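(* Let $\Lambda$ be a finite-dimensional basic split $k$-algebra with Jacobson radical $J$ satisfying $J^n=0$. Let $e_i,e_j$ be primitive idempotents with $V_{ij}=e_jJ^{n-1}e_i\neq 0$, let $m_{ij}=\dim_kV_{ij}$ and $1\le s\le m_{ij}$. Then the rank-$s$ terminal ambiguity fibre $\mathcal F^{<n,\mathrm{top},s}_{ij}$ carries the structure of a Grassmannian variety of dimension $$\dim\mathcal F^{<n,\mathrm{top},s}_{ij}=s(m_{ij}-s).$$
   Context: $k$ is a field; modules are finite-dimensional left $\Lambda$-modules, $n\ge 1$, $J^0=\Lambda$. Fix a complete set $e_1,\dots,e_t$ of primitive orthogonal idempotents of $\Lambda$, with $e_i,e_j$ among them; $\Lambda$ basic means the modules $\Lambda e_h$ are pairwise non-isomorphic, and split means $D_h=e_h\Lambda e_h/e_hJe_h\cong k$ for every $h$. Put $P_i=\Lambda e_i$ and $W_j=\bigoplus_{h\ne j}e_hJ^{n-1}P_i$. For a $k$-subspace $U\subseteq V_{ij}$ of codimension $s$ put $K_U=W_j\oplus U\subseteq J^{n-1}P_i$ (a $\Lambda$-submodule of $P_i$) and $M_U=P_i/K_U$. The rank-$s$ terminal ambiguity fibre is the set of isomorphism classes of $\Lambda$-modules $\mathcal F^{<n,\mathrm{top},s}_{ij}=\{M_U: U\in\operatorname{Gr}_k(m_{ij}-s,V_{ij})\}/\cong$. The variety structure on it is the one obtained by identifying it, via $U\leftrightarrow [M_U]$, with the Grassmannian $\operatorname{Gr}_k(m_{ij}-s,V_{ij})$ of $(m_{ij}-s)$-dimensional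 subspaces of $V_{ij}$. *)

theory Defs
  imports
    "Jordan_Normal_Form.Determinant"
    "HOL-Algebra.Ideal"
    "HOL-Library.Poly_Mapping"
    "HOL-Library.Extended_Real"
begin

section \<open>Left modules over a noncommutative ring\<close>

text \<open>The modules of \<open>HOL-Algebra\<close> and \<open>HOL.Modules\<close> are over commutative rings.\<close>

record ('r, 'm) lmodule =
  lcarrier :: "'m set"
  ladd :: "'m \<Rightarrow> 'm \<Rightarrow> 'm"
  lzero :: "'m"
  lsmult :: "'r \<Rightarrow> 'm \<Rightarrow> 'm"

definition lmodule_iso :: "('r, 'm) lmodule \<Rightarrow> ('r, 'n) lmodule \<Rightarrow> bool" where
  "lmodule_iso M N \<longleftrightarrow> (\<exists>f. bij_betw f (lcarrier M) (lcarrier N)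
     \<and> (\<forall>x\<in>lcarrier M. \<forall>y\<in>lcarrier M. f (ladd M x y) = ladd N (f x) (f y))
     \<and> (\<forall>r. \<forall>x\<in>lcarrier M. f (lsmult M r x) = lsmult N r (f x)))"

text \<open>
  The operations on cosets are complex operations on sets; on the cosets of a submodule \<open>K\<close>
  they are the usual ones, \<open>(x + K) + (y + K) = (x + y) + K\<close> and \<open>r (x + K) = r x + K\<close>.
\<close>

definition quotient_lmodule :: "('r, 'm) lmodule \<Rightarrow> 'm set \<Rightarrow> ('r, 'm set) lmodule" where
  "quotient_lmodule M K =
    \<lparr> lcarrier = (\<lambda>x. ladd M x ` K) ` lcarrier M,
      ladd = (\<lambda>A B. {ladd M a b |a b. a \<in> A \<and> b \<in> B}),
      lzero = K,
      lsmult = (\<lambda>r A. {ladd M (lsmult M r a) y |a y. a \<in> A \<and> y \<in> K}) \<rparr>"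

definition left_ideal_lmodule :: "'a::ring_1 set \<Rightarrow> ('a, 'a) lmodule" where
  "left_ideal_lmodule L = \<lparr> lcarrier = L, ladd = (+), lzero = 0, lsmult = (*) \<rparr>"


section \<open>Radical and idempotents\<close>

definition is_left_ideal :: "'a::ring_1 set \<Rightarrow> bool" where
  "is_left_ideal L \<longleftrightarrow> 0 \<in> L \<and> (\<forall>x\<in>L. \<forall>y\<in>L. x + y \<in> L) \<and> (\<forall>r. \<forall>x\<in>L. r * x \<in> L)"

definition is_maximal_left_ideal :: "'a::ring_1 set \<Rightarrow> bool" where
  "is_maximal_left_ideal L \<longleftrightarrow> is_left_ideal L \<and> L \<noteq> UNIV
     \<and> (\<forall>L'. is_left_ideal L' \<and> L \<subseteq> L' \<longrightarrow> L' = L \<or> L' = UNIV)"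

definition jacobson_radical :: "'a::ring_1 set" where
  "jacobson_radical = \<Inter> {L. is_maximal_left_ideal L}"

text \<open>The product of additive subgroups: all finite sums of products.\<close>

definition subgroup_product :: "'a::ring_1 set \<Rightarrow> 'a set \<Rightarrow> 'a set" where
  "subgroup_product A B = {sum_list (map (\<lambda>(a, b). a * b) ps) |ps. set ps \<subseteq> A \<times> B}"

primrec radical_power :: "nat \<Rightarrow> 'a::ring_1 set" where
  "radical_power 0 = UNIV"
| "radical_power (Suc n) = subgroup_product (radical_power n) jacobson_radical"

definition primitive_idempotent :: "'a::ring_1 \<Rightarrow> bool" where
  "primitive_idempotent x \<longleftrightarrow> x * x = x \<and> x \<noteq> 0
     \<and> \<not> (\<exists>f g. f * f = f \<and> g * g = g \<and> f \<noteq> 0 \<and> g \<noteq> 0 \<and> f * g = 0 \<and> g * f = 0 \<and> x = f + g)"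

definition complete_primitive_orthogonal :: "(nat \<Rightarrow> 'a::ring_1) \<Rightarrow> nat \<Rightarrow> bool" where
  "complete_primitive_orthogonal e t \<longleftrightarrow>
     (\<forall>h\<in>{1..t}. primitive_idempotent (e h))
     \<and> (\<forall>h\<in>{1..t}. \<forall>l\<in>{1..t}. h \<noteq> l \<longrightarrow> e h * e l = 0)
     \<and> (\<Sum>h\<in>{1..t}. e h) = 1"

definition proj_ideal :: "'a::ring_1 \<Rightarrow> 'a set" where
  "proj_ideal f = {x * f |x. True}"

definition corner :: "'a::ring_1 \<Rightarrow> 'a set \<Rightarrow> 'a \<Rightarrow> 'a set" where
  "corner f A g = {f * x * g |x. x \<in> A}"

definition basic_idempotents :: "(nat \<Rightarrow> 'a::ring_1) \<Rightarrow> nat \<Rightarrow> bool" where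
  "basic_idempotents e t \<longleftrightarrow> (\<forall>h\<in>{1..t}. \<forall>l\<in>{1..t}. h \<noteq> l \<longrightarrow>
     \<not> lmodule_iso (left_ideal_lmodule (proj_ideal (e h))) (left_ideal_lmodule (proj_ideal (e l))))"

locale fd_algebra = vector_space scale
  for scale :: "'k::field \<Rightarrow> 'a::ring_1 \<Rightarrow> 'a" +
  assumes scale_mult_left: "scale c x * y = scale c (x * y)"
    and scale_mult_right: "x * scale c y = scale c (x * y)"
    and finite_dim: "\<exists>B. finite B \<and> span B = UNIV"
begin

text \<open>
  \<open>D\<^sub>h\<close> is the set of cosets \<open>x + e\<^sub>h J e\<^sub>h\<close> with \<open>x \<in> e\<^sub>h \<Lambda> e\<^sub>h\<close>, and \<open>\<phi>\<close> below is an
  isomorphism of \<open>k\<close>-algebras from \<open>D\<^sub>h\<close> to \<open>k\<close>, its unit being the coset of \<open>e\<^sub>h\<close>.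
\<close>

definition split_idempotents :: "(nat \<Rightarrow> 'a) \<Rightarrow> nat \<Rightarrow> bool" where
  "split_idempotents e t \<longleftrightarrow> (\<forall>h\<in>{1..t}.
     let L = corner (e h) UNIV (e h);
         cs = (\<lambda>x. (+) x ` corner (e h) jacobson_radical (e h))
     in \<exists>\<phi> :: 'a set \<Rightarrow> 'k. bij_betw \<phi> (cs ` L) UNIV
        \<and> \<phi> (cs (e h)) = 1
        \<and> (\<forall>x\<in>L. \<forall>y\<in>L. \<phi> (cs (x + y)) = \<phi> (cs x) + \<phi> (cs y))
        \<and> (\<forall>x\<in>L. \<forall>y\<in>L. \<phi> (cs (x * y)) = \<phi> (cs x) * \<phi> (cs y))
        \<and> (\<forall>c. \<forall>x\<in>L. \<phi> (cs (scale c x)) = c * \<phi> (cs x)))"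

end


section \<open>Terminal ambiguity fibres\<close>

definition peirce_top :: "(nat \<Rightarrow> 'a::ring_1) \<Rightarrow> nat \<Rightarrow> nat \<Rightarrow> nat \<Rightarrow> 'a set" where
  "peirce_top e n i j = corner (e j) (radical_power (n - 1)) (e i)"

definition W_sum :: "(nat \<Rightarrow> 'a::ring_1) \<Rightarrow> nat \<Rightarrow> nat \<Rightarrow> nat \<Rightarrow> nat \<Rightarrow> 'a set" where
  "W_sum e t n i j = {\<Sum>h\<in>{1..t} - {j}. w h |w.
     \<forall>h\<in>{1..t} - {j}. w h \<in> (*) (e h) ` subgroup_product (radical_power (n - 1)) (proj_ideal (e i))}"

definition K_sub :: "(nat \<Rightarrow> 'a::ring_1) \<Rightarrow> nat \<Rightarrow> nat \<Rightarrow> nat \<Rightarrow> nat \<Rightarrow> 'a set \<Rightarrow> 'a set" where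
  "K_sub e t n i j U = {w + u |w u. w \<in> W_sum e t n i j \<and> u \<in> U}"

definition M_quot ::
  "(nat \<Rightarrow> 'a::ring_1) \<Rightarrow> nat \<Rightarrow> nat \<Rightarrow> nat \<Rightarrow> nat \<Rightarrow> 'a set \<Rightarrow> ('a, 'a set) lmodule" where
  "M_quot e t n i j U =
     quotient_lmodule (left_ideal_lmodule (proj_ideal (e i))) (K_sub e t n i j U)"

definition iso_on :: "('r, 'm) lmodule set \<Rightarrow> (('r, 'm) lmodule \<times> ('r, 'm) lmodule) set" where
  "iso_on S = {(M, N). M \<in> S \<and> N \<in> S \<and> lmodule_iso M N}"

context fd_algebra
begin

definition Gr :: "nat \<Rightarrow> 'a set \<Rightarrow> 'a set set" where
  "Gr d V = {U. subspace U \<and> U \<subseteq> V \<and> dim U = d}"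

definition fibre_modules ::
  "(nat \<Rightarrow> 'a) \<Rightarrow> nat \<Rightarrow> nat \<Rightarrow> nat \<Rightarrow> nat \<Rightarrow> nat \<Rightarrow> ('a, 'a set) lmodule set" where
  "fibre_modules e t n i j s =
     M_quot e t n i j ` Gr (dim (peirce_top e n i j) - s) (peirce_top e n i j)"

definition ambiguity_fibre ::
  "(nat \<Rightarrow> 'a) \<Rightarrow> nat \<Rightarrow> nat \<Rightarrow> nat \<Rightarrow> nat \<Rightarrow> nat \<Rightarrow> ('a, 'a set) lmodule set set" where
  "ambiguity_fibre e t n i j s = fibre_modules e t n i j s // iso_on (fibre_modules e t n i j s)"

definition fibre_class ::
  "(nat \<Rightarrow> 'a) \<Rightarrow> nat \<Rightarrow> nat \<Rightarrow> nat \<Rightarrow> nat \<Rightarrow> nat \<Rightarrow> 'a set \<Rightarrow> ('a, 'a set) lmodule set" where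
  "fibre_class e t n i j s U = iso_on (fibre_modules e t n i j s) `` {M_quot e t n i j U}"

end


section \<open>Projective varieties over a field\<close>

type_synonym ('b, 'k) mpolynomial = "('b \<Rightarrow>\<^sub>0 nat) \<Rightarrow>\<^sub>0 'k"

definition pvar :: "'b \<Rightarrow> ('b, 'k::field) mpolynomial" where
  "pvar v = Poly_Mapping.single (Poly_Mapping.single v 1) 1"

definition pconst :: "'k \<Rightarrow> ('b, 'k::field) mpolynomial" where
  "pconst c = Poly_Mapping.single 0 c"

text \<open>\<open>poly_subst \<phi> g f\<close> applies \<open>\<phi>\<close> to the coefficients and replaces each variable \<open>v\<close> by \<open>g v\<close>.\<close>

definition poly_subst ::
  "('k::field \<Rightarrow> 'c::comm_ring_1) \<Rightarrow> ('b \<Rightarrow> 'c) \<Rightarrow> ('b, 'k) mpolynomial \<Rightarrow> 'c" where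
  "poly_subst \<phi> g f = (\<Sum>\<mu>\<in>Poly_Mapping.keys f. \<phi> (Poly_Mapping.lookup f \<mu>) *
     (\<Prod>v\<in>Poly_Mapping.keys \<mu>. g v ^ Poly_Mapping.lookup \<mu> v))"

definition poly_ring_on :: "'b set \<Rightarrow> ('b, 'k::field) mpolynomial ring" where
  "poly_ring_on B = \<lparr> carrier = {f. \<forall>\<mu>\<in>Poly_Mapping.keys f. Poly_Mapping.keys \<mu> \<subseteq> B},
     mult = (*), one = 1, zero = 0, add = (+) \<rparr>"

definition hom_component :: "nat \<Rightarrow> ('b, 'k::field) mpolynomial \<Rightarrow> ('b, 'k) mpolynomial" where
  "hom_component D f =
     (\<Sum>\<mu> | \<mu> \<in> Poly_Mapping.keys f \<and>
            (\<Sum>v\<in>Poly_Mapping.keys \<mu>. Poly_Mapping.lookup \<mu> v) = D.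
        Poly_Mapping.single \<mu> (Poly_Mapping.lookup f \<mu>))"

text \<open>
  \<open>Proj_points B I\<close> is the underlying set of the scheme \<open>Proj (k[B]/I)\<close>: the homogeneous primes
  of \<open>k[B]\<close> that contain \<open>I\<close> but not the irrelevant ideal. Its Krull dimension is computed
  by chains of such primes, since the irreducible closed subsets are the closures of points.
  The empty scheme gets dimension \<open>-\<infinity>\<close>.
\<close>

definition Proj_points ::
  "'b set \<Rightarrow> ('b, 'k::field) mpolynomial set \<Rightarrow> ('b, 'k) mpolynomial set set" where
  "Proj_points B I = {P. primeideal P (poly_ring_on B)
     \<and> (\<forall>f\<in>P. \<forall>D. hom_component D f \<in> P) \<and> I \<subseteq> P \<and> \<not> pvar ` B \<subseteq> P}"

definition Proj_dim :: "'b set \<Rightarrow> ('b, 'k::field) mpolynomial set \<Rightarrow> ereal" where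
  "Proj_dim B I = Sup {ereal (real L) |L. \<exists>P. (\<forall>l\<le>L. P l \<in> Proj_points B I) \<and>
     (\<forall>l<L. P l \<subset> P (Suc l))}"

text \<open>A point of projective space is a punctured line, vectors being extended by \<open>0\<close> outside \<open>B\<close>.\<close>

definition proj_line :: "('b \<Rightarrow> 'k::field) \<Rightarrow> ('b \<Rightarrow> 'k) set" where
  "proj_line v = {\<lambda>I. c * v I |c. c \<noteq> 0}"

definition rational_points ::
  "'b set \<Rightarrow> ('b, 'k::field) mpolynomial set \<Rightarrow> ('b \<Rightarrow> 'k) set set" where
  "rational_points B I = {proj_line v |v. (\<exists>b\<in>B. v b \<noteq> 0) \<and> (\<forall>b. b \<notin> B \<longrightarrow> v b = 0)
     \<and> (\<forall>f\<in>I. poly_subst (\<lambda>c. c) v f = 0)}"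

text \<open>
  The structure of a projective variety over \<open>k\<close> on a set \<open>X\<close>: an integral closed subscheme
  \<open>Proj (k[B]/I)\<close> of a projective space, with an identification of \<open>X\<close> with its set of
  \<open>k\<close>-points. The ideal is part of the data because \<open>k\<close> need not be algebraically closed; for
  finite \<open>k\<close> the \<open>k\<close>-points alone would not determine the dimension.
\<close>

record (overloaded) ('x, 'b, 'k) variety_structure =
  vpoints :: "'x set"
  vcoords :: "'b set"
  videal :: "('b, 'k) mpolynomial set"
  vembed :: "'x \<Rightarrow> ('b \<Rightarrow> 'k) set"

definition projective_variety :: "('x, 'b, 'k::field) variety_structure \<Rightarrow> bool" where
  "projective_variety X \<longleftrightarrow> finite (vcoords X)
     \<and> videal X \<in> Proj_points (vcoords X) (videal X)
     \<and> bij_betw (vembed X) (vpoints X) (rational_points (vcoords X) (videal X))"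

definition variety_dim :: "('x, 'b, 'k::field) variety_structure \<Rightarrow> ereal" where
  "variety_dim X = Proj_dim (vcoords X) (videal X)"

definition transport_structure ::
  "('x \<Rightarrow> 'y) \<Rightarrow> ('x, 'b, 'k) variety_structure \<Rightarrow> ('y, 'b, 'k) variety_structure" where
  "transport_structure g X = \<lparr> vpoints = g ` vpoints X, vcoords = vcoords X, videal = videal X,
     vembed = (\<lambda>y. vembed X (inv_into (vpoints X) g y)) \<rparr>"


section \<open>Grassmannians in their Pluecker embedding\<close>

definition plucker_index :: "nat \<Rightarrow> nat \<Rightarrow> nat set set" where
  "plucker_index d m = {I. I \<subseteq> {..<m} \<and> card I = d}"

definition minor :: "nat \<Rightarrow> (nat \<Rightarrow> nat \<Rightarrow> 'c::comm_ring_1) \<Rightarrow> nat set \<Rightarrow> 'c" where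
  "minor d A I = det (mat d d (\<lambda>(a, c). A a (sorted_list_of_set I ! c)))"

text \<open>
  The ideal of all relations between the maximal minors of a generic \<open>d \<times> m\<close> matrix with
  entries \<open>pvar (Some (a, l))\<close>. The extra variable \<open>pvar None\<close> makes the kernel
  homogeneous also for \<open>d = 0\<close>, where the only minor is \<open>1\<close>; for \<open>d > 0\<close> it does not change
  the kernel.
\<close>

definition plucker_ideal :: "nat \<Rightarrow> nat \<Rightarrow> (nat set, 'k::field) mpolynomial set" where
  "plucker_ideal d m = {f \<in> carrier (poly_ring_on (plucker_index d m)).
     poly_subst pconst
       (\<lambda>I. pvar None * minor d (\<lambda>a l. pvar (Some (a, l)) :: ((nat \<times> nat) option, 'k) mpolynomial) I)
       f = 0}"

context fd_algebra
begin

definition ordered_basis :: "(nat \<Rightarrow> 'a) \<Rightarrow> nat \<Rightarrow> 'a set \<Rightarrow> bool" where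
  "ordered_basis b m V \<longleftrightarrow> inj_on b {..<m} \<and> independent (b ` {..<m}) \<and> span (b ` {..<m}) = V"

definition plucker_vector ::
  "(nat \<Rightarrow> 'a) \<Rightarrow> nat \<Rightarrow> nat \<Rightarrow> (nat \<Rightarrow> 'a) \<Rightarrow> nat set \<Rightarrow> 'k" where
  "plucker_vector b m d u I = (if I \<in> plucker_index d m
     then minor d (\<lambda>a l. representation (b ` {..<m}) (u a) (b l)) I else 0)"

text \<open>
  The lines of the Pluecker vectors of the bases of \<open>U\<close> all coincide, so the union is that line.
\<close>

definition plucker_point :: "(nat \<Rightarrow> 'a) \<Rightarrow> nat \<Rightarrow> nat \<Rightarrow> 'a set \<Rightarrow> (nat set \<Rightarrow> 'k) set" where
  "plucker_point b m d U = \<Union> {proj_line (plucker_vector b m d u) |u. ordered_basis u d U}"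

text \<open>
  The Grassmannian of \<open>d\<close>-dimensional subspaces of the space with ordered basis
  \<open>b 0, \<dots>, b (m - 1)\<close>. Another basis changes it by a linear change of the coordinates only.
\<close>

definition Grassmannian :: "(nat \<Rightarrow> 'a) \<Rightarrow> nat \<Rightarrow> nat \<Rightarrow> ('a set, nat set, 'k) variety_structure" where
  "Grassmannian b m d = \<lparr> vpoints = Gr d (span (b ` {..<m})),
     vcoords = plucker_index d m, videal = plucker_ideal d m, vembed = plucker_point b m d \<rparr>"

end

end

theory Submission
  imports Defs "HOL-Library.Product_Lexorder"
begin

text \<open>
  Two things have to be shown: that \<open>U \<mapsto> [M\<^sub>U]\<close> is a bijection, and that the Grassmannian in its
  Pluecker embedding is an integral projective variety of dimension \<open>s (m - s)\<close> whose rational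
  points are the subspaces.

  \<^bold>\<open>The bijection.\<close> The algebra being basic and split, every \<open>e\<^sub>j r e\<^sub>h\<close> with \<open>h \<noteq> j\<close> lies in the
  radical \<open>J\<close> and every \<open>e\<^sub>j r e\<^sub>j\<close> is a scalar multiple of \<open>e\<^sub>j\<close> modulo \<open>J\<close>; as \<open>J\<close> annihilates
  \<open>J\<^bsup>n-1\<^esup>\<close>, left multiplication acts on \<open>e\<^sub>j J\<^bsup>n-1\<^esup> e\<^sub>i\<close> through scalars, and \<open>K\<^sub>U\<close> is a left ideal.
  A homomorphism \<open>M\<^sub>U \<rightarrow> M\<^bsub>U'\<^esub>\<close> is right multiplication by some \<open>x = c e\<^sub>i + y\<close> with \<open>y \<in> J\<close>, and
  \<open>J\<^bsup>n-1\<^esup> J = 0\<close> makes it the scalar \<open>c\<close> on \<open>V\<^bsub>ij\<^esub>\<close>. Were \<open>c = 0\<close>, an isomorphism would kill all of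
  \<open>V\<^bsub>ij\<^esub>\<close>, which is impossible because \<open>s > 0\<close> makes \<open>U\<close> a proper subspace. So \<open>c \<noteq> 0\<close>, hence
  \<open>U \<subseteq> U'\<close>, and equality follows by dimension (\<open>M_quot_iso_imp_subset\<close>).

  \<^bold>\<open>Integrality.\<close> The ideal of relations is the kernel of a graded homomorphism into the
  polynomial ring \<open>R[T]\<close> over the domain \<open>R\<close> of polynomials in the entries of a generic matrix, so it
  is a homogeneous prime (\<open>plucker_ideal_eq_graded_kernel\<close>, \<open>graded_kernel_in_Proj_points\<close>).

  \<^bold>\<open>Rational points.\<close> Fix an index set \<open>I\<close> with \<open>p\<^sub>I \<noteq> 0\<close>. By Cramer's rule the rows of
  \<open>adj(A\<^sub>I) A\<close> have, up to sign, the Pluecker coordinates \<open>p\<^bsub>I - a + l\<^esub>\<close> as entries. They lie in the row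
  space of \<open>A\<close> and span it, so the coordinates determine the subspace. Taking determinants,
  \<open>p\<^sub>I det((\<plusminus>p\<^bsub>I - a + l\<^esub>)\<^sub>J) = p\<^sub>J p\<^sub>I\<^sup>d\<close>; this single family of relations already forces a point of the
  variety to be the minor vector of the matrix \<open>(\<plusminus>p\<^bsub>I - a + l\<^esub>)\<close>.

  \<^bold>\<open>Dimension.\<close> The affine chart \<open>(1 | Y)\<close>, with \<open>Y\<close> a generic \<open>d \<times> (m - d)\<close> matrix, has the same
  relations as the full generic matrix, since the two differ by an invertible matrix over the fraction
  field (\<open>chart_kernel_eq_plucker_ideal\<close>). Setting the entries of \<open>Y\<close> to zero one after another gives
  a chain of \<open>d (m - d)\<close> strict inclusions of homogeneous primes. Conversely, in any chain of primes
  an element of each step outside the previous one can be added to an algebraically independent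
  family (\<open>alg_indep_mod_extend\<close>), so a chain of length \<open>L\<close>, prolonged by the irrelevant ideal, gives
  \<open>L + 1\<close> elements independent modulo the relations, whose images in a polynomial ring in
  \<open>d (m - d) + 1\<close> variables are then independent; counting monomials bounds their number (\<open>algebraically_dependent\<close>).
\<close>

section \<open>The Jacobson radical and its powers\<close>

lemma left_idealD:
  assumes "is_left_ideal L"
  shows "0 \<in> L" "x \<in> L \<Longrightarrow> y \<in> L \<Longrightarrow> x + y \<in> L" "x \<in> L \<Longrightarrow> r * x \<in> L"
    "x \<in> L \<Longrightarrow> - x \<in> L" "x \<in> L \<Longrightarrow> y \<in> L \<Longrightarrow> x - y \<in> L"
proof -
  show *: "0 \<in> L" "\<And>x y. x \<in> L \<Longrightarrow> y \<in> L \<Longrightarrow> x + y \<in> L" "\<And>x r. x \<in> L \<Longrightarrow> r * x \<in> L"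
    using assms by (auto simp: is_left_ideal_def)
  show uminus: "- x \<in> L" if "x \<in> L" for x
    using *(3)[OF that, of "- 1"] by simp
  show "x - y \<in> L" if "x \<in> L" "y \<in> L" for x y
    using *(2)[OF that(1) uminus[OF that(2)]] by simp
qed

lemma left_ideal_UNIV_iff: "is_left_ideal L \<Longrightarrow> 1 \<in> L \<longleftrightarrow> L = UNIV"
  using left_idealD(3)[of L 1] by auto

lemma left_ideal_sum_principal:
  assumes "is_left_ideal (L :: 'a::ring_1 set)"
  shows "is_left_ideal {r * x + l |r l. l \<in> L}"
  unfolding is_left_ideal_def
proof (intro conjI ballI allI)
  show "0 \<in> {r * x + l |r l. l \<in> L}" using left_idealD(1)[OF assms] by (auto intro!: exI[of _ 0])
  fix u assume "u \<in> {r * x + l |r l. l \<in> L}"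
  then obtain r l where u: "u = r * x + l" "l \<in> L" by auto
  have "s * u = (s * r) * x + s * l" for s using u by (simp add: distrib_left mult.assoc)
  then show "s * u \<in> {r * x + l |r l. l \<in> L}" for s
    using u left_idealD(3)[OF assms] by blast
  fix v assume "v \<in> {r * x + l |r l. l \<in> L}"
  then obtain r' l' where v: "v = r' * x + l'" "l' \<in> L" by auto
  have "u + v = (r + r') * x + (l + l')" using u v by (simp add: distrib_right)
  then show "u + v \<in> {r * x + l |r l. l \<in> L}"
    using u v left_idealD(2)[OF assms] by blast
qed

lemma maximal_left_ideal_generates:
  assumes "is_maximal_left_ideal (L :: 'a::ring_1 set)" "x \<notin> L"
  obtains r l where "y = r * x + l" "l \<in> L"
proof -
  let ?S = "{r * x + l |r l. l \<in> L}"
  have L: "is_left_ideal L" using assms by (simp add: is_maximal_left_ideal_def)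
  have "l = 0 * x + l" for l by simp
  then have "L \<subseteq> ?S" by blast
  moreover have "x = 1 * x + 0" by simp
  then have "x \<in> ?S" using left_idealD(1)[OF L] by blast
  ultimately have "?S = UNIV"
    using assms left_ideal_sum_principal[OF L, of x] unfolding is_maximal_left_ideal_def by blast
  then show thesis using that by blast
qed

lemma left_ideal_jacobson_radical: "is_left_ideal (jacobson_radical :: 'a::ring_1 set)"
proof -
  have "is_left_ideal (\<Inter> S)" if "\<forall>L\<in>S. is_left_ideal L" for S :: "'a set set"
    using that by (simp add: is_left_ideal_def)
  then show ?thesis by (simp add: jacobson_radical_def is_maximal_left_ideal_def)
qed

text \<open>
  For a maximal left ideal \<open>L\<close> and an element \<open>a \<notin> L\<close>, the left ideal of all \<open>x\<close> with
  \<open>x a \<in> L\<close> is again maximal: it is the annihilator of the image of \<open>a\<close> in the simple module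
  \<open>\<Lambda> / L\<close>. The radical is contained in it.
\<close>

lemma jacobson_radical_right:
  assumes "(x :: 'a::ring_1) \<in> jacobson_radical"
  shows "x * a \<in> jacobson_radical"
  unfolding jacobson_radical_def
proof (rule InterI, clarify)
  fix L :: "'a set" assume L: "is_maximal_left_ideal L"
  then have L': "is_left_ideal L" by (simp add: is_maximal_left_ideal_def)
  show "x * a \<in> L"
  proof (cases "a \<in> L")
    case True
    then show ?thesis using left_idealD(3)[OF L'] by blast
  next
    case False
    let ?Q = "{x. x * a \<in> L}"
    have Q: "is_left_ideal ?Q"
      using left_idealD[OF L'] by (auto simp: is_left_ideal_def algebra_simps)
    have "is_maximal_left_ideal ?Q"
      unfolding is_maximal_left_ideal_def
    proof (intro conjI allI impI)
      have "1 \<notin> ?Q" using False by simp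
      then show "?Q \<noteq> UNIV" by blast
      fix N assume N: "is_left_ideal N \<and> ?Q \<subseteq> N"
      show "N = ?Q \<or> N = UNIV"
      proof (rule disjCI)
        assume "N \<noteq> UNIV"
        show "N = ?Q"
        proof (rule ccontr)
          assume "N \<noteq> ?Q"
          then obtain l where l: "l \<in> N" "l * a \<notin> L" using N by blast
          obtain r k where k: "a = r * (l * a) + k" "k \<in> L"
            by (rule maximal_left_ideal_generates[OF L l(2)])
          have "(1 - r * l) * a = k" using k(1) by (simp add: algebra_simps)
          then have "1 - r * l \<in> N" using N k(2) by blast
          then have "1 - r * l + r * l \<in> N" using left_idealD(2,3) N l(1) by metis
          then show False using left_ideal_UNIV_iff N \<open>N \<noteq> UNIV\<close> by auto
        qed
      qed
    qed (fact Q)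
    then show ?thesis using assms by (auto simp: jacobson_radical_def)
  qed
qed

text \<open>
  If \<open>x\<close> were outside a maximal left ideal \<open>L\<close>, then \<open>1 - r x \<in> L\<close> for some \<open>r\<close>; but \<open>1 - r x\<close>
  is invertible, \<open>r x\<close> being nilpotent.
\<close>

lemma nil_left_ideal_in_jacobson_radical:
  assumes "\<And>r :: 'a::ring_1. \<exists>k. (r * x) ^ k = 0"
  shows "x \<in> jacobson_radical"
  unfolding jacobson_radical_def
proof (rule InterI, clarify)
  fix L :: "'a set" assume L: "is_maximal_left_ideal L"
  then have L': "is_left_ideal L" by (simp add: is_maximal_left_ideal_def)
  show "x \<in> L"
  proof (rule ccontr)
    assume "x \<notin> L"
    then obtain r l where l: "1 = r * x + l" "l \<in> L"
      using maximal_left_ideal_generates[OF L] by blast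
    obtain k where k: "(r * x) ^ k = 0" using assms by blast
    have "1 - (r * x) ^ i \<in> L" for i
    proof (induction i)
      case 0
      then show ?case using left_idealD(1)[OF L'] by simp
    next
      case (Suc i)
      have "1 - (r * x) ^ Suc i = l + (r * x) * (1 - (r * x) ^ i)"
        by (subst (1) l(1)) (simp add: algebra_simps)
      then show ?case using Suc l(2) left_idealD(2,3)[OF L'] by simp
    qed
    from this[of k] have "1 \<in> L" using k by simp
    then show False using L left_ideal_UNIV_iff[OF L'] by (auto simp: is_maximal_left_ideal_def)
  qed
qed

lemma subgroup_product_add:
  assumes "x \<in> subgroup_product A B" "y \<in> subgroup_product A B"
  shows "x + y \<in> subgroup_product A B"
proof -
  obtain ps qs where "x = sum_list (map (\<lambda>(a, b). a * b) ps)" "set ps \<subseteq> A \<times> B"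
    "y = sum_list (map (\<lambda>(a, b). a * b) qs)" "set qs \<subseteq> A \<times> B"
    using assms by (auto simp: subgroup_product_def)
  then show ?thesis by (auto simp: subgroup_product_def intro!: exI[of _ "ps @ qs"])
qed

lemma subgroup_product_zero: "0 \<in> subgroup_product A B"
  by (auto simp: subgroup_product_def intro!: exI[of _ "[]"])

lemma subgroup_product_mult: "a \<in> A \<Longrightarrow> b \<in> B \<Longrightarrow> a * b \<in> subgroup_product A B"
  by (auto simp: subgroup_product_def intro!: exI[of _ "[(a, b)]"])

lemma subgroup_product_induct [consumes 1, case_names zero add]:
  assumes "x \<in> subgroup_product A B" "P 0"
    "\<And>a b y. a \<in> A \<Longrightarrow> b \<in> B \<Longrightarrow> y \<in> subgroup_product A B \<Longrightarrow> P y \<Longrightarrow> P (a * b + y)"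
  shows "P x"
proof -
  have "set ps \<subseteq> A \<times> B \<Longrightarrow> P (sum_list (map (\<lambda>(a, b). a * b) ps))" for ps
  proof (induction ps)
    case (Cons p ps)
    then have "sum_list (map (\<lambda>(a, b). a * b) ps) \<in> subgroup_product A B"
      unfolding subgroup_product_def by auto
    then show ?case
      using Cons assms(3)[of "fst p" "snd p" "sum_list (map (\<lambda>(a, b). a * b) ps)"]
      by (cases p) auto
  qed (simp add: assms(2))
  then show ?thesis using assms(1) by (auto simp: subgroup_product_def)
qed

lemma left_ideal_radical_power: "is_left_ideal (radical_power n :: 'a::ring_1 set)"
proof (induction n)
  case 0
  then show ?case by (simp add: is_left_ideal_def)
next
  case (Suc n)
  have "r * x \<in> radical_power (Suc n)" if "x \<in> radical_power (Suc n)" for r x :: 'a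
    using that unfolding radical_power.simps
  proof (induction rule: subgroup_product_induct)
    case (add a b y)
    have "r * a * b \<in> subgroup_product (radical_power n) jacobson_radical"
      using add left_idealD(3)[OF Suc] by (intro subgroup_product_mult) auto
    with add show ?case by (simp add: distrib_left subgroup_product_add mult.assoc)
  qed (simp add: subgroup_product_zero)
  then show ?case by (auto simp: is_left_ideal_def subgroup_product_add subgroup_product_zero)
qed

lemma radical_power_right: "x \<in> radical_power n \<Longrightarrow> x * a \<in> radical_power n"
proof (cases n)
  case (Suc k)
  assume "x \<in> radical_power n"
  then show ?thesis
    unfolding Suc radical_power.simps
  proof (induction rule: subgroup_product_induct)
    case (add u v y)
    have "u * (v * a) \<in> subgroup_product (radical_power k) jacobson_radical"
      using add jacobson_radical_right by (intro subgroup_product_mult) auto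
    with add show ?case by (simp add: distrib_right subgroup_product_add mult.assoc)
  qed (simp add: subgroup_product_zero)
qed simp

lemma radical_power_mult_right:
  "x \<in> radical_power n \<Longrightarrow> y \<in> jacobson_radical \<Longrightarrow> x * y \<in> radical_power (Suc n)"
  by (simp add: subgroup_product_mult)

text \<open>
  The powers are defined by multiplying with \<open>J\<close> on the right; here \<open>J\<close> is multiplied on the left.
  Both sides are needed, as \<open>J\<^bsup>n-1\<^esup>\<close> has to be annihilated by \<open>J\<close> from either side.
\<close>

lemma radical_power_mult_left:
  assumes "x \<in> jacobson_radical" "y \<in> radical_power n"
  shows "x * y \<in> radical_power (Suc n)"
  using assms(2)
proof (induction n arbitrary: y)
  case 0
  have "1 * (x * y) \<in> radical_power (Suc 0)"
    using jacobson_radical_right[OF assms(1)] by (intro radical_power_mult_right) auto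
  then show ?case by simp
next
  case (Suc n)
  from Suc.prems show ?case
    unfolding radical_power.simps(2)[of n]
  proof (induction rule: subgroup_product_induct)
    case zero
    then show ?case using left_idealD(1)[OF left_ideal_radical_power, of "Suc (Suc n)"] by simp
  next
    case (add a b y)
    have "x * a * b \<in> radical_power (Suc (Suc n))"
      using radical_power_mult_right[OF Suc.IH] add by blast
    with add show ?case
      using left_idealD(2)[OF left_ideal_radical_power, of _ "Suc (Suc n)"]
      by (simp add: distrib_left mult.assoc del: radical_power.simps)
  qed
qed

lemma power_in_radical_power: "x \<in> jacobson_radical \<Longrightarrow> x ^ n \<in> radical_power n"
proof (induction n)
  case (Suc n)
  then show ?case using radical_power_mult_right[of "x ^ n" n x] by (simp add: power_Suc2 del: radical_power.simps power_Suc)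
qed simp

section \<open>Peirce components of a basic split algebra\<close>

context fd_algebra
begin

lemma ex_finite_basis: "\<exists>B. finite_dimensional_vector_space scale B"
proof -
  obtain S where S: "finite S" "span S = UNIV" using finite_dim by blast
  obtain B where B: "B \<subseteq> UNIV" "independent B" "UNIV \<subseteq> span B" by (rule basis_exists[of UNIV])
  have "finite B" using independent_span_bound[OF S(1) B(2)] S(2) by simp
  moreover have "span B = UNIV" using B(3) by blast
  ultimately have "finite_dimensional_vector_space scale B"
    using B(2) by (intro finite_dimensional_vector_space.intro vector_space_axioms
        finite_dimensional_vector_space_axioms.intro)
  then show ?thesis by blast
qed

lemma subspace_eq_of_dim: "subspace U \<Longrightarrow> subspace W \<Longrightarrow> U \<subseteq> W \<Longrightarrow> dim W \<le> dim U \<Longrightarrow> U = W"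
proof -
  obtain B where "finite_dimensional_vector_space scale B" using ex_finite_basis by blast
  then interpret finite_dimensional_vector_space scale B .
  show "subspace U \<Longrightarrow> subspace W \<Longrightarrow> U \<subseteq> W \<Longrightarrow> dim W \<le> dim U \<Longrightarrow> U = W"
    by (rule subspace_dim_equal)
qed

end

locale basic_split_algebra = fd_algebra scale
  for scale :: "'k::field \<Rightarrow> 'a::ring_1 \<Rightarrow> 'a" +
  fixes e :: "nat \<Rightarrow> 'a" and t n :: nat
  assumes idempotents: "complete_primitive_orthogonal e t"
    and basic: "basic_idempotents e t"
    and split: "split_idempotents e t"
    and n_pos: "n \<ge> 1"
    and nilpotent: "radical_power n = ({0} :: 'a set)"
begin

abbreviation J :: "'a set" where "J \<equiv> jacobson_radical"

lemma left_ideal_J: "is_left_ideal J"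
  and left_ideal_top_powers: "is_left_ideal (radical_power k :: 'a set)"
  by (rule left_ideal_jacobson_radical left_ideal_radical_power)+

lemma J_right: "x \<in> J \<Longrightarrow> x * a \<in> J"
  and top_powers_right: "x \<in> radical_power k \<Longrightarrow> x * a \<in> radical_power k" for x :: 'a
  by (rule jacobson_radical_right radical_power_right; assumption)+

lemma e_idem: "h \<in> {1..t} \<Longrightarrow> e h * e h = e h"
  and e_nonzero: "h \<in> {1..t} \<Longrightarrow> e h \<noteq> 0"
  and e_orth: "h \<in> {1..t} \<Longrightarrow> l \<in> {1..t} \<Longrightarrow> h \<noteq> l \<Longrightarrow> e h * e l = 0"
  and e_sum: "(\<Sum>h\<in>{1..t}. e h) = 1"
  using idempotents by (auto simp: complete_primitive_orthogonal_def primitive_idempotent_def)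

lemma e_idem_left: "h \<in> {1..t} \<Longrightarrow> e h * (e h * x) = e h * x"
  by (simp add: mult.assoc[symmetric] e_idem)

lemma in_proj_ideal_iff:
  assumes "i \<in> {1..t}"
  shows "x \<in> proj_ideal (e i) \<longleftrightarrow> x * e i = x"
proof
  show "x * e i = x" if "x \<in> proj_ideal (e i)"
    using that by (auto simp: proj_ideal_def mult.assoc e_idem[OF assms])
  show "x \<in> proj_ideal (e i)" if "x * e i = x"
    unfolding proj_ideal_def by (intro CollectI exI[of _ x]) (simp add: that)
qed

lemma scale_eq_mult: "scale c x = scale c 1 * x"
  by (simp add: scale_mult_left)

lemma left_ideal_scale: "is_left_ideal L \<Longrightarrow> x \<in> L \<Longrightarrow> scale c x \<in> L"
  using left_idealD(3)[of L x "scale c 1"] by (simp add: scale_eq_mult[symmetric])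

lemma J_nil: "x \<in> J \<Longrightarrow> x ^ n = 0"
  using power_in_radical_power[of x n] nilpotent by auto

lemma top_power_annihilated:
  assumes "x \<in> radical_power (n - 1)" "y \<in> J"
  shows "x * y = 0" "y * x = 0"
proof -
  have "Suc (n - 1) = n" using n_pos by simp
  then show "x * y = 0" "y * x = 0"
    using radical_power_mult_right[OF assms] radical_power_mult_left[OF assms(2,1)] nilpotent
    by (auto simp del: radical_power.simps)
qed

text \<open>
  This is how the splitting hypothesis \<open>D\<^sub>h \<cong> k\<close> is used: modulo \<open>J\<close> the corner \<open>e\<^sub>h \<Lambda> e\<^sub>h\<close>
  consists of scalars.
\<close>

lemma corner_local:
  assumes h: "h \<in> {1..t}"
  obtains c y where "e h * r * e h = scale c (e h) + y" "y \<in> J" "e h * y = y" "y * e h = y"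
proof -
  let ?L = "corner (e h) UNIV (e h)"
  let ?cs = "\<lambda>x. (+) x ` corner (e h) J (e h)"
  obtain \<phi> :: "'a set \<Rightarrow> 'k" where bij: "bij_betw \<phi> (?cs ` ?L) UNIV" and one: "\<phi> (?cs (e h)) = 1"
    and sc: "\<And>c x. x \<in> ?L \<Longrightarrow> \<phi> (?cs (scale c x)) = c * \<phi> (?cs x)"
    using split[unfolded split_idempotents_def Let_def, rule_format, OF h] by auto
  let ?x = "e h * r * e h"
  have x: "?x \<in> ?L" by (auto simp: corner_def)
  have eL: "e h \<in> ?L" using e_idem[OF h] by (auto simp: corner_def intro!: exI[of _ 1])
  define c where "c = \<phi> (?cs ?x)"
  have "scale c (e h) = e h * scale c 1 * e h"
    by (simp add: scale_mult_left scale_mult_right e_idem[OF h])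
  then have cL: "scale c (e h) \<in> ?L" by (auto simp: corner_def)
  have "\<phi> (?cs (scale c (e h))) = \<phi> (?cs ?x)" using sc[OF eL, of c] one by (simp add: c_def)
  then have "?cs (scale c (e h)) = ?cs ?x"
    using bij_betw_imp_inj_on[OF bij] x cL by (simp add: inj_on_def)
  moreover have "?x \<in> ?cs ?x"
    using left_idealD(1)[OF left_ideal_J] by (force simp: corner_def)
  ultimately obtain y where y: "?x = scale c (e h) + y" "y \<in> corner (e h) J (e h)" by blast
  then obtain z where z: "z \<in> J" "y = e h * z * e h" by (auto simp: corner_def)
  show thesis
  proof (rule that[OF y(1)])
    show "y \<in> J" using z left_idealD(3)[OF left_ideal_J] J_right by auto
    show "e h * y = y" using z e_idem[OF h] by (simp add: mult.assoc[symmetric])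
    show "y * e h = y" using z e_idem[OF h] by (simp add: mult.assoc)
  qed
qed

text \<open>
  Up to a nonzero scalar such an element is \<open>e\<^sub>h - u\<close> with \<open>u\<close> nilpotent, and the geometric
  series inverts it in the corner. The induction shows that the left ideal generated by \<open>e\<^sub>h - u\<close>
  contains every \<open>e\<^sub>h - u\<^sup>k\<close> with \<open>k \<ge> 1\<close>.
\<close>

lemma corner_unit:
  assumes h: "h \<in> {1..t}" and w: "e h * r * e h \<notin> J"
  obtains z where "z * (e h * r * e h) = e h"
proof -
  note J = left_idealD[OF left_ideal_J] left_ideal_scale[OF left_ideal_J]
  obtain c y where cy: "e h * r * e h = scale c (e h) + y" "y \<in> J" "e h * y = y" "y * e h = y"
    by (rule corner_local[OF h])
  have c: "c \<noteq> 0" using cy w by auto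
  define u where "u = - scale (1 / c) y"
  have uJ: "u \<in> J" and ue: "u * e h = u" and eu: "e h * u = u"
    using cy J by (auto simp: u_def scale_mult_left scale_mult_right)
  have w': "scale (1 / c) 1 * (e h * r * e h) = e h - u"
    using c by (simp add: cy(1) u_def scale_eq_mult[symmetric] scale_right_distrib)
  have "\<exists>z. z * (e h - u) = e h - u ^ Suc k" for k
  proof (induction k)
    case 0
    show ?case by (rule exI[of _ 1]) simp
  next
    case (Suc k)
    then obtain z where z: "z * (e h - u) = e h - u ^ Suc k" by blast
    have "(1 + u * z) * (e h - u) = e h - u + u * (e h - u ^ Suc k)"
      by (simp add: distrib_right mult.assoc z)
    also have "\<dots> = e h - u ^ Suc (Suc k)" by (simp add: right_diff_distrib ue)
    finally show ?case by blast
  qed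
  from this[of "n - 1"] obtain z where "z * (e h - u) = e h"
    using n_pos J_nil[OF uJ] by (auto simp: Suc_diff_1)
  then have "(z * scale (1 / c) 1) * (e h * r * e h) = e h"
    using w' by (simp add: mult.assoc)
  then show thesis by (rule that)
qed

text \<open>
  An element \<open>x \<in> e\<^sub>h \<Lambda> e\<^sub>l\<close> outside \<open>J\<close> generates a left ideal that is not nil, and therefore
  \<open>y x = e\<^sub>l\<close> for some \<open>y \<in> e\<^sub>l \<Lambda> e\<^sub>h\<close>. Then \<open>x y\<close> is a nonzero idempotent of \<open>e\<^sub>h \<Lambda> e\<^sub>h\<close>, equal
  to \<open>e\<^sub>h\<close> by primitivity, and right multiplication by \<open>x\<close> is an isomorphism \<open>\<Lambda> e\<^sub>h \<cong> \<Lambda> e\<^sub>l\<close>,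
  which contradicts basicness.
\<close>

lemma off_diagonal_corner_in_radical:
  assumes h: "h \<in> {1..t}" and l: "l \<in> {1..t}" and hl: "h \<noteq> l"
  shows "e h * r * e l \<in> J"
proof (rule ccontr)
  note J = left_idealD[OF left_ideal_J]
  define x where "x = e h * r * e l"
  assume "e h * r * e l \<notin> J"
  then have xJ: "x \<notin> J" by (simp add: x_def)
  have xl: "x * e l = x" and hx: "e h * x = x"
    by (simp_all add: x_def mult.assoc e_idem[OF l] e_idem_left[OF h])
  \<comment> \<open>otherwise the square of every \<open>s x\<close> lies in \<open>J\<close>, so \<open>\<Lambda> x\<close> is nil\<close>
  have "\<exists>s. e l * s * x \<notin> J"
  proof (rule ccontr)
    assume "\<not> ?thesis"
    then have "(s * x) * (e l * s * x) \<in> J" for s using J(3) by blast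
    moreover have "(s * x) * (e l * s * x) = (s * x) * (s * x)" for s
    proof -
      have "(s * x) * (e l * s * x) = s * (x * e l) * (s * x)" by (simp add: mult.assoc)
      then show ?thesis by (simp add: xl)
    qed
    ultimately have "(s * x) * (s * x) \<in> J" for s by metis
    then have "((s * x) ^ 2) ^ n = 0" for s by (intro J_nil) (simp add: power2_eq_square)
    then have "x \<in> J" by (intro nil_left_ideal_in_jacobson_radical) (metis power_mult)
    then show False using xJ by simp
  qed
  then obtain s where s: "e l * s * x \<notin> J" by blast
  then have "e l * (s * x) * e l \<notin> J" using xl by (simp add: mult.assoc)
  then obtain z where "z * (e l * (s * x) * e l) = e l" by (rule corner_unit[OF l])
  then have zx: "(z * e l * s) * x = e l" using xl by (simp add: mult.assoc)
  define y where "y = e l * (z * e l * s) * e h"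
  have yx: "y * x = e l"
  proof -
    have "y * x = e l * ((z * e l * s) * (e h * x))" by (simp add: y_def mult.assoc)
    then show ?thesis by (simp only: hx zx e_idem[OF l])
  qed
  have yh: "y * e h = y" and ly: "e l * y = y"
    by (simp_all add: y_def mult.assoc e_idem[OF h] e_idem_left[OF l])
  define g where "g = x * y"
  have g: "g * g = g"
  proof -
    have "g * g = x * (y * x) * y" by (simp add: g_def mult.assoc)
    then show ?thesis by (simp add: yx xl g_def)
  qed
  have gh: "g * e h = g" "e h * g = g" by (simp add: g_def mult.assoc yh, simp add: g_def mult.assoc[symmetric] hx)
  have g0: "g \<noteq> 0"
  proof
    assume "g = 0"
    then have "y * g * x = 0" by simp
    moreover have "y * g * x = (y * x) * (y * x)" by (simp add: g_def mult.assoc)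
    ultimately show False using yx e_idem[OF l] e_nonzero[OF l] by simp
  qed
  have "e h - g = 0"
  proof (rule ccontr)
    assume "e h - g \<noteq> 0"
    moreover have "(e h - g) * (e h - g) = e h - g" "g * (e h - g) = 0" "(e h - g) * g = 0" "e h = g + (e h - g)"
      using g gh e_idem[OF h] by (simp_all add: algebra_simps)
    ultimately have "\<not> primitive_idempotent (e h)"
      unfolding primitive_idempotent_def using g g0 by blast
    then show False using idempotents h by (simp add: complete_primitive_orthogonal_def)
  qed
  then have xy: "x * y = e h" by (simp add: g_def)
  have "lmodule_iso (left_ideal_lmodule (proj_ideal (e h))) (left_ideal_lmodule (proj_ideal (e l)))"
    unfolding lmodule_iso_def left_ideal_lmodule_def
  proof (intro exI[of _ "\<lambda>a. a * x"] conjI)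
    have "bij_betw (\<lambda>a. a * x) (proj_ideal (e h)) (proj_ideal (e l))"
    proof (rule bij_betw_byWitness[where f' = "\<lambda>a. a * y"])
      show "\<forall>a\<in>proj_ideal (e h). a * x * y = a" "\<forall>a\<in>proj_ideal (e l). a * y * x = a"
        using e_idem h l by (auto simp: proj_ideal_def mult.assoc xy yx)
      show "(\<lambda>a. a * x) ` proj_ideal (e h) \<subseteq> proj_ideal (e l)"
        using xl by (auto simp: proj_ideal_def) (metis mult.assoc)
      show "(\<lambda>a. a * y) ` proj_ideal (e l) \<subseteq> proj_ideal (e h)"
        using yh by (auto simp: in_proj_ideal_iff[OF h] mult.assoc)
    qed
    then show "bij_betw (\<lambda>a. a * x) (lcarrier \<lparr>lcarrier = proj_ideal (e h), ladd = (+), lzero = 0, lsmult = (*)\<rparr>)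
        (lcarrier \<lparr>lcarrier = proj_ideal (e l), ladd = (+), lzero = 0, lsmult = (*)\<rparr>)" by simp
  qed (auto simp: distrib_right mult.assoc)
  then show False using basic h l hl by (auto simp: basic_idempotents_def)
qed

section \<open>The modules of the fibre\<close>

abbreviation V :: "nat \<Rightarrow> nat \<Rightarrow> 'a set" where "V i j \<equiv> peirce_top e n i j"

lemma in_V_iff:
  assumes "i \<in> {1..t}" "j \<in> {1..t}"
  shows "v \<in> V i j \<longleftrightarrow> v \<in> radical_power (n - 1) \<and> v * e i = v \<and> e j * v = v"
proof
  assume "v \<in> V i j"
  then obtain x where "x \<in> radical_power (n - 1)" "v = e j * x * e i"
    by (auto simp: peirce_top_def corner_def)
  then show "v \<in> radical_power (n - 1) \<and> v * e i = v \<and> e j * v = v"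
    using e_idem e_idem_left assms left_idealD(3)[OF left_ideal_top_powers] top_powers_right
    by (auto simp: mult.assoc)
next
  assume v: "v \<in> radical_power (n - 1) \<and> v * e i = v \<and> e j * v = v"
  then have "v = e j * v * e i" by simp
  then show "v \<in> V i j" using v unfolding peirce_top_def corner_def by blast
qed

lemma radical_power_times_proj_ideal:
  assumes i: "i \<in> {1..t}"
  shows "x \<in> subgroup_product (radical_power (n - 1)) (proj_ideal (e i)) \<longleftrightarrow>
    x \<in> radical_power (n - 1) \<and> x * e i = x"
proof
  assume "x \<in> subgroup_product (radical_power (n - 1)) (proj_ideal (e i))"
  then show "x \<in> radical_power (n - 1) \<and> x * e i = x"
  proof (induction rule: subgroup_product_induct)
    case zero
    then show ?case using left_idealD(1)[OF left_ideal_top_powers] by simp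
  next
    case (add a b y)
    then show ?case
      using i left_idealD(2)[OF left_ideal_top_powers] top_powers_right
      by (auto simp: in_proj_ideal_iff distrib_right mult.assoc)
  qed
next
  assume "x \<in> radical_power (n - 1) \<and> x * e i = x"
  then show "x \<in> subgroup_product (radical_power (n - 1)) (proj_ideal (e i))"
    using subgroup_product_mult[of x "radical_power (n - 1)" "e i" "proj_ideal (e i)"] i
    by (simp add: in_proj_ideal_iff e_idem)
qed

text \<open>
  The Peirce decomposition \<open>k = \<Sum>\<^sub>h e\<^sub>h k\<close> makes membership in \<open>W\<^sub>j \<oplus> U\<close> a condition on the
  component \<open>e\<^sub>j k\<close> alone.
\<close>

lemma K_sub_iff:
  assumes i: "i \<in> {1..t}" and j: "j \<in> {1..t}" and U: "U \<subseteq> V i j"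
  shows "k \<in> K_sub e t n i j U \<longleftrightarrow> k \<in> radical_power (n - 1) \<and> k * e i = k \<and> e j * k \<in> U"
proof
  note R = left_idealD[OF left_ideal_top_powers[of "n - 1"]]
  assume "k \<in> K_sub e t n i j U"
  then obtain w u where k: "k = (\<Sum>h\<in>{1..t} - {j}. w h) + u" "u \<in> U"
    and w: "\<And>h. h \<in> {1..t} - {j} \<Longrightarrow> w h \<in> (*) (e h) ` subgroup_product (radical_power (n - 1)) (proj_ideal (e i))"
    by (auto simp: K_sub_def W_sum_def)
  have u: "u \<in> radical_power (n - 1)" "u * e i = u" "e j * u = u"
    using U k(2) in_V_iff[OF i j] by auto
  have wh: "w h \<in> radical_power (n - 1) \<and> w h * e i = w h \<and> e j * w h = 0" if h: "h \<in> {1..t} - {j}" for h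
  proof -
    obtain x where x: "w h = e h * x" "x \<in> radical_power (n - 1)" "x * e i = x"
      using w[OF h] radical_power_times_proj_ideal[OF i] by auto
    have "e j * w h = (e j * e h) * x" by (simp add: x(1) mult.assoc)
    then have "e j * w h = 0" using e_orth[OF j, of h] h by auto
    then show ?thesis using x R(3) by (auto simp: mult.assoc)
  qed
  have "(\<Sum>h\<in>A. w h) \<in> radical_power (n - 1)" if "A \<subseteq> {1..t} - {j}" for A
    using finite_subset[OF that] that
    by (induction A rule: finite_induct) (use R wh in auto)
  then have "(\<Sum>h\<in>{1..t} - {j}. w h) \<in> radical_power (n - 1)" by blast
  moreover have "(\<Sum>h\<in>{1..t} - {j}. w h) * e i = (\<Sum>h\<in>{1..t} - {j}. w h)"
    unfolding sum_distrib_right using wh by (intro sum.cong) auto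
  moreover have "e j * (\<Sum>h\<in>{1..t} - {j}. w h) = 0"
    unfolding sum_distrib_left using wh by (intro sum.neutral) auto
  ultimately show "k \<in> radical_power (n - 1) \<and> k * e i = k \<and> e j * k \<in> U"
    using k u R(2) by (auto simp: distrib_left distrib_right)
next
  assume k: "k \<in> radical_power (n - 1) \<and> k * e i = k \<and> e j * k \<in> U"
  have "(\<Sum>h\<in>{1..t} - {j}. e h * k) = (\<Sum>h\<in>{1..t}. e h * k) - e j * k"
    using j by (simp add: sum_diff1)
  also have "(\<Sum>h\<in>{1..t}. e h * k) = k" by (simp only: sum_distrib_right[symmetric] e_sum mult_1)
  finally have "k = (\<Sum>h\<in>{1..t} - {j}. e h * k) + e j * k" by simp
  moreover have "(\<Sum>h\<in>{1..t} - {j}. e h * k) \<in> W_sum e t n i j"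
    using k radical_power_times_proj_ideal[OF i] unfolding W_sum_def by blast
  ultimately show "k \<in> K_sub e t n i j U" using k unfolding K_sub_def by blast
qed

text \<open>
  For \<open>k \<in> J\<^bsup>n-1\<^esup>\<close> the component \<open>e\<^sub>j r k = \<Sum>\<^sub>h e\<^sub>j r e\<^sub>h k\<close> is a scalar multiple of \<open>e\<^sub>j k\<close>: the
  terms with \<open>h \<noteq> j\<close> vanish since \<open>e\<^sub>j r e\<^sub>h \<in> J\<close>, and \<open>e\<^sub>j r e\<^sub>j\<close> is a scalar modulo \<open>J\<close>.
\<close>

lemma left_ideal_K_sub:
  assumes i: "i \<in> {1..t}" and j: "j \<in> {1..t}" and U: "U \<subseteq> V i j" "subspace U"
  shows "is_left_ideal (K_sub e t n i j U)"
proof -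
  note R = left_idealD[OF left_ideal_top_powers[of "n - 1"]]
  note K = K_sub_iff[OF i j U(1)]
  have "e j * (r * k) \<in> U" if k: "k \<in> K_sub e t n i j U" for r k
  proof -
    have "e j * r * e h * k = 0" if "h \<in> {1..t} - {j}" for h
      using that k K off_diagonal_corner_in_radical[OF j, of h] top_power_annihilated(2) by auto
    then have "(\<Sum>h\<in>{1..t}. e j * r * e h * k) = e j * r * e j * k"
      using j by (subst sum.remove[of _ j]) auto
    moreover have "(\<Sum>h\<in>{1..t}. e j * r * e h * k) = e j * r * k"
      by (simp only: sum_distrib_left[symmetric] sum_distrib_right[symmetric] e_sum mult_1_right)
    moreover obtain c y where "e j * r * e j = scale c (e j) + y" "y \<in> J" by (rule corner_local[OF j])
    ultimately have "e j * (r * k) = scale c (e j * k)"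
      using k K top_power_annihilated(2) by (simp add: mult.assoc[symmetric] distrib_right scale_mult_left)
    then show ?thesis using k K U(2) by (auto simp: subspace_def)
  qed
  then show ?thesis
    unfolding is_left_ideal_def using K R U(2)
    by (auto simp: subspace_def distrib_left distrib_right mult.assoc)
qed

end

lemma coset_eq_iff:
  assumes "is_left_ideal K"
  shows "(+) x ` K = (+) y ` K \<longleftrightarrow> x - y \<in> K"
proof
  assume "(+) x ` K = (+) y ` K"
  moreover have "x \<in> (+) x ` K" using left_idealD(1)[OF assms] by force
  ultimately obtain k where "x = y + k" "k \<in> K" by auto
  then show "x - y \<in> K" by simp
next
  assume a: "x - y \<in> K"
  have "(+) x ` K \<subseteq> (+) y ` K" if "x - y \<in> K" for x y
  proof
    fix z assume "z \<in> (+) x ` K"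
    then obtain k where "z = x + k" "k \<in> K" by auto
    then have "z = y + ((x - y) + k)" "(x - y) + k \<in> K" using left_idealD(2)[OF assms] that by auto
    then show "z \<in> (+) y ` K" by blast
  qed
  from this[OF a] this[of y x] show "(+) x ` K = (+) y ` K"
    using left_idealD(4)[OF assms a] by auto
qed

lemma lsmult_coset:
  assumes "is_left_ideal K"
  shows "lsmult (quotient_lmodule (left_ideal_lmodule P) K) r ((+) x ` K) = (+) (r * x) ` K"
proof -
  have "{r * a + y |a y. a \<in> (+) x ` K \<and> y \<in> K} = (+) (r * x) ` K"
  proof (intro equalityI subsetI)
    fix z assume "z \<in> {r * a + y |a y. a \<in> (+) x ` K \<and> y \<in> K}"
    then obtain k y where "z = r * x + (r * k + y)" "k \<in> K" "y \<in> K"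
      by (auto simp: distrib_left add.assoc)
    then show "z \<in> (+) (r * x) ` K" using left_idealD(2,3)[OF assms] by blast
  next
    fix z assume "z \<in> (+) (r * x) ` K"
    then obtain y where "z = r * (x + 0) + y" "y \<in> K" by auto
    then show "z \<in> {r * a + y |a y. a \<in> (+) x ` K \<and> y \<in> K}"
      using left_idealD(1)[OF assms] by blast
  qed
  then show ?thesis by (simp add: quotient_lmodule_def left_ideal_lmodule_def)
qed

context basic_split_algebra
begin

text \<open>
  An isomorphism \<open>f\<close> is right multiplication by a representative \<open>x\<close> of the image of the coset of
  \<open>e\<^sub>i\<close>. On \<open>V\<^bsub>ij\<^esub>\<close> this is multiplication by the scalar \<open>c\<close> with \<open>e\<^sub>i x e\<^sub>i \<in> c e\<^sub>i + J\<close>, because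
  \<open>J\<^bsup>n-1\<^esup> J = 0\<close>. So \<open>v \<in> U\<close> is equivalent to \<open>c v \<in> U'\<close>.
\<close>

lemma M_quot_iso_imp_subset:
  assumes i: "i \<in> {1..t}" and j: "j \<in> {1..t}"
    and U: "subspace U" "U \<subset> V i j" and U': "subspace U'" "U' \<subseteq> V i j"
    and iso: "lmodule_iso (M_quot e t n i j U) (M_quot e t n i j U')"
  shows "U \<subseteq> U'"
proof -
  let ?K = "K_sub e t n i j U" and ?K' = "K_sub e t n i j U'"
  have UV: "U \<subseteq> V i j" using U(2) by blast
  note K = K_sub_iff[OF i j UV] and K' = K_sub_iff[OF i j U'(2)]
  note KI = left_ideal_K_sub[OF i j UV U(1)] and KI' = left_ideal_K_sub[OF i j U'(2,1)]
  note V = in_V_iff[OF i j]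
  have car: "lcarrier (M_quot e t n i j U) = (\<lambda>x. (+) x ` K_sub e t n i j U) ` proj_ideal (e i)" for U
    by (simp add: M_quot_def quotient_lmodule_def left_ideal_lmodule_def)
  obtain f where bij: "bij_betw f (lcarrier (M_quot e t n i j U)) (lcarrier (M_quot e t n i j U'))"
    and sm: "\<And>r x. x \<in> lcarrier (M_quot e t n i j U) \<Longrightarrow>
       f (lsmult (M_quot e t n i j U) r x) = lsmult (M_quot e t n i j U') r (f x)"
    using iso unfolding lmodule_iso_def by blast
  have eP: "e i \<in> proj_ideal (e i)" using in_proj_ideal_iff[OF i] e_idem[OF i] by blast
  then have "f ((+) (e i) ` ?K) \<in> lcarrier (M_quot e t n i j U')"
    using bij_betwE[OF bij] unfolding car by blast
  then obtain x where x: "x * e i = x" "f ((+) (e i) ` ?K) = (+) x ` ?K'"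
    using in_proj_ideal_iff[OF i] unfolding car by blast
  have f: "f ((+) p ` ?K) = (+) (p * x) ` ?K'" if "p * e i = p" for p
  proof -
    have "f (lsmult (M_quot e t n i j U) p ((+) (e i) ` ?K)) = lsmult (M_quot e t n i j U') p ((+) x ` ?K')"
      using sm[of "(+) (e i) ` ?K" p] eP x(2) unfolding car by auto
    then show ?thesis
      unfolding M_quot_def lsmult_coset[OF KI] lsmult_coset[OF KI'] that .
  qed
  obtain c y where cy: "e i * x * e i = scale c (e i) + y" "y \<in> J" by (rule corner_local[OF i])
  have vx: "v * x = scale c v" if "v \<in> V i j" for v
  proof -
    have v: "v \<in> radical_power (n - 1)" "v * e i = v" using that V by auto
    have "v * x = v * e i * x * e i" using v(2) x(1) by (simp add: mult.assoc)
    also have "\<dots> = v * (e i * x * e i)" by (simp add: mult.assoc)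
    also have "\<dots> = scale c v"
      using v top_power_annihilated(1)[OF v(1) cy(2)] by (simp add: cy(1) distrib_left scale_mult_right)
    finally show ?thesis .
  qed
  have key: "v \<in> U \<longleftrightarrow> scale c v \<in> U'" if v: "v \<in> V i j" for v
  proof -
    have "v \<in> U \<longleftrightarrow> v - 0 \<in> ?K" using v V K by auto
    also have "\<dots> \<longleftrightarrow> (+) v ` ?K = (+) 0 ` ?K" by (rule coset_eq_iff[OF KI, symmetric])
    also have "\<dots> \<longleftrightarrow> f ((+) v ` ?K) = f ((+) 0 ` ?K)"
    proof -
      have "v \<in> proj_ideal (e i)" "0 \<in> proj_ideal (e i)"
        using v V in_proj_ideal_iff[OF i] by auto
      then have "(+) v ` ?K \<in> lcarrier (M_quot e t n i j U)" "(+) 0 ` ?K \<in> lcarrier (M_quot e t n i j U)"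
        unfolding car by blast+
      then show ?thesis using inj_on_eq_iff[OF bij_betw_imp_inj_on[OF bij]] by metis
    qed
    also have "\<dots> \<longleftrightarrow> (+) (v * x) ` ?K' = (+) (0 * x) ` ?K'" using f[of v] f[of 0] v V by (simp only: mult_zero_left)
    also have "\<dots> \<longleftrightarrow> v * x - 0 * x \<in> ?K'" by (rule coset_eq_iff[OF KI'])
    also have "\<dots> \<longleftrightarrow> scale c v \<in> U'"
      using v V K' vx[OF v] left_ideal_scale[OF left_ideal_top_powers]
      by (auto simp: scale_mult_left scale_mult_right)
    finally show ?thesis .
  qed
  have c: "c \<noteq> 0"
  proof
    assume "c = 0"
    \<comment> \<open>the zero scalar would make \<open>f\<close> kill the coset of every \<open>v \<in> V\<^bsub>ij\<^esub>\<close>\<close>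
    then have "V i j \<subseteq> U" using key U'(1) by (auto simp: subspace_def)
    then show False using U(2) by blast
  qed
  show ?thesis
  proof
    fix u assume "u \<in> U"
    then have "scale c u \<in> U'" using key UV by blast
    then have "scale (1 / c) (scale c u) \<in> U'" by (rule subspace_scale[OF U'(1)])
    then show "u \<in> U'" using c by simp
  qed
qed

proposition bij_betw_fibre_class:
  assumes i: "i \<in> {1..t}" and j: "j \<in> {1..t}" and s: "1 \<le> s" "s \<le> dim (V i j)"
  shows "bij_betw (fibre_class e t n i j s) (Gr (dim (V i j) - s) (V i j)) (ambiguity_fibre e t n i j s)"
proof -
  let ?G = "Gr (dim (V i j) - s) (V i j)"
  have refl: "lmodule_iso M M" for M :: "('a, 'a set) lmodule"
    unfolding lmodule_iso_def by (rule exI[of _ "\<lambda>x. x"]) (auto simp: bij_betw_def)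
  show ?thesis
    unfolding bij_betw_def
  proof
    show "inj_on (fibre_class e t n i j s) ?G"
    proof (rule inj_onI)
      fix U U' assume U: "U \<in> ?G" and U': "U' \<in> ?G"
        and eq: "fibre_class e t n i j s U = fibre_class e t n i j s U'"
      have "M_quot e t n i j U' \<in> fibre_class e t n i j s U'"
        using U' refl by (auto simp: fibre_class_def iso_on_def fibre_modules_def)
      then have iso: "lmodule_iso (M_quot e t n i j U) (M_quot e t n i j U')"
        unfolding eq[symmetric] by (auto simp: fibre_class_def iso_on_def)
      have "U \<noteq> V i j" using U s by (auto simp: Gr_def)
      then have "U \<subseteq> U'"
        using M_quot_iso_imp_subset[OF i j _ _ _ _ iso] U U' by (auto simp: Gr_def)
      then show "U = U'" using U U' by (intro subspace_eq_of_dim) (auto simp: Gr_def)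
    qed
    show "fibre_class e t n i j s ` ?G = ambiguity_fibre e t n i j s"
      by (auto simp: fibre_class_def ambiguity_fibre_def fibre_modules_def quotient_def)
  qed
qed

end

section \<open>Evaluation of polynomials\<close>

definition monom_value :: "('b \<Rightarrow> 'c::comm_ring_1) \<Rightarrow> ('b \<Rightarrow>\<^sub>0 nat) \<Rightarrow> 'c" where
  "monom_value g \<mu> = (\<Prod>v\<in>Poly_Mapping.keys \<mu>. g v ^ Poly_Mapping.lookup \<mu> v)"

definition monom_degree :: "('b \<Rightarrow>\<^sub>0 nat) \<Rightarrow> nat" where
  "monom_degree \<mu> = (\<Sum>v\<in>Poly_Mapping.keys \<mu>. Poly_Mapping.lookup \<mu> v)"

lemma monom_value_superset:
  assumes "finite S" "Poly_Mapping.keys \<mu> \<subseteq> S"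
  shows "monom_value g \<mu> = (\<Prod>v\<in>S. g v ^ Poly_Mapping.lookup \<mu> v)"
  unfolding monom_value_def using assms
  by (intro prod.mono_neutral_left) (auto simp: in_keys_iff)

lemma keys_add_nat: "Poly_Mapping.keys (\<mu> + \<nu> :: 'b \<Rightarrow>\<^sub>0 nat) = Poly_Mapping.keys \<mu> \<union> Poly_Mapping.keys \<nu>"
  by (auto simp: in_keys_iff lookup_add)

lemma monom_value_zero [simp]: "monom_value g 0 = 1"
  by (simp add: monom_value_def)

lemma monom_value_add: "monom_value g (\<mu> + \<nu>) = monom_value g \<mu> * monom_value g \<nu>"
proof -
  let ?S = "Poly_Mapping.keys \<mu> \<union> Poly_Mapping.keys \<nu>"
  have "monom_value g x = (\<Prod>v\<in>?S. g v ^ Poly_Mapping.lookup x v)" if "x \<in> {\<mu>, \<nu>, \<mu> + \<nu>}" for x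
    using that by (intro monom_value_superset) (auto simp: keys_add_nat)
  then show ?thesis by (simp add: lookup_add power_add prod.distrib)
qed

lemma monom_value_single [simp]: "monom_value g (Poly_Mapping.single v k) = g v ^ k"
  by (cases "k = 0") (simp_all add: monom_value_def)

lemma monom_value_scaled:
  "monom_value (\<lambda>v. c * h v) \<mu> = c ^ monom_degree \<mu> * monom_value h \<mu>"
  by (simp add: monom_value_def monom_degree_def power_mult_distrib prod.distrib power_sum)

lemma poly_subst_superset:
  assumes "finite S" "Poly_Mapping.keys f \<subseteq> S" "\<phi> 0 = 0"
  shows "poly_subst \<phi> g f = (\<Sum>\<mu>\<in>S. \<phi> (Poly_Mapping.lookup f \<mu>) * monom_value g \<mu>)"
  unfolding poly_subst_def monom_value_def[symmetric] using assms
  by (intro sum.mono_neutral_left) (auto simp: in_keys_iff)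

lemma poly_mapping_sum_singles:
  "f = (\<Sum>\<mu>\<in>Poly_Mapping.keys f. Poly_Mapping.single \<mu> (Poly_Mapping.lookup f \<mu>))"
  by (rule poly_mapping_eqI) (auto simp: lookup_sum lookup_single when_def in_keys_iff)

context
  fixes \<phi> :: "'k::field \<Rightarrow> 'c::comm_ring_1"
  assumes hom: "comm_ring_hom \<phi>"
begin

interpretation comm_ring_hom \<phi> by (fact hom)

lemma poly_subst_add: "poly_subst \<phi> g (f + f') = poly_subst \<phi> g f + poly_subst \<phi> g f'"
proof -
  let ?S = "Poly_Mapping.keys f \<union> Poly_Mapping.keys f'"
  have "Poly_Mapping.keys (f + f') \<subseteq> ?S" by (rule keys_add)
  then show ?thesis
    using poly_subst_superset[of ?S _ \<phi> g]
    by (simp add: lookup_add hom_add distrib_right sum.distrib)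
qed

lemma poly_subst_zero [simp]: "poly_subst \<phi> g 0 = 0"
  by (simp add: poly_subst_def)

lemma poly_subst_sum: "poly_subst \<phi> g (sum F A) = (\<Sum>x\<in>A. poly_subst \<phi> g (F x))"
  by (induction A rule: infinite_finite_induct) (simp_all add: poly_subst_add)

lemma poly_subst_single: "poly_subst \<phi> g (Poly_Mapping.single \<mu> c) = \<phi> c * monom_value g \<mu>"
  by (cases "c = 0") (simp_all add: poly_subst_def monom_value_def)

lemma poly_subst_mult: "poly_subst \<phi> g (f * f') = poly_subst \<phi> g f * poly_subst \<phi> g f'"
proof -
  let ?s = "\<lambda>f \<mu>. Poly_Mapping.single \<mu> (Poly_Mapping.lookup f \<mu>)"
  have "f * f' = (\<Sum>\<mu>\<in>Poly_Mapping.keys f. ?s f \<mu>) * (\<Sum>\<nu>\<in>Poly_Mapping.keys f'. ?s f' \<nu>)"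
    using poly_mapping_sum_singles by metis
  also have "\<dots> = (\<Sum>\<mu>\<in>Poly_Mapping.keys f. \<Sum>\<nu>\<in>Poly_Mapping.keys f'. ?s f \<mu> * ?s f' \<nu>)"
    by (simp add: sum_product)
  finally have "poly_subst \<phi> g (f * f') = (\<Sum>\<mu>\<in>Poly_Mapping.keys f. \<Sum>\<nu>\<in>Poly_Mapping.keys f'.
      poly_subst \<phi> g (?s f \<mu>) * poly_subst \<phi> g (?s f' \<nu>))"
    by (simp add: poly_subst_sum mult_single poly_subst_single monom_value_add hom_mult algebra_simps)
  also have "\<dots> = poly_subst \<phi> g (\<Sum>\<mu>\<in>Poly_Mapping.keys f. ?s f \<mu>) *
      poly_subst \<phi> g (\<Sum>\<nu>\<in>Poly_Mapping.keys f'. ?s f' \<nu>)"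
    by (simp add: poly_subst_sum sum_product)
  finally show ?thesis using poly_mapping_sum_singles by metis
qed

lemma poly_subst_pconst [simp]: "poly_subst \<phi> g (pconst c) = \<phi> c"
  by (simp add: pconst_def poly_subst_single)

lemma poly_subst_pvar [simp]: "poly_subst \<phi> g (pvar v) = g v"
  by (simp add: pvar_def poly_subst_single)

lemma poly_subst_one [simp]: "poly_subst \<phi> g 1 = 1"
  using poly_subst_pconst[of g 1] by (simp add: pconst_def)

lemma comm_ring_hom_poly_subst: "comm_ring_hom (poly_subst \<phi> g)"
  by unfold_locales (simp_all add: poly_subst_add poly_subst_mult)

lemma poly_subst_comp:
  assumes "comm_ring_hom \<theta>"
  shows "\<theta> (poly_subst \<phi> g f) = poly_subst (\<lambda>c. \<theta> (\<phi> c)) (\<lambda>v. \<theta> (g v)) f"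
proof -
  interpret \<theta>: comm_ring_hom \<theta> by (fact assms)
  show ?thesis
    by (simp add: poly_subst_def \<theta>.hom_sum \<theta>.hom_mult \<theta>.hom_prod \<theta>.hom_power)
qed

end

lemma comm_ring_hom_id: "comm_ring_hom (\<lambda>c. c)"
  by unfold_locales auto

lemma comm_ring_hom_pconst: "comm_ring_hom (pconst :: 'k::field \<Rightarrow> ('b, 'k) mpolynomial)"
  by unfold_locales (auto simp: pconst_def single_add mult_single)

lemma comm_ring_hom_comp:
  "comm_ring_hom f \<Longrightarrow> comm_ring_hom g \<Longrightarrow> comm_ring_hom (\<lambda>x. g (f x))"
  unfolding comm_ring_hom_def Ring_Hom.ring_hom_def semiring_hom_def
  by (auto simp: comm_monoid_add_hom_def monoid_add_hom_def zero_hom_def semigroup_add_hom_def plus_hom_def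
     monoid_mult_hom_def one_hom_def semigroup_mult_hom_def times_hom_def)

lemma comm_ring_hom_const_poly:
  "comm_ring_hom (\<phi> :: 'k::field \<Rightarrow> 'r::comm_ring_1) \<Longrightarrow> comm_ring_hom (\<lambda>c. [:\<phi> c:])"
  by (rule comm_ring_hom_comp[where g = "\<lambda>c. [:c:]"]) (simp_all, unfold_locales, auto simp: one_pCons)

lemma poly_subst_cong:
  assumes "f \<in> carrier (poly_ring_on B)" "\<And>v. v \<in> B \<Longrightarrow> g v = g' v"
  shows "poly_subst \<phi> g f = poly_subst \<phi> g' f"
  unfolding poly_subst_def using assms
  by (intro sum.cong refl arg_cong2[where f="(*)"] prod.cong) (auto 4 4 simp: poly_ring_on_def)

subsection \<open>Polynomial rings in a set of variables\<close>

lemma poly_ring_on_simps [simp]: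
  "mult (poly_ring_on B) = (*)" "one (poly_ring_on B) = 1"
  "zero (poly_ring_on B) = 0" "add (poly_ring_on B) = (+)"
  by (simp_all add: poly_ring_on_def)

lemma in_poly_ring_on:
  "f \<in> carrier (poly_ring_on B) \<longleftrightarrow> (\<forall>\<mu>\<in>Poly_Mapping.keys f. Poly_Mapping.keys \<mu> \<subseteq> B)"
  by (simp add: poly_ring_on_def)

lemma poly_ring_on_zero [simp]: "0 \<in> carrier (poly_ring_on B)"
  and poly_ring_on_one [simp]: "1 \<in> carrier (poly_ring_on B)"
  and poly_ring_on_pconst [simp]: "pconst c \<in> carrier (poly_ring_on B)"
  and poly_ring_on_pvar: "v \<in> B \<Longrightarrow> pvar v \<in> carrier (poly_ring_on B)"
  by (auto simp: in_poly_ring_on pconst_def pvar_def split: if_splits)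

lemma poly_ring_on_add:
  "f \<in> carrier (poly_ring_on B) \<Longrightarrow> g \<in> carrier (poly_ring_on B) \<Longrightarrow> f + g \<in> carrier (poly_ring_on B)"
  unfolding in_poly_ring_on using keys_add[of f g] by blast

lemma poly_ring_on_uminus:
  "f \<in> carrier (poly_ring_on B) \<Longrightarrow> - f \<in> carrier (poly_ring_on B)"
  unfolding in_poly_ring_on by (auto simp: in_keys_iff)

lemma poly_ring_on_mult:
  assumes "f \<in> carrier (poly_ring_on B)" "g \<in> carrier (poly_ring_on B)"
  shows "f * g \<in> carrier (poly_ring_on B)"
  unfolding in_poly_ring_on
proof
  fix \<mu> assume "\<mu> \<in> Poly_Mapping.keys (f * g)"
  then obtain a b where "\<mu> = a + b" "a \<in> Poly_Mapping.keys f" "b \<in> Poly_Mapping.keys g"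
    using keys_mult[of f g] by blast
  then show "Poly_Mapping.keys \<mu> \<subseteq> B" using assms by (auto simp: in_poly_ring_on keys_add_nat)
qed

lemma poly_ring_on_diff:
  "f \<in> carrier (poly_ring_on B) \<Longrightarrow> g \<in> carrier (poly_ring_on B) \<Longrightarrow> f - g \<in> carrier (poly_ring_on B)"
  using poly_ring_on_add[of f B "- g"] poly_ring_on_uminus[of g B] by simp

lemma poly_ring_on_sum:
  "(\<And>x. x \<in> A \<Longrightarrow> F x \<in> carrier (poly_ring_on B)) \<Longrightarrow> sum F A \<in> carrier (poly_ring_on B)"
  by (induction A rule: infinite_finite_induct) (auto intro: poly_ring_on_add)

lemma poly_ring_on_prod:
  "(\<And>x. x \<in> A \<Longrightarrow> F x \<in> carrier (poly_ring_on B)) \<Longrightarrow> prod F A \<in> carrier (poly_ring_on B)"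
  by (induction A rule: infinite_finite_induct) (auto intro: poly_ring_on_mult)

lemma poly_ring_on_power:
  "f \<in> carrier (poly_ring_on B) \<Longrightarrow> f ^ n \<in> carrier (poly_ring_on B)"
  by (induction n) (auto intro: poly_ring_on_mult)

lemma poly_ring_on_poly_subst:
  assumes "f \<in> carrier (poly_ring_on B)" "\<And>v. v \<in> B \<Longrightarrow> g v \<in> carrier (poly_ring_on X)"
  shows "poly_subst pconst g f \<in> carrier (poly_ring_on X)"
  unfolding poly_subst_def using assms(1)
  by (intro poly_ring_on_sum poly_ring_on_mult poly_ring_on_prod poly_ring_on_power
      poly_ring_on_pconst assms(2)) (auto simp: in_poly_ring_on)

lemma poly_ring_on_det:
  assumes "\<And>a c. a < d \<Longrightarrow> c < d \<Longrightarrow> A (a, c) \<in> carrier (poly_ring_on X)"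
  shows "det (mat d d A) \<in> carrier (poly_ring_on X)"
proof -
  have sg: "signof p \<in> carrier (poly_ring_on X)" for p :: "nat \<Rightarrow> nat"
    by (auto simp: sign_def intro: poly_ring_on_uminus)
  show ?thesis using assms
    by (auto simp: det_def sg intro!: poly_ring_on_sum poly_ring_on_mult poly_ring_on_prod)
qed

lemma cring_poly_ring_on: "cring (poly_ring_on B)"
proof (rule cringI)
  show "abelian_group (poly_ring_on B)"
    by (rule abelian_groupI)
       (auto simp: poly_ring_on_add add_ac intro!: bexI[OF _ poly_ring_on_uminus])
  show "Group.comm_monoid (poly_ring_on B)"
    by (rule comm_monoidI) (auto simp: poly_ring_on_mult mult_ac)
qed (auto simp: algebra_simps)

lemma a_inv_poly_ring_on:
  assumes "a \<in> carrier (poly_ring_on B)"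
  shows "\<ominus>\<^bsub>poly_ring_on B\<^esub> a = - a"
proof -
  interpret cring "poly_ring_on B" by (rule cring_poly_ring_on)
  show ?thesis using assms by (intro minus_equality) (auto intro: poly_ring_on_uminus)
qed

subsection \<open>Homogeneous components\<close>

lemma lookup_hom_component:
  "Poly_Mapping.lookup (hom_component D f) \<mu> = (if monom_degree \<mu> = D then Poly_Mapping.lookup f \<mu> else 0)"
  unfolding hom_component_def monom_degree_def[symmetric]
  by (auto simp: lookup_sum lookup_single when_def in_keys_iff)

lemma hom_component_hom_component:
  "hom_component D (hom_component E f) = (if D = E then hom_component D f else 0)"
  by (rule poly_mapping_eqI) (simp add: lookup_hom_component)

lemma poly_ring_on_hom_component:
  "f \<in> carrier (poly_ring_on B) \<Longrightarrow> hom_component D f \<in> carrier (poly_ring_on B)"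
  by (auto simp: in_poly_ring_on in_keys_iff lookup_hom_component split: if_splits)

lemma monom_degree_eq_0_iff: "monom_degree \<mu> = 0 \<longleftrightarrow> \<mu> = 0"
  by (auto simp: monom_degree_def in_keys_iff intro: poly_mapping_eqI)

lemma hom_component_0: "hom_component 0 f = pconst (Poly_Mapping.lookup f 0)"
  by (rule poly_mapping_eqI)
     (auto simp: lookup_hom_component pconst_def lookup_single when_def monom_degree_eq_0_iff)

lemma sum_hom_components:
  assumes "\<And>\<mu>. \<mu> \<in> Poly_Mapping.keys f \<Longrightarrow> monom_degree \<mu> \<le> N"
  shows "f = (\<Sum>D\<le>N. hom_component D f)"
proof (rule poly_mapping_eqI)
  fix \<mu>
  show "Poly_Mapping.lookup f \<mu> = Poly_Mapping.lookup (\<Sum>D\<le>N. hom_component D f) \<mu>"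
    using assms[of \<mu>] by (auto simp: lookup_sum lookup_hom_component in_keys_iff)
qed

lemma ex_sum_hom_components: "\<exists>N. f = (\<Sum>D\<le>N. hom_component D f)"
proof -
  have "finite (monom_degree ` Poly_Mapping.keys f)" by simp
  then obtain N where "\<forall>x \<in> monom_degree ` Poly_Mapping.keys f. x \<le> N"
    using finite_nat_set_iff_bounded_le by blast
  then show ?thesis by (intro exI[of _ N] sum_hom_components) auto
qed

lemma poly_subst_hom_component_scaled:
  "poly_subst \<phi> (\<lambda>v. c * h v) (hom_component D f) = c ^ D * poly_subst \<phi> h (hom_component D f)"
proof -
  have "monom_degree \<mu> = D" if "\<mu> \<in> Poly_Mapping.keys (hom_component D f)" for \<mu>
    using that by (auto simp: in_keys_iff lookup_hom_component split: if_splits)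
  then show ?thesis
    by (auto simp: poly_subst_def monom_value_def[symmetric] monom_value_scaled sum_distrib_left
        intro!: sum.cong)
qed

lemma poly_subst_scaled:
  assumes "comm_ring_hom \<phi>"
  shows "\<exists>N. poly_subst \<phi> (\<lambda>v. c * h v) f = (\<Sum>D\<le>N. c ^ D * poly_subst \<phi> h (hom_component D f))"
proof -
  obtain N where "f = (\<Sum>D\<le>N. hom_component D f)" using ex_sum_hom_components by blast
  then have "poly_subst \<phi> (\<lambda>v. c * h v) f = (\<Sum>D\<le>N. poly_subst \<phi> (\<lambda>v. c * h v) (hom_component D f))"
    using poly_subst_sum[OF assms] by metis
  then show ?thesis by (auto simp: poly_subst_hom_component_scaled)
qed

text \<open>
  Evaluation with an auxiliary variable \<open>T\<close>: the value \<open>h v\<close> is replaced by \<open>h v T\<close>, so that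
  the coefficients in \<open>T\<close> separate the homogeneous components.
\<close>

abbreviation graded_eval ::
  "('k::field \<Rightarrow> 'c::comm_ring_1) \<Rightarrow> ('b \<Rightarrow> 'c) \<Rightarrow> ('b, 'k) mpolynomial \<Rightarrow> 'c Polynomial.poly" where
  "graded_eval \<phi> h \<equiv> poly_subst (\<lambda>c. [:\<phi> c:]) (\<lambda>v. Polynomial.monom (h v) (Suc 0))"

lemma coeff_poly_subst_graded:
  assumes "comm_ring_hom \<phi>"
  shows "Polynomial.coeff (graded_eval \<phi> h f) D =
     poly_subst \<phi> h (hom_component D f)"
proof -
  have mv: "monom_value (\<lambda>v. Polynomial.monom (h v) (Suc 0)) \<mu> = Polynomial.monom (monom_value h \<mu>) (monom_degree \<mu>)" for \<mu>
  proof -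
    have 1: "(\<Prod>v\<in>A. Polynomial.monom (h v) (Suc 0) ^ n v) = Polynomial.monom (\<Prod>v\<in>A. h v ^ n v) (\<Sum>v\<in>A. n v)"
      if "finite A" for A and n :: "_ \<Rightarrow> nat"
      using that by (induction A) (simp_all add: monom_power mult_monom one_pCons monom_0)
    show ?thesis unfolding monom_value_def monom_degree_def by (rule 1) simp
  qed
  interpret comm_ring_hom \<phi> by fact
  have sub: "Poly_Mapping.keys (hom_component D f) \<subseteq> Poly_Mapping.keys f"
    by (auto simp: in_keys_iff lookup_hom_component split: if_splits)
  show ?thesis
    by (subst poly_subst_superset[OF _ sub])
       (auto simp: poly_subst_def monom_value_def[symmetric] mv coeff_sum lookup_hom_component smult_monom
        intro!: sum.cong)
qed

section \<open>Homogeneous prime ideals as graded kernels\<close>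

text \<open>
  The largest homogeneous ideal on which evaluation at \<open>h\<close> vanishes. Geometrically it is the ideal
  of the cone over the image of \<open>h\<close>. The primes constructed below all have this form.
\<close>

definition graded_kernel ::
  "'b set \<Rightarrow> ('k::field \<Rightarrow> 'r::comm_ring_1) \<Rightarrow> ('b \<Rightarrow> 'r) \<Rightarrow> ('b, 'k) mpolynomial set" where
  "graded_kernel B \<phi> h =
     {f \<in> carrier (poly_ring_on B). \<forall>D. poly_subst \<phi> h (hom_component D f) = 0}"

lemma graded_kernel_iff:
  assumes "comm_ring_hom \<phi>"
  shows "f \<in> graded_kernel B \<phi> h \<longleftrightarrow> f \<in> carrier (poly_ring_on B) \<and>
    graded_eval \<phi> h f = 0"
  by (simp add: graded_kernel_def poly_eq_iff coeff_poly_subst_graded[OF assms])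

lemma ideal_graded_kernel:
  assumes "comm_ring_hom \<phi>"
  shows "ideal (graded_kernel B \<phi> h) (poly_ring_on B)"
proof -
  note hom = comm_ring_hom_const_poly[OF assms]
  interpret cring "poly_ring_on B" by (rule cring_poly_ring_on)
  interpret H: comm_ring_hom "graded_eval \<phi> h"
    by (rule comm_ring_hom_poly_subst[OF hom])
  note [simp] = graded_kernel_iff[OF assms] H.hom_add H.hom_mult H.hom_uminus
  show ?thesis
  proof (rule idealI)
    show "subgroup (graded_kernel B \<phi> h) (add_monoid (poly_ring_on B))"
    proof (rule add.subgroupI)
      fix a assume a: "a \<in> graded_kernel B \<phi> h"
      have "\<ominus>\<^bsub>poly_ring_on B\<^esub> a = - a"
        using a by (simp add: a_inv_poly_ring_on)
      then show "\<ominus>\<^bsub>poly_ring_on B\<^esub> a \<in> graded_kernel B \<phi> h"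
        using a by (auto intro: poly_ring_on_uminus)
    next
      have "0 \<in> graded_kernel B \<phi> h" by simp
      then show "graded_kernel B \<phi> h \<noteq> {}" by blast
    qed (auto intro: poly_ring_on_add)
  qed (auto intro: poly_ring_on_mult ring_axioms)
qed

text \<open>
  The graded kernel is an ordinary kernel, of the homomorphism \<open>graded_eval\<close> into \<open>R[T]\<close>, and
  \<open>R[T]\<close> is a domain.
\<close>

lemma primeideal_graded_kernel:
  fixes h :: "'b \<Rightarrow> 'r::idom"
  assumes "comm_ring_hom \<phi>"
  shows "primeideal (graded_kernel B \<phi> h) (poly_ring_on B)"
proof (rule primeidealI[OF ideal_graded_kernel[OF assms] cring_poly_ring_on])
  note hom = comm_ring_hom_const_poly[OF assms]
  interpret H: comm_ring_hom "graded_eval \<phi> h"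
    by (rule comm_ring_hom_poly_subst[OF hom])
  have "1 \<notin> graded_kernel B \<phi> h" by (simp add: graded_kernel_iff[OF assms] poly_subst_one[OF hom])
  then show "carrier (poly_ring_on B) \<noteq> graded_kernel B \<phi> h"
    using poly_ring_on_one by blast
  fix a b
  assume "a \<in> carrier (poly_ring_on B)" "b \<in> carrier (poly_ring_on B)"
    "a \<otimes>\<^bsub>poly_ring_on B\<^esub> b \<in> graded_kernel B \<phi> h"
  then show "a \<in> graded_kernel B \<phi> h \<or> b \<in> graded_kernel B \<phi> h"
    by (simp add: graded_kernel_iff[OF assms] H.hom_mult)
qed

lemma hom_component_pvar: "hom_component D (pvar v) = (if D = 1 then pvar v else 0)"
  by (rule poly_mapping_eqI)
     (auto simp: lookup_hom_component pvar_def lookup_single when_def monom_degree_def)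

lemma pvar_in_graded_kernel_iff:
  assumes "comm_ring_hom \<phi>" "v \<in> B"
  shows "pvar v \<in> graded_kernel B \<phi> h \<longleftrightarrow> h v = 0"
  using assms by (auto simp: graded_kernel_def hom_component_pvar poly_ring_on_pvar)

lemma graded_kernel_in_Proj_points:
  fixes h :: "'b \<Rightarrow> 'r::idom"
  assumes "comm_ring_hom \<phi>" "v \<in> B" "h v \<noteq> 0" "I \<subseteq> graded_kernel B \<phi> h"
  shows "graded_kernel B \<phi> h \<in> Proj_points B I"
  unfolding Proj_points_def
proof (intro CollectI conjI ballI allI)
  show "primeideal (graded_kernel B \<phi> h) (poly_ring_on B)"
    by (rule primeideal_graded_kernel[OF assms(1)])
  show "hom_component D f \<in> graded_kernel B \<phi> h" if "f \<in> graded_kernel B \<phi> h" for f D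
    using that by (auto simp: graded_kernel_def hom_component_hom_component
        poly_ring_on_hom_component poly_subst_zero[OF assms(1)])
  show "\<not> pvar ` B \<subseteq> graded_kernel B \<phi> h"
    using assms pvar_in_graded_kernel_iff[OF assms(1,2), of h] by blast
qed (fact assms)

lemma poly_subst_pconst_pvar: "poly_subst pconst pvar f = f"
proof -
  have 1: "monom_value pvar \<mu> = Poly_Mapping.single \<mu> (1::'b::field)" for \<mu> :: "'a \<Rightarrow>\<^sub>0 nat"
  proof (induction \<mu> rule: update_induct)
    case const
    then show ?case by simp
  next
    case (update \<mu> v n)
    have "Poly_Mapping.update v n \<mu> = \<mu> + Poly_Mapping.single v n"
      using update by (intro poly_mapping_eqI) (auto simp: lookup_update lookup_add lookup_single when_def in_keys_iff)
    moreover have "pvar v ^ n = Poly_Mapping.single (Poly_Mapping.single v n) (1::'b)"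
      by (induction n) (auto simp: pvar_def mult_single single_add[symmetric])
    ultimately show ?case using update by (simp add: monom_value_add mult_single)
  qed
  show ?thesis
    using poly_mapping_sum_singles[of f]
    by (simp add: poly_subst_def monom_value_def[symmetric] 1 pconst_def mult_single)
qed

abbreviation rename_Some :: "('v, 'k::field) mpolynomial \<Rightarrow> ('v option, 'k) mpolynomial" where
  "rename_Some \<equiv> poly_subst pconst (\<lambda>v. pvar (Some v))"

text \<open>
  The auxiliary variable may also be taken as one more variable, \<open>None\<close>, of the target polynomial
  ring. This is the form in which the ideal of relations between minors is given.
\<close>

lemma kernel_with_cone_variable:
  fixes h :: "'b \<Rightarrow> ('v, 'k::field) mpolynomial"
  shows "poly_subst pconst (\<lambda>I. pvar None * rename_Some (h I)) f = 0 \<longleftrightarrow>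
    (\<forall>D. poly_subst pconst h (hom_component D f) = 0)"
proof
  let ?\<theta> = "poly_subst (\<lambda>c. [:pconst c:]) (case_option [:0, 1:] (\<lambda>v. [:pvar v:])) ::
     ('v option, 'k) mpolynomial \<Rightarrow> ('v, 'k) mpolynomial Polynomial.poly"
  note c = comm_ring_hom_pconst
  note pc = comm_ring_hom_const_poly[OF c]
  note \<theta> = comm_ring_hom_poly_subst[OF pc]
  interpret \<theta>: comm_ring_hom ?\<theta> by (rule \<theta>)
  have const: "comm_ring_hom (\<lambda>p :: ('v, 'k) mpolynomial. [:p:])"
    by unfold_locales (auto simp: one_pCons)
  have ren: "?\<theta> (rename_Some p) = [:p:]" for p
    using poly_subst_comp[OF c const, of pvar p]
    by (simp add: poly_subst_comp[OF c \<theta>] poly_subst_pvar[OF pc] poly_subst_pconst[OF pc] poly_subst_pconst_pvar)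
  have gen: "?\<theta> (pvar None * rename_Some (h I)) = Polynomial.monom (h I) (Suc 0)" for I
    by (simp add: \<theta>.hom_mult ren poly_subst_pvar[OF pc] monom_Suc monom_0)
  assume "poly_subst pconst (\<lambda>I. pvar None * rename_Some (h I)) f = 0"
  then have "?\<theta> (poly_subst pconst (\<lambda>I. pvar None * rename_Some (h I)) f) = 0" by simp
  then have "graded_eval pconst h f = 0"
    unfolding poly_subst_comp[OF c \<theta>] gen poly_subst_pconst[OF pc] .
  then show "\<forall>D. poly_subst pconst h (hom_component D f) = 0"
    by (simp add: poly_eq_iff coeff_poly_subst_graded[OF c])
next
  note c = comm_ring_hom_pconst
  assume 0: "\<forall>D. poly_subst pconst h (hom_component D f) = 0"
  have ren: "poly_subst pconst (\<lambda>I. rename_Some (h I)) F = rename_Some (poly_subst pconst h F)" for F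
    by (simp add: poly_subst_comp[OF c comm_ring_hom_poly_subst[OF c]] poly_subst_pconst[OF c])
  obtain N where "poly_subst pconst (\<lambda>I. pvar None * rename_Some (h I)) f =
      (\<Sum>D\<le>N. pvar None ^ D * poly_subst pconst (\<lambda>I. rename_Some (h I)) (hom_component D f))"
    using poly_subst_scaled[OF c, of "pvar None" "\<lambda>I. rename_Some (h I)" f] by blast
  then show "poly_subst pconst (\<lambda>I. pvar None * rename_Some (h I)) f = 0"
    using 0 by (simp add: ren poly_subst_zero[OF c])
qed

section \<open>Algebraic independence\<close>

definition alg_indep_mod ::
  "('b, 'k::field) mpolynomial set \<Rightarrow> (nat \<Rightarrow> ('b, 'k) mpolynomial) \<Rightarrow> nat \<Rightarrow> bool" where
  "alg_indep_mod P y r \<longleftrightarrow>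
     (\<forall>f\<in>carrier (poly_ring_on {..<r}). poly_subst pconst y f \<in> P \<longrightarrow> f = 0)"

text \<open>
  Division with remainder by the last variable; the last clause says that the degree in that variable
  drops, as is needed for the induction below.
\<close>

lemma split_last_variable:
  fixes f :: "(nat, 'k::field) mpolynomial"
  assumes f: "f \<in> carrier (poly_ring_on {..<Suc r})"
  obtains f0 f1 where "f = f0 + pvar r * f1" "f0 \<in> carrier (poly_ring_on {..<r})"
    "f1 \<in> carrier (poly_ring_on {..<Suc r})"
    "\<And>e. (\<And>\<mu>. \<mu> \<in> Poly_Mapping.keys f \<Longrightarrow> Poly_Mapping.lookup \<mu> r < Suc e) \<Longrightarrow>
       (\<And>\<mu>. \<mu> \<in> Poly_Mapping.keys f1 \<Longrightarrow> Poly_Mapping.lookup \<mu> r < e)"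
proof -
  let ?K0 = "{\<mu> \<in> Poly_Mapping.keys f. Poly_Mapping.lookup \<mu> r = 0}"
  let ?K1 = "{\<mu> \<in> Poly_Mapping.keys f. Poly_Mapping.lookup \<mu> r \<noteq> 0}"
  define f0 where "f0 = (\<Sum>\<mu>\<in>?K0. Poly_Mapping.single \<mu> (Poly_Mapping.lookup f \<mu>))"
  define f1 where "f1 = (\<Sum>\<mu>\<in>?K1. Poly_Mapping.single (\<mu> - Poly_Mapping.single r 1) (Poly_Mapping.lookup f \<mu>))"
  have K: "Poly_Mapping.keys f = ?K0 \<union> ?K1" by auto
  have "f = (\<Sum>\<mu>\<in>?K0 \<union> ?K1. Poly_Mapping.single \<mu> (Poly_Mapping.lookup f \<mu>))"
    using poly_mapping_sum_singles[of f] K by simp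
  also have "\<dots> = f0 + (\<Sum>\<mu>\<in>?K1. Poly_Mapping.single \<mu> (Poly_Mapping.lookup f \<mu>))"
    unfolding f0_def by (rule sum.union_disjoint) auto
  also have "(\<Sum>\<mu>\<in>?K1. Poly_Mapping.single \<mu> (Poly_Mapping.lookup f \<mu>)) = pvar r * f1"
    unfolding f1_def sum_distrib_left
  proof (rule sum.cong)
    fix \<mu> assume "\<mu> \<in> ?K1"
    then have "Poly_Mapping.single r 1 + (\<mu> - Poly_Mapping.single r 1) = \<mu>"
      by (intro poly_mapping_eqI) (auto simp: lookup_add lookup_minus lookup_single when_def)
    then show "Poly_Mapping.single \<mu> (Poly_Mapping.lookup f \<mu>) =
        pvar r * Poly_Mapping.single (\<mu> - Poly_Mapping.single r 1) (Poly_Mapping.lookup f \<mu>)"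
      by (simp add: pvar_def mult_single)
  qed simp
  finally have 1: "f = f0 + pvar r * f1" .
  have k0: "Poly_Mapping.keys f0 \<subseteq> ?K0"
    unfolding f0_def by (rule order_trans[OF keys_sum]) auto
  have k1: "Poly_Mapping.keys f1 \<subseteq> (\<lambda>\<mu>. \<mu> - Poly_Mapping.single r 1) ` ?K1"
    unfolding f1_def by (rule order_trans[OF keys_sum]) (auto split: if_splits)
  have 2: "f0 \<in> carrier (poly_ring_on {..<r})"
    unfolding in_poly_ring_on
  proof
    fix \<mu> assume "\<mu> \<in> Poly_Mapping.keys f0"
    then have "Poly_Mapping.keys \<mu> \<subseteq> {..<Suc r}" "r \<notin> Poly_Mapping.keys \<mu>"
      using k0 f unfolding in_poly_ring_on by (blast, auto simp: in_keys_iff)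
    then show "Poly_Mapping.keys \<mu> \<subseteq> {..<r}" by (auto simp: less_Suc_eq)
  qed
  have 3: "f1 \<in> carrier (poly_ring_on {..<Suc r})"
    unfolding in_poly_ring_on
  proof
    fix \<nu> assume "\<nu> \<in> Poly_Mapping.keys f1"
    then obtain \<mu> where "\<mu> \<in> ?K1" "\<nu> = \<mu> - Poly_Mapping.single r 1" using k1 by blast
    moreover from this have "Poly_Mapping.keys \<mu> \<subseteq> {..<Suc r}"
      using f by (auto simp: poly_ring_on_def)
    ultimately show "Poly_Mapping.keys \<nu> \<subseteq> {..<Suc r}"
      by (fastforce simp: subset_iff in_keys_iff lookup_minus lookup_single when_def split: if_splits)
  qed
  have 4: "Poly_Mapping.lookup \<nu> r < e"
    if lt: "\<And>\<mu>. \<mu> \<in> Poly_Mapping.keys f \<Longrightarrow> Poly_Mapping.lookup \<mu> r < Suc e"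
      and \<nu>: "\<nu> \<in> Poly_Mapping.keys f1" for e \<nu>
  proof -
    obtain \<mu> where "\<mu> \<in> ?K1" "\<nu> = \<mu> - Poly_Mapping.single r 1" using k1 \<nu> by blast
    with lt[of \<mu>] show ?thesis by (auto simp: lookup_minus lookup_single when_def)
  qed
  show thesis by (rule that[OF 1 2 3 4])
qed

text \<open>
  Suppose \<open>f(y, q) \<in> P\<close>, and write \<open>f = f\<^sub>0 + X f\<^sub>1\<close> with \<open>X\<close> the variable for \<open>q\<close> and \<open>f\<^sub>0\<close> free
  of \<open>X\<close>. Modulo \<open>Q\<close> only \<open>f\<^sub>0(y)\<close> remains, so \<open>f\<^sub>0 = 0\<close> by independence modulo \<open>Q\<close>. Then
  \<open>q f\<^sub>1(y, q) \<in> P\<close>, the prime \<open>P\<close> does not contain \<open>q\<close>, and \<open>f\<^sub>1\<close> has smaller degree in \<open>X\<close>.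
\<close>

lemma alg_indep_mod_extend:
  fixes P Q :: "('b, 'k::field) mpolynomial set"
  assumes P: "primeideal P (poly_ring_on B)" and Q: "ideal Q (poly_ring_on B)" and PQ: "P \<subseteq> Q"
    and q: "q \<in> Q" "q \<notin> P" and y: "\<And>i. i < r \<Longrightarrow> y i \<in> carrier (poly_ring_on B)"
    and ind: "alg_indep_mod Q y r"
  shows "alg_indep_mod P (y(r := q)) (Suc r)"
proof -
  let ?y = "y(r := q)"
  interpret P: primeideal P "poly_ring_on B" by fact
  interpret Q: ideal Q "poly_ring_on B" by fact
  note c = comm_ring_hom_pconst
  interpret H: comm_ring_hom "poly_subst pconst ?y" by (rule comm_ring_hom_poly_subst[OF c])
  have qc: "q \<in> carrier (poly_ring_on B)" using q(1) by (rule Q.a_Hcarr)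
  have yc: "poly_subst pconst ?y f \<in> carrier (poly_ring_on B)"
    if "f \<in> carrier (poly_ring_on {..<Suc r})" for f
    using that by (rule poly_ring_on_poly_subst) (auto simp: y qc)
  have "f = 0" if "f \<in> carrier (poly_ring_on {..<Suc r})" "poly_subst pconst ?y f \<in> P"
    "\<And>\<mu>. \<mu> \<in> Poly_Mapping.keys f \<Longrightarrow> Poly_Mapping.lookup \<mu> r < e" for f e
    using that
  proof (induction e arbitrary: f)
    case 0
    then have "Poly_Mapping.keys f = {}" by blast
    then show ?case by (simp only: keys_eq_empty)
  next
    case (Suc e)
    obtain f0 f1 where f: "f = f0 + pvar r * f1" "f0 \<in> carrier (poly_ring_on {..<r})"
      "f1 \<in> carrier (poly_ring_on {..<Suc r})"
      and e: "\<And>\<mu>. \<mu> \<in> Poly_Mapping.keys f1 \<Longrightarrow> Poly_Mapping.lookup \<mu> r < e"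
      using split_last_variable[OF Suc.prems(1)] Suc.prems(3) by metis
    have ev: "poly_subst pconst ?y f = poly_subst pconst ?y f0 + q * poly_subst pconst ?y f1"
      by (simp add: f(1) H.hom_add H.hom_mult poly_subst_pvar[OF c])
    have qf1: "q * poly_subst pconst ?y f1 \<in> Q"
      using Q.I_r_closed[OF q(1) yc[OF f(3)]] by simp
    have "poly_subst pconst ?y f \<in> Q" using Suc.prems(2) PQ by blast
    then have "poly_subst pconst ?y f \<ominus>\<^bsub>poly_ring_on B\<^esub> q * poly_subst pconst ?y f1 \<in> Q"
      using Q.a_closed[OF _ Q.a_inv_closed[OF qf1]] by (simp add: a_minus_def)
    moreover have "poly_subst pconst ?y f \<ominus>\<^bsub>poly_ring_on B\<^esub> q * poly_subst pconst ?y f1 = poly_subst pconst ?y f0"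
    proof -
      have "\<ominus>\<^bsub>poly_ring_on B\<^esub> (q * poly_subst pconst ?y f1) = - (q * poly_subst pconst ?y f1)"
        using Q.a_Hcarr[OF qf1] by (rule a_inv_poly_ring_on)
      then show ?thesis by (simp add: a_minus_def ev)
    qed
    moreover have "poly_subst pconst ?y f0 = poly_subst pconst y f0"
      using f(2) by (rule poly_subst_cong) auto
    ultimately have "f0 = 0" using ind f(2) by (auto simp: alg_indep_mod_def)
    then have "q * poly_subst pconst ?y f1 \<in> P"
      using Suc.prems(2) unfolding ev by (simp del: fun_upd_apply)
    then have "poly_subst pconst ?y f1 \<in> P"
      using P.I_prime[OF qc yc[OF f(3)]] q(2) by simp
    then have "f1 = 0" using Suc.IH[OF f(3)] e by blast
    with \<open>f0 = 0\<close> f(1) show "f = 0" by simp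
  qed
  moreover have "\<exists>e. \<forall>\<mu>\<in>Poly_Mapping.keys f. Poly_Mapping.lookup \<mu> r < e" for f :: "(nat, 'k) mpolynomial"
  proof -
    have "finite ((\<lambda>\<mu>. Poly_Mapping.lookup \<mu> r) ` Poly_Mapping.keys f)" by simp
    then show ?thesis using finite_nat_set_iff_bounded by (metis image_eqI)
  qed
  ultimately show ?thesis unfolding alg_indep_mod_def by metis
qed

section \<open>Counting monomials\<close>

definition bounded_polys :: "'v set \<Rightarrow> nat \<Rightarrow> ('v, 'k::field) mpolynomial set" where
  "bounded_polys X b =
     {f. \<forall>\<mu>\<in>Poly_Mapping.keys f. Poly_Mapping.keys \<mu> \<subseteq> X \<and> (\<forall>v. Poly_Mapping.lookup \<mu> v \<le> b)}"

definition monom_box :: "'v set \<Rightarrow> nat \<Rightarrow> ('v \<Rightarrow>\<^sub>0 nat) set" where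
  "monom_box X b = {\<mu>. Poly_Mapping.keys \<mu> \<subseteq> X \<and> (\<forall>v. Poly_Mapping.lookup \<mu> v \<le> b)}"

lemma
  assumes "finite X"
  shows finite_monom_box: "finite (monom_box X b)"
    and card_monom_box: "card (monom_box X b) = (b + 1) ^ card X"
proof -
  have "bij_betw (\<lambda>\<mu>. restrict (Poly_Mapping.lookup \<mu>) X) (monom_box X b) (X \<rightarrow>\<^sub>E {..b})"
  proof (rule bij_betw_byWitness[where f' = "\<lambda>g. Abs_poly_mapping (\<lambda>v. if v \<in> X then g v else 0)"])
    have fin: "finite {v. (if v \<in> X then g v else 0) \<noteq> (0::nat)}" for g
      using assms by (rule rev_finite_subset) auto
    note [simp] = Abs_poly_mapping_inverse[simplified, OF fin]
    show "\<forall>\<mu>\<in>monom_box X b. Abs_poly_mapping (\<lambda>v. if v \<in> X then restrict (Poly_Mapping.lookup \<mu>) X v else 0) = \<mu>"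
      by (auto simp: monom_box_def in_keys_iff intro!: poly_mapping_eqI)
    show "\<forall>g\<in>X \<rightarrow>\<^sub>E {..b}. restrict (Poly_Mapping.lookup (Abs_poly_mapping (\<lambda>v. if v \<in> X then g v else 0))) X = g"
      by (auto simp: fun_eq_iff PiE_def extensional_def)
    show "(\<lambda>\<mu>. restrict (Poly_Mapping.lookup \<mu>) X) ` monom_box X b \<subseteq> X \<rightarrow>\<^sub>E {..b}"
      by (auto simp: monom_box_def)
    show "(\<lambda>g. Abs_poly_mapping (\<lambda>v. if v \<in> X then g v else 0)) ` (X \<rightarrow>\<^sub>E {..b}) \<subseteq> monom_box X b"
      by (auto simp: monom_box_def in_keys_iff split: if_splits)
  qed
  moreover have "finite (X \<rightarrow>\<^sub>E {..b})" using assms by (simp add: finite_PiE)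
  moreover have "card (X \<rightarrow>\<^sub>E {..b}) = (b + 1) ^ card X" using assms by (simp add: card_PiE)
  ultimately show "finite (monom_box X b)" "card (monom_box X b) = (b + 1) ^ card X"
    using bij_betw_finite bij_betw_same_card by (blast, metis)
qed

lemma bounded_polys_one [simp]: "1 \<in> bounded_polys X b"
  by (auto simp: bounded_polys_def)

lemma bounded_polys_mult:
  assumes "f \<in> bounded_polys X a" "g \<in> bounded_polys X b"
  shows "f * g \<in> bounded_polys X (a + b)"
  unfolding bounded_polys_def
proof (intro CollectI ballI)
  fix \<mu> assume "\<mu> \<in> Poly_Mapping.keys (f * g)"
  then obtain x y where "\<mu> = x + y" "x \<in> Poly_Mapping.keys f" "y \<in> Poly_Mapping.keys g"
    using keys_mult[of f g] by blast
  then show "Poly_Mapping.keys \<mu> \<subseteq> X \<and> (\<forall>v. Poly_Mapping.lookup \<mu> v \<le> a + b)"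
    using assms by (auto simp: bounded_polys_def keys_add_nat lookup_add intro!: add_mono)
qed

lemma bounded_polys_power:
  "f \<in> bounded_polys X a \<Longrightarrow> f ^ n \<in> bounded_polys X (n * a)"
  by (induction n) (auto intro: bounded_polys_mult)

lemma bounded_polys_prod:
  "finite A \<Longrightarrow> (\<And>x. x \<in> A \<Longrightarrow> F x \<in> bounded_polys X (b x)) \<Longrightarrow> prod F A \<in> bounded_polys X (sum b A)"
  by (induction A rule: finite_induct) (auto intro: bounded_polys_mult)

lemma bounded_polys_mono: "a \<le> b \<Longrightarrow> f \<in> bounded_polys X a \<Longrightarrow> f \<in> bounded_polys X b"
  by (auto simp: bounded_polys_def intro: order_trans)

lemma ex_bounded_polys:
  assumes "f \<in> carrier (poly_ring_on X)"
  shows "\<exists>b. f \<in> bounded_polys X b"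
proof -
  let ?S = "\<Union>\<mu>\<in>Poly_Mapping.keys f. Poly_Mapping.lookup \<mu> ` Poly_Mapping.keys \<mu>"
  have "finite ?S" by simp
  then obtain b where b: "\<forall>x\<in>?S. x \<le> b" using finite_nat_set_iff_bounded_le by blast
  have "Poly_Mapping.lookup \<mu> v \<le> b" if "\<mu> \<in> Poly_Mapping.keys f" for \<mu> v
    using b that by (cases "v \<in> Poly_Mapping.keys \<mu>") (auto simp: in_keys_iff)
  then show ?thesis using assms by (auto simp: bounded_polys_def in_poly_ring_on)
qed

lemma vector_space_mpolynomial:
  "vector_space (\<lambda>c (f :: ('v, 'k::field) mpolynomial). pconst c * f)"
proof -
  interpret comm_ring_hom "pconst :: 'k \<Rightarrow> ('v, 'k) mpolynomial" by (rule comm_ring_hom_pconst)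
  show ?thesis by unfold_locales (auto simp: algebra_simps hom_add hom_mult)
qed

text \<open>
  Let all exponents in the given polynomials be at most \<open>E\<close>. If the \<open>r\<close> polynomials were
  independent, the \<open>(t + 1)\<^sup>r\<close> monomials in them with exponents at most \<open>t\<close> would be linearly independent. They lie in the span of the monomials in \<open>X\<close> with exponents
  at most \<open>r t E\<close>, of which there are \<open>(r t E + 1)\<^bsup>|X|\<^esup>\<close>. For \<open>|X| < r\<close> the first number
  outgrows the second as \<open>t\<close> increases.
\<close>

proposition algebraically_dependent:
  fixes g :: "nat \<Rightarrow> ('v, 'k::field) mpolynomial"
  assumes X: "finite X" "card X < r" and g: "\<And>i. i < r \<Longrightarrow> g i \<in> carrier (poly_ring_on X)"
  shows "\<exists>f\<in>carrier (poly_ring_on {..<r}). f \<noteq> 0 \<and> poly_subst pconst g f = 0"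
proof (rule ccontr)
  assume "\<not> ?thesis"
  then have indep: "f = 0" if "f \<in> carrier (poly_ring_on {..<r})" "poly_subst pconst g f = 0" for f
    using that by blast
  interpret vs: vector_space "\<lambda>c (f :: ('v, 'k) mpolynomial). pconst c * f"
    by (rule vector_space_mpolynomial)
  note c = comm_ring_hom_pconst
  obtain b where b: "\<And>i. i < r \<Longrightarrow> g i \<in> bounded_polys X (b i)"
    using ex_bounded_polys[OF g] by metis
  define E where "E = (\<Sum>i<r. b i)"
  have gE: "g i \<in> bounded_polys X E" if "i < r" for i
    using that by (intro bounded_polys_mono[OF _ b[OF that]]) (auto simp: E_def intro: member_le_sum)
  have bound: "t + 1 \<le> (r * E + 1) ^ card X" for t
  proof -
    let ?Box = "monom_box {..<r} t"
    let ?S = "monom_value g ` ?Box"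
    let ?T = "(\<lambda>\<mu>. Poly_Mapping.single \<mu> (1::'k)) ` monom_box X (r * (t * E))"
    have fB: "finite ?Box" by (simp add: finite_monom_box)
    have sub: "?S \<subseteq> vs.span ?T"
    proof
      fix s assume "s \<in> ?S"
      then obtain \<alpha> where \<alpha>: "\<alpha> \<in> ?Box" "s = monom_value g \<alpha>" by blast
      then have "s = (\<Prod>i<r. g i ^ Poly_Mapping.lookup \<alpha> i)"
        using monom_value_superset[of "{..<r}" \<alpha> g] by (auto simp: monom_box_def)
      moreover have "(\<Prod>i<r. g i ^ Poly_Mapping.lookup \<alpha> i) \<in> bounded_polys X (\<Sum>i<r. Poly_Mapping.lookup \<alpha> i * E)"
        by (rule bounded_polys_prod) (auto intro: bounded_polys_power gE)
      moreover have "(\<Sum>i<r. Poly_Mapping.lookup \<alpha> i * E) \<le> (\<Sum>i<r. t * E)"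
        using \<alpha> by (intro sum_mono mult_right_mono) (auto simp: monom_box_def)
      ultimately have s: "s \<in> bounded_polys X (r * (t * E))"
        by (auto intro: bounded_polys_mono)
      have "s = (\<Sum>\<mu>\<in>Poly_Mapping.keys s. pconst (Poly_Mapping.lookup s \<mu>) * Poly_Mapping.single \<mu> 1)"
        using poly_mapping_sum_singles[of s] by (simp add: pconst_def mult_single)
      also have "\<dots> \<in> vs.span ?T"
        using s by (intro vs.span_sum vs.span_scale vs.span_base) (auto simp: bounded_polys_def monom_box_def)
      finally show "s \<in> vs.span ?T" .
    qed
    have ev: "poly_subst pconst g (\<Sum>\<alpha>\<in>?Box. Poly_Mapping.single \<alpha> (u \<alpha>)) = (\<Sum>\<alpha>\<in>?Box. pconst (u \<alpha>) * monom_value g \<alpha>)" for u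
      by (simp add: poly_subst_sum[OF c] poly_subst_single[OF c])
    have zero: "u \<alpha> = 0" if "(\<Sum>\<alpha>\<in>?Box. pconst (u \<alpha>) * monom_value g \<alpha>) = 0" "\<alpha> \<in> ?Box" for u \<alpha>
    proof -
      let ?f = "\<Sum>\<alpha>\<in>?Box. Poly_Mapping.single \<alpha> (u \<alpha>)"
      have "?f \<in> carrier (poly_ring_on {..<r})"
        by (rule poly_ring_on_sum) (auto simp: in_poly_ring_on monom_box_def split: if_splits)
      then have "?f = 0" using indep ev that by metis
      moreover have "Poly_Mapping.lookup ?f \<alpha> = u \<alpha>"
        using that(2) fB by (simp add: lookup_sum lookup_single when_def sum.delta)
      ultimately show ?thesis by simp
    qed
    have inj: "inj_on (monom_value g) ?Box"
    proof (rule inj_onI, rule ccontr)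
      fix \<alpha> \<beta> assume ab: "\<alpha> \<in> ?Box" "\<beta> \<in> ?Box" "monom_value g \<alpha> = monom_value g \<beta>" "\<alpha> \<noteq> \<beta>"
      let ?u = "\<lambda>x. if x = \<alpha> then 1 else if x = \<beta> then -1 else (0::'k)"
      have "pconst (?u x) * monom_value g x = (if x = \<alpha> then monom_value g \<alpha> else 0) -
          (if x = \<beta> then monom_value g \<beta> else 0)" for x
        using ab(4) by (auto simp: pconst_def single_uminus)
      then have "(\<Sum>x\<in>?Box. pconst (?u x) * monom_value g x) = 0"
        using ab fB by (simp add: sum_subtractf sum.delta)
      from zero[OF this ab(1)] show False by simp
    qed
    have "vs.independent ?S"
    proof (rule vs.independent_if_scalars_zero)
      show "finite ?S" using fB by simp
      fix u x assume "(\<Sum>x\<in>?S. pconst (u x) * x) = 0" "x \<in> ?S"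
      then show "u x = 0"
        using zero[of "\<lambda>\<alpha>. u (monom_value g \<alpha>)"] by (auto simp: sum.reindex[OF inj])
    qed
    then have "card ?S \<le> card ?T"
      using vs.independent_span_bound[OF _ _ sub] X(1) finite_monom_box by blast
    also have "\<dots> \<le> (r * (t * E) + 1) ^ card X"
      using card_image_le[OF finite_monom_box[OF X(1)]] card_monom_box[OF X(1)] by metis
    finally have "(t + 1) ^ r \<le> (r * (t * E) + 1) ^ card X"
      by (simp add: card_image[OF inj] card_monom_box)
    also have "\<dots> \<le> ((r * E + 1) * (t + 1)) ^ card X"
      by (rule power_mono) (auto simp: algebra_simps)
    finally have "(t + 1) ^ r \<le> (r * E + 1) ^ card X * (t + 1) ^ card X"
      unfolding power_mult_distrib .
    moreover have "(t + 1) ^ (card X + 1) \<le> (t + 1) ^ r"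
      using X(2) by (intro power_increasing) auto
    ultimately have "(t + 1) * (t + 1) ^ card X \<le> (r * E + 1) ^ card X * (t + 1) ^ card X"
      by simp
    then show ?thesis by (rule mult_right_le_imp_le) simp
  qed
  from bound[of "(r * E + 1) ^ card X"] show False by simp
qed

section \<open>Minors\<close>

text \<open>
  A minor with its columns listed in arbitrary order and possibly repeated, as they arise when a
  single column is exchanged.
\<close>

definition column_det :: "nat \<Rightarrow> (nat \<Rightarrow> nat \<Rightarrow> 'c::comm_ring_1) \<Rightarrow> (nat \<Rightarrow> nat) \<Rightarrow> 'c" where
  "column_det d A cs = det (mat d d (\<lambda>(a, c). A a (cs c)))"

lemma minor_eq_column_det: "minor d A I = column_det d A ((!) (sorted_list_of_set I))"
  by (simp add: minor_def column_det_def)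

lemma column_det_cong:
  assumes "\<And>a c. a < d \<Longrightarrow> c < d \<Longrightarrow> A a (cs c) = A' a (cs' c)"
  shows "column_det d A cs = column_det d A' cs'"
  unfolding column_det_def using assms by (intro arg_cong[of _ _ det] eq_matI) auto

lemma plucker_index_nth:
  assumes "I \<in> plucker_index d m"
  shows "set (sorted_list_of_set I) = I" "length (sorted_list_of_set I) = d" "finite I"
    "c < d \<Longrightarrow> sorted_list_of_set I ! c \<in> I" "c < d \<Longrightarrow> sorted_list_of_set I ! c < m"
proof -
  show f: "finite I" using assms by (auto simp: plucker_index_def intro: finite_subset)
  then show s: "set (sorted_list_of_set I) = I" and l: "length (sorted_list_of_set I) = d"
    using assms by (auto simp: plucker_index_def)
  show i: "sorted_list_of_set I ! c \<in> I" if "c < d" using that s l nth_mem by metis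
  show "sorted_list_of_set I ! c < m" if "c < d" using i[OF that] assms by (auto simp: plucker_index_def)
qed

lemma minor_cong:
  assumes "I \<in> plucker_index d m" "\<And>a l. a < d \<Longrightarrow> l < m \<Longrightarrow> A a l = A' a l"
  shows "minor d A I = minor d A' I"
  unfolding minor_eq_column_det using plucker_index_nth[OF assms(1)] assms(2)
  by (intro column_det_cong) auto

lemma finite_plucker_index: "finite (plucker_index d m)"
  by (rule finite_subset[of _ "Pow {..<m}"]) (auto simp: plucker_index_def)

lemma hom_column_det:
  assumes "comm_ring_hom \<theta>"
  shows "\<theta> (column_det d A cs) = column_det d (\<lambda>a l. \<theta> (A a l)) cs"
proof -
  interpret comm_ring_hom \<theta> by fact
  show ?thesis unfolding column_det_def hom_det[symmetric]
    by (intro arg_cong[of _ _ det] eq_matI) auto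
qed

lemma hom_minor: "comm_ring_hom \<theta> \<Longrightarrow> \<theta> (minor d A I) = minor d (\<lambda>a l. \<theta> (A a l)) I"
  unfolding minor_eq_column_det by (rule hom_column_det)

lemma column_det_mult:
  "column_det d (\<lambda>a l. \<Sum>b<d. C a b * A b l) cs = det (mat d d (\<lambda>(a, b). C a b)) * column_det d A cs"
proof -
  have "mat d d (\<lambda>(a, c). \<Sum>b<d. C a b * A b (cs c)) =
      mat d d (\<lambda>(a, b). C a b) * mat d d (\<lambda>(a, c). A a (cs c))"
    by (rule eq_matI) (auto simp: scalar_prod_def atLeast0LessThan)
  then show ?thesis unfolding column_det_def
    by (simp add: det_mult[of _ d])
qed

lemma minor_mult:
  "minor d (\<lambda>a l. \<Sum>b<d. C a b * A b l) I = det (mat d d (\<lambda>(a, b). C a b)) * minor d A I"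
  unfolding minor_eq_column_det by (rule column_det_mult)

lemma minor_scale: "minor d (\<lambda>a l. c * A a l) I = c ^ d * minor d A I"
proof -
  have "mat d d (\<lambda>(a, k). c * A a (sorted_list_of_set I ! k)) = c \<cdot>\<^sub>m mat d d (\<lambda>(a, k). A a (sorted_list_of_set I ! k))"
    by (rule eq_matI) auto
  then show ?thesis unfolding minor_def by simp
qed

lemma column_det_permute:
  assumes "p permutes {0..<d}"
  shows "column_det d A (\<lambda>c. cs (p c)) = signof p * column_det d A cs"
proof -
  let ?B = "mat d d (\<lambda>(c, a). A a (cs c))"
  have tr: "column_det d A cs' = det (mat d d (\<lambda>(c, a). A a (cs' c)))" for cs'
  proof -
    have "det (mat d d (\<lambda>(a, c). A a (cs' c))) = det (transpose_mat (mat d d (\<lambda>(a, c). A a (cs' c))))"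
      by (rule det_transpose[symmetric, of _ d]) simp
    also have "transpose_mat (mat d d (\<lambda>(a, c). A a (cs' c))) = mat d d (\<lambda>(c, a). A a (cs' c))"
      by (rule eq_matI) auto
    finally show ?thesis by (simp add: column_det_def)
  qed
  have "mat d d (\<lambda>(c, a). A a (cs (p c))) = mat d d (\<lambda>(c, a). ?B $$ (p c, a))"
    using permutes_in_image[OF assms] by (intro eq_matI) auto
  then show ?thesis
    unfolding tr using det_permute_rows[of ?B d p] assms by simp
qed

text \<open>
  Sorting the columns costs a sign; a repeated column gives \<open>0\<close>. The sign and the index set do not
  depend on the matrix, so that they can be used in a polynomial relation. The index set \<open>I0\<close> is only
  a default value for the case of a repeated column.
\<close>

lemma column_det_eq_signed_minor:
  assumes I0: "I0 \<in> plucker_index d m" and cs: "\<And>c. c < d \<Longrightarrow> cs c < m"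
  shows "\<exists>(\<epsilon>::int) I. I \<in> plucker_index d m \<and>
    (\<forall>A :: nat \<Rightarrow> nat \<Rightarrow> 'c::comm_ring_1. column_det d A cs = of_int \<epsilon> * minor d A I)"
proof (cases "inj_on cs {0..<d}")
  case False
  then obtain x y where xy: "x < d" "y < d" "x \<noteq> y" "cs x = cs y" by (auto simp: inj_on_def)
  have "column_det d A cs = of_int 0 * minor d A I0" for A :: "nat \<Rightarrow> nat \<Rightarrow> 'c"
  proof -
    have "det (mat d d (\<lambda>(a, c). A a (cs c))) = 0"
      by (rule det_identical_columns[of _ d x y]) (use xy in \<open>auto simp: vec_eq_iff\<close>)
    then show ?thesis by (simp add: column_det_def)
  qed
  then show ?thesis using I0 by blast
next
  case True
  define I where "I = cs ` {0..<d}"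
  have I: "I \<in> plucker_index d m"
    using cs by (auto simp: I_def plucker_index_def card_image[OF True])
  let ?L = "sorted_list_of_set I"
  have bij: "bij_betw ((!) ?L) {0..<d} I"
    using bij_betw_nth[of ?L "{..<d}" I] plucker_index_nth[OF I] by (simp add: atLeast0LessThan)
  have bcs: "bij_betw cs {0..<d} I" using True by (simp add: bij_betw_def I_def)
  define p where "p c = (if c \<in> {0..<d} then inv_into {0..<d} ((!) ?L) (cs c) else c)" for c
  have "bij_betw (inv_into {0..<d} ((!) ?L) \<circ> cs) {0..<d} {0..<d}"
    by (rule bij_betw_trans[OF bcs bij_betw_inv_into[OF bij]])
  then have "bij_betw p {0..<d} {0..<d}"
    by (subst bij_betw_cong[where g = "inv_into {0..<d} ((!) ?L) \<circ> cs"]) (auto simp: p_def)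
  then have p: "p permutes {0..<d}" by (rule bij_imp_permutes) (simp add: p_def)
  have "?L ! p c = cs c" if "c < d" for c
    using that bij_betw_inv_into_right[OF bij, of "cs c"] by (auto simp: p_def I_def)
  then have "column_det d A cs = of_int (sign p) * minor d A I" for A :: "nat \<Rightarrow> nat \<Rightarrow> 'c"
    unfolding minor_eq_column_det using column_det_permute[OF p, of A "(!) ?L"]
    by (metis (no_types, lifting) column_det_cong)
  then show ?thesis using I by blast
qed

definition replace_at :: "nat set \<Rightarrow> nat \<Rightarrow> nat \<Rightarrow> nat \<Rightarrow> nat" where
  "replace_at I a l = (\<lambda>c. if c = a then l else sorted_list_of_set I ! c)"

text \<open>
  Cramer's rule, by expansion along the exchanged column: the entries of \<open>adj(A\<^sub>I) A\<close> are the
  minors of \<open>A\<close> in which one column of \<open>I\<close> is exchanged.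
\<close>

lemma cramer_columns:
  assumes a: "a < d"
  shows "column_det d A (replace_at I a l) =
    (\<Sum>b<d. adj_mat (mat d d (\<lambda>(a, c). A a (sorted_list_of_set I ! c))) $$ (a, b) * A b l)"
proof -
  let ?X = "mat d d (\<lambda>(a, c). A a (sorted_list_of_set I ! c))"
  let ?R = "mat d d (\<lambda>(b, c). A b (replace_at I a l c))"
  have "column_det d A (replace_at I a l) = (\<Sum>b<d. ?R $$ (b, a) * cofactor ?R b a)"
    unfolding column_det_def by (rule laplace_expansion_column) (use a in auto)
  also have "\<dots> = (\<Sum>b<d. A b l * cofactor ?X b a)"
  proof (rule sum.cong)
    fix b assume b: "b \<in> {..<d}"
    have "mat_delete ?R b a = mat_delete ?X b a"
      by (rule eq_matI) (auto simp: mat_delete_def replace_at_def)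
    then show "?R $$ (b, a) * cofactor ?R b a = A b l * cofactor ?X b a"
      using a b by (simp add: cofactor_def replace_at_def)
  qed simp
  also have "\<dots> = (\<Sum>b<d. adj_mat ?X $$ (a, b) * A b l)"
    using a by (intro sum.cong) (auto simp: adj_mat_def mult.commute)
  finally show ?thesis .
qed

lemma det_adj_mat:
  assumes "X \<in> carrier_mat d d"
  shows "det (adj_mat X) * det X = det X ^ d"
proof -
  have "det (adj_mat X) * det X = det (adj_mat X * X)"
    using assms adj_mat(1)[OF assms] by (simp add: det_mult)
  also have "\<dots> = det X ^ d" using adj_mat(3)[OF assms] by simp
  finally show ?thesis .
qed

text \<open>
  The \<open>J\<close>-minor of \<open>adj(A\<^sub>I) A\<close> is \<open>det(adj(A\<^sub>I))\<close> times that of \<open>A\<close>, and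
  \<open>det(adj(A\<^sub>I)) det(A\<^sub>I) = det(A\<^sub>I)\<^sup>d\<close>. The additional factor \<open>det(A\<^sub>I)\<close> on both sides makes the
  identity true for \<open>d = 0\<close> as well, where \<open>det(A\<^sub>I)\<^bsup>d-1\<^esup>\<close> has no meaning.
\<close>

lemma minor_of_replaced_columns:
  "minor d A I0 * minor d (\<lambda>a l. column_det d A (replace_at I0 a l)) J = minor d A J * minor d A I0 ^ d"
proof -
  let ?X = "mat d d (\<lambda>(a, c). A a (sorted_list_of_set I0 ! c))"
  let ?C = "\<lambda>a b. adj_mat ?X $$ (a, b)"
  have X: "?X \<in> carrier_mat d d" by simp
  have C: "mat d d (\<lambda>(a, b). ?C a b) = adj_mat ?X"
    using adj_mat(1)[OF X] by (intro eq_matI) auto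
  have "minor d (\<lambda>a l. column_det d A (replace_at I0 a l)) J = minor d (\<lambda>a l. \<Sum>b<d. ?C a b * A b l) J"
    unfolding minor_eq_column_det by (rule column_det_cong) (simp add: cramer_columns)
  also have "\<dots> = det (adj_mat ?X) * minor d A J" by (simp only: minor_mult C)
  finally have "minor d A I0 * minor d (\<lambda>a l. column_det d A (replace_at I0 a l)) J =
      minor d A J * (det (adj_mat ?X) * minor d A I0)"
    by (simp only: ac_simps)
  then show ?thesis
    using det_adj_mat[OF X] by (simp add: minor_def)
qed

lemma det_eq_0_imp_left_kernel:
  assumes "det (mat d d (\<lambda>(a, c). A a c)) = (0 :: 'k::field)"
  shows "\<exists>x. (\<exists>a<d. x a \<noteq> 0) \<and> (\<forall>c<d. (\<Sum>a<d. x a * A a c) = 0)"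
proof -
  let ?T = "mat d d (\<lambda>(c, a). A a c)"
  have "transpose_mat (mat d d (\<lambda>(a, c). A a c)) = ?T" by (rule eq_matI) auto
  then have "det ?T = 0" using assms det_transpose[of "mat d d (\<lambda>(a, c). A a c)" d] by simp
  then obtain v where v: "v \<in> carrier_vec d" "v \<noteq> 0\<^sub>v d" "?T *\<^sub>v v = 0\<^sub>v d"
    using det_0_iff_vec_prod_zero_field[of ?T d] by auto
  show ?thesis
  proof (intro exI[of _ "\<lambda>a. v $ a"] conjI allI impI)
    show "\<exists>a<d. v $ a \<noteq> 0" using v(1,2) by (metis carrier_vecD eq_vecI index_zero_vec(1,2))
    show "(\<Sum>a<d. v $ a * A a c) = 0" if "c < d" for c
    proof -
      have "(?T *\<^sub>v v) $ c = (\<Sum>a<d. A a c * v $ a)"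
        using that v(1) by (auto simp: scalar_prod_def atLeast0LessThan)
      then show ?thesis using v(3) that by (simp add: mult.commute)
    qed
  qed
qed

lemma det_nonzero_left_kernel:
  assumes "det (mat d d (\<lambda>(a, c). A a c)) \<noteq> (0 :: 'k::field)"
    and "\<And>c. c < d \<Longrightarrow> (\<Sum>a<d. x a * A a c) = 0" "a < d"
  shows "x a = 0"
proof (rule ccontr)
  assume "x a \<noteq> 0"
  let ?T = "mat d d (\<lambda>(c, a). A a c)"
  have "transpose_mat (mat d d (\<lambda>(a, c). A a c)) = ?T" by (rule eq_matI) auto
  then have "det ?T \<noteq> 0" using assms(1) det_transpose[of "mat d d (\<lambda>(a, c). A a c)" d] by simp
  moreover have "?T *\<^sub>v vec d x = 0\<^sub>v d"
    by (rule eq_vecI) (use assms(2) in \<open>auto simp: scalar_prod_def atLeast0LessThan mult.commute\<close>)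
  moreover have "vec d x \<noteq> 0\<^sub>v d" using \<open>x a \<noteq> 0\<close> assms(3) by (metis index_vec index_zero_vec(1))
  ultimately show False
    using det_0_iff_vec_prod_zero_field[of ?T d] vec_carrier[of d x] mat_carrier by blast
qed

section \<open>The Pluecker ideal\<close>

text \<open>
  The lexicographic order on the pairs \<open>(a, l)\<close> induces a linear order on the monomials, and it is
  through this order that the polynomial ring is an instance of \<open>idom\<close>.
\<close>

abbreviation generic_matrix :: "nat \<Rightarrow> nat \<Rightarrow> (nat \<times> nat, 'k::field) mpolynomial" where
  "generic_matrix \<equiv> \<lambda>a l. pvar (a, l)"

lemma generic_minor_Some:
  "minor d (\<lambda>a l. pvar (Some (a, l)) :: ((nat \<times> nat) option, 'k::field) mpolynomial) I =
     rename_Some (minor d generic_matrix I)"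
  by (simp add: hom_minor[OF comm_ring_hom_poly_subst[OF comm_ring_hom_pconst]]
      poly_subst_pvar[OF comm_ring_hom_pconst])

lemma plucker_ideal_eq_graded_kernel:
  "plucker_ideal d m = graded_kernel (plucker_index d m) pconst (minor d generic_matrix)"
  unfolding plucker_ideal_def graded_kernel_def generic_minor_Some kernel_with_cone_variable ..

lemma plucker_ideal_carrier: "f \<in> plucker_ideal d m \<Longrightarrow> f \<in> carrier (poly_ring_on (plucker_index d m))"
  by (simp add: plucker_ideal_def)

lemma plucker_ideal_vanishes_on_minors:
  assumes "f \<in> plucker_ideal d m" "comm_ring_hom \<phi>"
    "\<And>I. I \<in> plucker_index d m \<Longrightarrow> v I = z * minor d A I"
  shows "poly_subst \<phi> v f = 0"
proof -
  let ?\<theta> = "poly_subst \<phi> (case_option z (\<lambda>(a, l). A a l))"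
  note c = comm_ring_hom_pconst
  note \<theta> = comm_ring_hom_poly_subst[OF assms(2)]
  interpret \<theta>: comm_ring_hom ?\<theta> by (rule \<theta>)
  have "0 = ?\<theta> (poly_subst pconst (\<lambda>I. pvar None * minor d (\<lambda>a l. pvar (Some (a, l))) I) f)"
    using assms(1) by (simp add: plucker_ideal_def)
  also have "\<dots> = poly_subst \<phi> (\<lambda>I. z * minor d A I) f"
    by (simp add: poly_subst_comp[OF c \<theta>] \<theta>.hom_mult hom_minor[OF \<theta>]
        poly_subst_pvar[OF assms(2)] poly_subst_pconst[OF assms(2)])
  also have "\<dots> = poly_subst \<phi> v f"
    using assms(3) by (intro poly_subst_cong[OF plucker_ideal_carrier[OF assms(1)]]) simp
  finally show ?thesis by simp
qed

lemma lessThan_in_plucker_index: "d \<le> m \<Longrightarrow> {..<d} \<in> plucker_index d m"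
  by (auto simp: plucker_index_def)

lemma nth_sorted_lessThan: "c < d \<Longrightarrow> sorted_list_of_set {..<d} ! c = c"
  by (simp add: lessThan_atLeast0)

lemma minor_lessThan:
  assumes "\<And>a l. a < d \<Longrightarrow> l < d \<Longrightarrow> A a l = (if a = l then 1 else 0)"
  shows "minor d A {..<d} = 1"
proof -
  have "mat d d (\<lambda>(a, c). A a (sorted_list_of_set {..<d} ! c)) = 1\<^sub>m d"
    using assms by (intro eq_matI) (auto simp: nth_sorted_lessThan)
  then show ?thesis by (simp add: minor_def)
qed

lemma generic_minor_nonzero: "minor d generic_matrix {..<d} \<noteq> (0 :: (nat \<times> nat, 'k::field) mpolynomial)"
proof -
  let ?\<theta> = "poly_subst (\<lambda>c. c) (\<lambda>(a, l). if a = l then 1 else 0) :: (nat \<times> nat, 'k) mpolynomial \<Rightarrow> 'k"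
  note i = comm_ring_hom_id
  have "?\<theta> (minor d generic_matrix {..<d}) = 1"
    by (simp add: hom_minor[OF comm_ring_hom_poly_subst[OF i]] poly_subst_pvar[OF i] minor_lessThan)
  then show ?thesis using poly_subst_zero[OF i] by (metis zero_neq_one)
qed

lemma plucker_ideal_in_Proj_points:
  assumes "d \<le> m"
  shows "(plucker_ideal d m :: (nat set, 'k::field) mpolynomial set)
    \<in> Proj_points (plucker_index d m) (plucker_ideal d m)"
  unfolding plucker_ideal_eq_graded_kernel
  by (rule graded_kernel_in_Proj_points[OF comm_ring_hom_pconst lessThan_in_plucker_index[OF assms]])
     (simp_all add: generic_minor_nonzero)

lemma replaced_columns_eq_signed_minor:
  assumes "I0 \<in> plucker_index d m" "l < m"
  shows "\<exists>(\<epsilon>::int) I. I \<in> plucker_index d m \<and> (\<forall>A :: nat \<Rightarrow> nat \<Rightarrow> 'c::comm_ring_1.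
    column_det d A (replace_at I0 a l) = of_int \<epsilon> * minor d A I)"
  using assms plucker_index_nth(5)[OF assms(1)]
  by (intro column_det_eq_signed_minor) (auto simp: replace_at_def)

text \<open>
  The identity for replaced columns, read as a polynomial in the Pluecker coordinates.
  Relations of this form suffice to recover a matrix from a point of the variety.
\<close>

lemma plucker_relation:
  fixes \<epsilon> :: "nat \<Rightarrow> nat \<Rightarrow> int" and \<kappa> :: "nat \<Rightarrow> nat \<Rightarrow> nat set"
  assumes I0: "I0 \<in> plucker_index d m" and J: "J \<in> plucker_index d m"
    and \<kappa>: "\<And>a l. a < d \<Longrightarrow> l < m \<Longrightarrow> \<kappa> a l \<in> plucker_index d m"
    and \<epsilon>: "\<And>a l A. a < d \<Longrightarrow> l < m \<Longrightarrow>
      column_det d (A :: nat \<Rightarrow> nat \<Rightarrow> ((nat \<times> nat) option, 'k::field) mpolynomial) (replace_at I0 a l) =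
        of_int (\<epsilon> a l) * minor d A (\<kappa> a l)"
  shows "pvar J * pvar I0 ^ d - pvar I0 * minor d (\<lambda>a l. of_int (\<epsilon> a l) * pvar (\<kappa> a l)) J
    \<in> (plucker_ideal d m :: (nat set, 'k) mpolynomial set)" (is "?f \<in> _")
proof -
  let ?X = "\<lambda>a l. pvar (Some (a, l)) :: ((nat \<times> nat) option, 'k) mpolynomial"
  let ?z = "pvar None :: ((nat \<times> nat) option, 'k) mpolynomial"
  let ?g = "\<lambda>I. ?z * minor d ?X I"
  note c = comm_ring_hom_pconst
  interpret H: comm_ring_hom "poly_subst pconst ?g" by (rule comm_ring_hom_poly_subst[OF c])
  have of_int: "(of_int x :: (nat set, 'k) mpolynomial) = pconst (of_int x)" for x
  proof -
    interpret comm_ring_hom "pconst :: 'k \<Rightarrow> (nat set, 'k) mpolynomial" by (rule c)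
    show ?thesis by (simp add: hom_of_int)
  qed
  have "minor d (\<lambda>a l. of_int (\<epsilon> a l) * ?g (\<kappa> a l)) J =
      minor d (\<lambda>a l. ?z * column_det d ?X (replace_at I0 a l)) J"
    by (rule minor_cong[OF J]) (simp add: \<epsilon> mult_ac)
  also have "\<dots> = ?z ^ d * minor d (\<lambda>a l. column_det d ?X (replace_at I0 a l)) J" by (rule minor_scale)
  finally have 1: "?g I0 * minor d (\<lambda>a l. of_int (\<epsilon> a l) * ?g (\<kappa> a l)) J =
      ?z * ?z ^ d * (minor d ?X I0 * minor d (\<lambda>a l. column_det d ?X (replace_at I0 a l)) J)"
    by (simp only: mult_ac)
  have "poly_subst pconst ?g ?f = ?g J * ?g I0 ^ d - ?g I0 * minor d (\<lambda>a l. of_int (\<epsilon> a l) * ?g (\<kappa> a l)) J"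
    by (simp add: H.hom_minus H.hom_mult H.hom_power hom_minor[OF comm_ring_hom_poly_subst[OF c]]
        H.hom_of_int poly_subst_pvar[OF c])
  also have "\<dots> = 0"
    unfolding 1 minor_of_replaced_columns by (simp add: power_mult_distrib mult_ac)
  finally have "poly_subst pconst ?g ?f = 0" .
  moreover have "?f \<in> carrier (poly_ring_on (plucker_index d m))"
    unfolding minor_def using I0 J plucker_index_nth(5)[OF J]
    by (intro poly_ring_on_diff poly_ring_on_mult poly_ring_on_power poly_ring_on_det)
       (auto simp: of_int intro!: poly_ring_on_pvar poly_ring_on_mult \<kappa>)
  ultimately show ?thesis by (simp add: plucker_ideal_def)
qed

text \<open>
  At a point with \<open>v I0 = 1\<close> the relation becomes \<open>v J = det((\<plusminus> v (I0 - a + l))\<^sub>J)\<close>, so the point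
  consists of the minors of the matrix with entries \<open>\<plusminus> v (I0 - a + l)\<close>.
\<close>

lemma plucker_point_is_minor_vector:
  fixes v :: "nat set \<Rightarrow> 'k::field"
  assumes I0: "I0 \<in> plucker_index d m" and v1: "v I0 = 1"
    and van: "\<And>f. f \<in> plucker_ideal d m \<Longrightarrow> poly_subst (\<lambda>c. c) v f = 0"
  obtains A where "\<And>J. J \<in> plucker_index d m \<Longrightarrow> minor d A J = v J"
proof -
  have "\<exists>(\<epsilon>::int) I. a < d \<longrightarrow> l < m \<longrightarrow> I \<in> plucker_index d m \<and>
    (\<forall>A :: nat \<Rightarrow> nat \<Rightarrow> ((nat \<times> nat) option, 'k) mpolynomial.
       column_det d A (replace_at I0 a l) = of_int \<epsilon> * minor d A I)" for a l
    using replaced_columns_eq_signed_minor[OF I0, of l a] by blast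
  then obtain \<epsilon> :: "nat \<Rightarrow> nat \<Rightarrow> int" and \<kappa> where \<kappa>: "\<And>a l. a < d \<Longrightarrow> l < m \<Longrightarrow> \<kappa> a l \<in> plucker_index d m"
    and \<epsilon>: "\<And>a l A. a < d \<Longrightarrow> l < m \<Longrightarrow>
      column_det d (A :: nat \<Rightarrow> nat \<Rightarrow> ((nat \<times> nat) option, 'k::field) mpolynomial) (replace_at I0 a l) =
        of_int (\<epsilon> a l) * minor d A (\<kappa> a l)"
    by metis
  note i = comm_ring_hom_id
  interpret H: comm_ring_hom "poly_subst (\<lambda>c. c) v" by (rule comm_ring_hom_poly_subst[OF i])
  show thesis
  proof (rule that[of "\<lambda>a l. of_int (\<epsilon> a l) * v (\<kappa> a l)"])
    fix J assume J: "J \<in> plucker_index d m"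
    have "0 = poly_subst (\<lambda>c. c) v (pvar J * pvar I0 ^ d - pvar I0 * minor d (\<lambda>a l. of_int (\<epsilon> a l) * pvar (\<kappa> a l)) J)"
      using van[OF plucker_relation[OF I0 J \<kappa> \<epsilon>]] by simp
    also have "\<dots> = v J - minor d (\<lambda>a l. of_int (\<epsilon> a l) * v (\<kappa> a l)) J"
      by (simp add: H.hom_minus H.hom_mult H.hom_power hom_minor[OF comm_ring_hom_poly_subst[OF i]]
        H.hom_of_int poly_subst_pvar[OF i] v1)
    finally show "minor d (\<lambda>a l. of_int (\<epsilon> a l) * v (\<kappa> a l)) J = v J" by simp
  qed
qed

section \<open>Krull dimension of the Grassmannian\<close>

text \<open>
  The matrix \<open>(1 | Y)\<close> in which the entries of \<open>Y\<close> outside \<open>S\<close> are set to zero. Its minors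
  parametrise a coordinate subspace of the open chart where the first maximal minor does not vanish.
\<close>

definition affine_chart :: "nat \<Rightarrow> (nat \<times> nat) set \<Rightarrow> nat \<Rightarrow> nat \<Rightarrow> (nat \<times> nat, 'k::field) mpolynomial" where
  "affine_chart d S a l = (if l < d then if a = l then 1 else 0 else if (a, l) \<in> S then pvar (a, l) else 0)"

abbreviation chart_coords :: "nat \<Rightarrow> nat \<Rightarrow> (nat \<times> nat) set" where
  "chart_coords d m \<equiv> {..<d} \<times> {d..<m}"

definition chart_kernel :: "nat \<Rightarrow> nat \<Rightarrow> (nat \<times> nat) set \<Rightarrow> (nat set, 'k::field) mpolynomial set" where
  "chart_kernel d m S = graded_kernel (plucker_index d m) pconst (minor d (affine_chart d S))"

lemma plucker_ideal_subset_chart_kernel: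
  "(plucker_ideal d m :: (nat set, 'k::field) mpolynomial set) \<subseteq> chart_kernel d m S"
proof
  let ?\<theta> = "poly_subst pconst (\<lambda>(a, l). affine_chart d S a l) :: (nat \<times> nat, 'k::field) mpolynomial \<Rightarrow> _"
  note c = comm_ring_hom_pconst
  note \<theta> = comm_ring_hom_poly_subst[OF c]
  fix f :: "(nat set, 'k) mpolynomial" assume f: "f \<in> plucker_ideal d m"
  have "poly_subst pconst (minor d (affine_chart d S)) F = ?\<theta> (poly_subst pconst (minor d generic_matrix) F)" for F
    by (simp add: poly_subst_comp[OF c \<theta>] hom_minor[OF \<theta>] poly_subst_pvar[OF c] poly_subst_pconst[OF c])
  then show "f \<in> chart_kernel d m S"
    using f by (simp add: plucker_ideal_eq_graded_kernel chart_kernel_def graded_kernel_def poly_subst_zero[OF c])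
qed

lemma chart_kernel_antimono:
  assumes "S \<subseteq> S'"
  shows "(chart_kernel d m S' :: (nat set, 'k::field) mpolynomial set) \<subseteq> chart_kernel d m S"
proof
  let ?\<theta> = "poly_subst pconst (\<lambda>x. if x \<in> S then pvar x else 0) :: (nat \<times> nat, 'k::field) mpolynomial \<Rightarrow> (nat \<times> nat, 'k) mpolynomial"
  note c = comm_ring_hom_pconst
  note \<theta> = comm_ring_hom_poly_subst[OF c]
  fix f :: "(nat set, 'k) mpolynomial" assume f: "f \<in> chart_kernel d m S'"
  have "?\<theta> (affine_chart d S' a l) = affine_chart d S a l" for a l
    using assms by (auto simp: affine_chart_def poly_subst_zero[OF c] poly_subst_one[OF c] poly_subst_pvar[OF c])
  then have "poly_subst pconst (minor d (affine_chart d S)) F = ?\<theta> (poly_subst pconst (minor d (affine_chart d S')) F)" for F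
    by (simp add: poly_subst_comp[OF c \<theta>] hom_minor[OF \<theta>] poly_subst_pconst[OF c])
  then show "f \<in> chart_kernel d m S"
    using f by (simp add: chart_kernel_def graded_kernel_def poly_subst_zero[OF c])
qed

lemma minor_affine_chart_lessThan: "minor d (affine_chart d S) {..<d} = 1"
  by (rule minor_lessThan) (simp add: affine_chart_def)

lemma chart_kernel_in_Proj_points:
  assumes "d \<le> m"
  shows "(chart_kernel d m S :: (nat set, 'k::field) mpolynomial set)
    \<in> Proj_points (plucker_index d m) (plucker_ideal d m)"
  unfolding chart_kernel_def
proof (rule graded_kernel_in_Proj_points[OF comm_ring_hom_pconst lessThan_in_plucker_index[OF assms]])
  show "plucker_ideal d m \<subseteq> graded_kernel (plucker_index d m) pconst (minor d (affine_chart d S))"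
    using plucker_ideal_subset_chart_kernel unfolding chart_kernel_def .
qed (simp add: minor_affine_chart_lessThan)

lemma adj_mat_one: "adj_mat (1\<^sub>m d :: 'c::comm_ring_1 mat) = 1\<^sub>m d"
proof -
  have "adj_mat (1\<^sub>m d :: 'c mat) = adj_mat (1\<^sub>m d) * 1\<^sub>m d"
    using adj_mat(1)[of "1\<^sub>m d :: 'c mat" d] by simp
  also have "\<dots> = det (1\<^sub>m d) \<cdot>\<^sub>m 1\<^sub>m d" by (rule adj_mat(3)) simp
  also have "\<dots> = 1\<^sub>m d" by (rule eq_matI) auto
  finally show ?thesis .
qed

text \<open>
  Every entry of \<open>Y\<close> is itself, up to sign, a maximal minor of \<open>(1 | Y)\<close>.
\<close>

lemma column_det_affine_chart:
  assumes "a < d"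
  shows "column_det d (affine_chart d S) (replace_at {..<d} a l) = affine_chart d S a l"
proof -
  let ?X = "mat d d (\<lambda>(a, c). affine_chart d S a (sorted_list_of_set {..<d} ! c))"
  have X: "?X = 1\<^sub>m d"
    by (intro eq_matI) (auto simp: nth_sorted_lessThan affine_chart_def)
  have "column_det d (affine_chart d S) (replace_at {..<d} a l) = (\<Sum>b<d. adj_mat ?X $$ (a, b) * affine_chart d S b l)"
    by (rule cramer_columns[OF assms])
  also have "\<dots> = (\<Sum>b<d. if b = a then affine_chart d S b l else 0)"
    unfolding X adj_mat_one using assms by (intro sum.cong) auto
  also have "\<dots> = affine_chart d S a l" using assms by (simp add: sum.delta)
  finally show ?thesis .
qed

text \<open>
  The minor equal to \<open>\<plusminus>\<close> the entry \<open>x\<close> vanishes on the smaller coordinate subspace only.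
\<close>

lemma chart_kernel_strict:
  assumes "d \<le> m" and x: "x \<in> S'" "x \<notin> S" "x \<in> chart_coords d m" and "S \<subseteq> S'"
  shows "(chart_kernel d m S' :: (nat set, 'k::field) mpolynomial set) \<subset> chart_kernel d m S"
proof -
  obtain a l where al: "x = (a, l)" "a < d" "d \<le> l" "l < m" using x(3) by auto
  note I0 = lessThan_in_plucker_index[OF assms(1)]
  obtain \<epsilon> :: int and I where I: "I \<in> plucker_index d m"
    and \<epsilon>: "\<And>A :: nat \<Rightarrow> nat \<Rightarrow> (nat \<times> nat, 'k) mpolynomial.
      column_det d A (replace_at {..<d} a l) = of_int \<epsilon> * minor d A I"
    using replaced_columns_eq_signed_minor[OF I0 al(4), of a] by blast
  have "of_int \<epsilon> * minor d (affine_chart d S') I = (pvar (a, l) :: (nat \<times> nat, 'k) mpolynomial)"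
    unfolding \<epsilon>[symmetric] column_det_affine_chart[OF al(2)] using x(1) al by (simp add: affine_chart_def)
  moreover have "pvar (a, l) \<noteq> (0 :: (nat \<times> nat, 'k) mpolynomial)"
  proof
    assume "pvar (a, l) = (0 :: (nat \<times> nat, 'k) mpolynomial)"
    from arg_cong[OF this, of "poly_subst (\<lambda>c. c) (\<lambda>_. 1)"] show False
      by (simp add: poly_subst_pvar[OF comm_ring_hom_id] poly_subst_zero[OF comm_ring_hom_id])
  qed
  ultimately have nz: "of_int \<epsilon> \<noteq> (0 :: (nat \<times> nat, 'k) mpolynomial)"
    "minor d (affine_chart d S') I \<noteq> (0 :: (nat \<times> nat, 'k) mpolynomial)" by auto
  have "of_int \<epsilon> * minor d (affine_chart d S) I = (0 :: (nat \<times> nat, 'k) mpolynomial)"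
    unfolding \<epsilon>[symmetric] column_det_affine_chart[OF al(2)] using x(2) al by (simp add: affine_chart_def)
  then have "of_int \<epsilon> = (0 :: (nat \<times> nat, 'k) mpolynomial) \<or>
      minor d (affine_chart d S) I = (0 :: (nat \<times> nat, 'k) mpolynomial)"
    by (simp only: mult_eq_0_iff)
  with nz(1) have "minor d (affine_chart d S) I = (0 :: (nat \<times> nat, 'k) mpolynomial)" by metis
  with nz(2) have "pvar I \<in> (chart_kernel d m S :: (nat set, 'k) mpolynomial set)"
    "pvar I \<notin> (chart_kernel d m S' :: (nat set, 'k) mpolynomial set)"
    unfolding chart_kernel_def pvar_in_graded_kernel_iff[OF comm_ring_hom_pconst I] by auto
  then show ?thesis using chart_kernel_antimono[OF assms(5)] by blast
qed

lemma comm_ring_hom_to_fract: "comm_ring_hom (to_fract :: 'r::idom \<Rightarrow> 'r fract)"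
  by unfold_locales auto

text \<open>
  Over the fraction field of the generic matrix \<open>X\<close>, the matrix \<open>Y = X\<^sub>0\<^sup>-\<^sup>1 X\<close>, where \<open>X\<^sub>0\<close>
  consists of the first \<open>d\<close> columns, is a specialisation of the chart, and its minors are those of
  \<open>X\<close> up to the common factor \<open>det(X\<^sub>0)\<^sup>-\<^sup>1\<close>, which a homogeneous relation does not see.
\<close>

lemma chart_kernel_eq_plucker_ideal:
  assumes "d \<le> m"
  shows "chart_kernel d m (chart_coords d m) = (plucker_ideal d m :: (nat set, 'k::field) mpolynomial set)"
proof (rule antisym[OF _ plucker_ideal_subset_chart_kernel], rule subsetI)
  let ?S = "chart_coords d m"
  let ?X = "generic_matrix :: nat \<Rightarrow> nat \<Rightarrow> (nat \<times> nat, 'k) mpolynomial"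
  let ?M = "mat d d (\<lambda>(a, c). ?X a (sorted_list_of_set {..<d} ! c))"
  define \<delta> where "\<delta> = minor d ?X {..<d}"
  define C where "C a b = to_fract (adj_mat ?M $$ (a, b)) / to_fract \<delta>" for a b
  define Y where "Y a l = (\<Sum>b<d. C a b * to_fract (?X b l))" for a l
  let ?\<theta> = "poly_subst (\<lambda>c. to_fract (pconst c)) (\<lambda>(a, l). Y a l)"
  let ?D = "det (mat d d (\<lambda>(a, b). C a b))"
  note c = comm_ring_hom_pconst
  note fr = comm_ring_hom_to_fract
  interpret fr: comm_ring_hom "to_fract :: (nat \<times> nat, 'k) mpolynomial \<Rightarrow> _" by (rule fr)
  note cf = comm_ring_hom_comp[OF c fr]
  note \<theta> = comm_ring_hom_poly_subst[OF cf]
  have \<delta>0: "\<delta> \<noteq> 0"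
    unfolding \<delta>_def by (rule generic_minor_nonzero)
  have Yid: "Y a l = (if a = l then 1 else 0)" if "a < d" "l < d" for a l
  proof -
    have X0: "?M \<in> carrier_mat d d" by simp
    have "(\<Sum>b<d. adj_mat ?M $$ (a, b) * ?X b l) = (adj_mat ?M * ?M) $$ (a, l)"
      using that adj_mat(1)[OF X0] by (auto simp: scalar_prod_def atLeast0LessThan nth_sorted_lessThan)
    also have "\<dots> = (if a = l then \<delta> else 0)"
      using that by (simp add: adj_mat(3)[OF X0] \<delta>_def minor_def)
    finally have "to_fract (\<Sum>b<d. adj_mat ?M $$ (a, b) * ?X b l) = (if a = l then to_fract \<delta> else 0)" by simp
    moreover have "Y a l = to_fract (\<Sum>b<d. adj_mat ?M $$ (a, b) * ?X b l) / to_fract \<delta>"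
      by (simp add: Y_def C_def fr.hom_sum fr.hom_mult sum_divide_distrib)
    ultimately show ?thesis using \<delta>0 by simp
  qed
  have Ychart: "?\<theta> (affine_chart d ?S a l) = Y a l" if "a < d" "l < m" for a l
    using that Yid by (auto simp: affine_chart_def poly_subst_zero[OF cf] poly_subst_one[OF cf] poly_subst_pvar[OF cf])
  have minY: "minor d Y I = ?D * to_fract (minor d ?X I)" for I
    unfolding Y_def minor_mult hom_minor[OF fr] ..
  have D: "?D \<noteq> 0"
  proof
    assume "?D = 0"
    then have "minor d Y {..<d} = 0" by (simp add: minY)
    then show False using minor_lessThan[of d Y] Yid by simp
  qed
  fix f :: "(nat set, 'k) mpolynomial"
  assume f: "f \<in> chart_kernel d m ?S"
  have "poly_subst pconst (minor d ?X) (hom_component E f) = 0" for E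
  proof -
    let ?f = "hom_component E f"
    have fc: "?f \<in> carrier (poly_ring_on (plucker_index d m))"
      using f by (auto simp: chart_kernel_def graded_kernel_def intro: poly_ring_on_hom_component)
    have "0 = ?\<theta> (poly_subst pconst (minor d (affine_chart d ?S)) ?f)"
      using f by (simp add: chart_kernel_def graded_kernel_def poly_subst_zero[OF cf])
    also have "\<dots> = poly_subst (\<lambda>c. to_fract (pconst c)) (\<lambda>I. minor d (\<lambda>a l. ?\<theta> (affine_chart d ?S a l)) I) ?f"
      by (simp add: poly_subst_comp[OF c \<theta>] hom_minor[OF \<theta>] poly_subst_pconst[OF cf])
    also have "\<dots> = poly_subst (\<lambda>c. to_fract (pconst c)) (\<lambda>I. ?D * to_fract (minor d ?X I)) ?f"
      unfolding minY[symmetric] by (rule poly_subst_cong[OF fc], rule minor_cong) (auto simp: Ychart)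
    also have "\<dots> = ?D ^ E * to_fract (poly_subst pconst (minor d ?X) ?f)"
      by (simp add: poly_subst_hom_component_scaled poly_subst_comp[OF c fr])
    finally show ?thesis using D by simp
  qed
  then show "f \<in> plucker_ideal d m"
    using f by (simp add: plucker_ideal_eq_graded_kernel chart_kernel_def graded_kernel_def)
qed

text \<open>
  Evaluation at \<open>0\<close> has as its graded kernel the ideal generated by the variables.
\<close>

definition irrelevant_ideal :: "'b set \<Rightarrow> ('b, 'k::field) mpolynomial set" where
  "irrelevant_ideal B = graded_kernel B (\<lambda>c. c) (\<lambda>_. 0 :: 'k)"

lemma irrelevant_ideal_iff:
  "f \<in> irrelevant_ideal B \<longleftrightarrow> f \<in> carrier (poly_ring_on B) \<and> Poly_Mapping.lookup f 0 = 0"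
proof -
  note i = comm_ring_hom_id
  have "poly_subst (\<lambda>c. c) (\<lambda>_. 0) (hom_component D f) = (if D = 0 then Poly_Mapping.lookup f 0 else 0)" for D
  proof (cases "D = 0")
    case True
    then show ?thesis by (simp add: hom_component_0 poly_subst_pconst[OF i])
  next
    case False
    then show ?thesis
      using poly_subst_hom_component_scaled[of "\<lambda>c. c" 0 "\<lambda>_. 1" D f] by simp
  qed
  then show ?thesis by (auto simp: irrelevant_ideal_def graded_kernel_def)
qed

lemma Proj_point_psubset_irrelevant_ideal:
  fixes P :: "('b, 'k::field) mpolynomial set"
  assumes "P \<in> Proj_points B I"
  shows "P \<subset> irrelevant_ideal B"
proof -
  interpret primeideal P "poly_ring_on B" using assms by (simp add: Proj_points_def)
  have "Poly_Mapping.lookup f 0 = 0" if "f \<in> P" for f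
  proof (rule ccontr)
    let ?c = "Poly_Mapping.lookup f 0"
    assume c: "?c \<noteq> 0"
    have "hom_component 0 f \<in> P" using that assms by (simp add: Proj_points_def)
    then have "pconst (1 / ?c) * pconst ?c \<in> P"
      using I_l_closed[of "pconst ?c" "pconst (1 / ?c)"] by (simp add: hom_component_0)
    then have "1 \<in> P" using c by (simp add: pconst_def mult_single)
    then show False using one_imp_carrier I_notcarr by simp
  qed
  then have "P \<subseteq> irrelevant_ideal B" using a_Hcarr by (auto simp: irrelevant_ideal_iff)
  moreover have "pvar ` B \<subseteq> irrelevant_ideal B"
    by (auto simp: irrelevant_ideal_def pvar_in_graded_kernel_iff[OF comm_ring_hom_id])
  ultimately show ?thesis using assms by (auto simp: Proj_points_def)
qed

text \<open>
  Downwards along the chain, starting from the irrelevant ideal, modulo which the empty family is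
  independent. Appending the irrelevant ideal accounts for the one element more than the length of
  the chain, i.e. for the dimension of the affine cone.
\<close>

lemma chain_alg_indep:
  fixes P :: "nat \<Rightarrow> ('b, 'k::field) mpolynomial set"
  assumes P: "\<And>l. l \<le> L \<Longrightarrow> P l \<in> Proj_points B I" and less: "\<And>l. l < L \<Longrightarrow> P l \<subset> P (Suc l)"
  shows "\<exists>y. (\<forall>i<Suc L. y i \<in> carrier (poly_ring_on B)) \<and> alg_indep_mod (P 0) y (Suc L)"
proof -
  have prime: "primeideal (P l) (poly_ring_on B)" if "l \<le> L" for l
    using P[OF that] by (simp add: Proj_points_def)
  have "\<exists>y. (\<forall>i<Suc k. y i \<in> carrier (poly_ring_on B)) \<and> alg_indep_mod (P (L - k)) y (Suc k)" if "k \<le> L" for k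
    using that
  proof (induction k)
    case 0
    obtain q where q: "q \<in> irrelevant_ideal B" "q \<notin> P L"
      using Proj_point_psubset_irrelevant_ideal[OF P[of L]] by blast
    have "alg_indep_mod (irrelevant_ideal B :: ('b, 'k) mpolynomial set) (\<lambda>_. 0) 0"
      unfolding alg_indep_mod_def
    proof (intro ballI impI)
      fix f :: "(nat, 'k) mpolynomial"
      assume f: "f \<in> carrier (poly_ring_on {..<0})" "poly_subst pconst (\<lambda>_. 0) f \<in> irrelevant_ideal B"
      have "f = pconst (Poly_Mapping.lookup f 0)"
        using f(1) by (intro poly_mapping_eqI)
          (auto simp: in_poly_ring_on pconst_def lookup_single when_def in_keys_iff)
      then show "f = 0" using f(2)
        by (metis irrelevant_ideal_iff lookup_single_eq pconst_def poly_subst_pconst[OF comm_ring_hom_pconst] single_zero)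
    qed
    then have "alg_indep_mod (P L) ((\<lambda>_. 0)(0 := q)) (Suc 0)"
      using q Proj_point_psubset_irrelevant_ideal[OF P[of L]]
      by (intro alg_indep_mod_extend[OF prime, of L "irrelevant_ideal B"])
         (auto simp: irrelevant_ideal_def intro: ideal_graded_kernel[OF comm_ring_hom_id])
    moreover have "q \<in> carrier (poly_ring_on B)" using q(1) by (simp add: irrelevant_ideal_iff)
    then have "\<forall>i<Suc 0. ((\<lambda>_. 0)(0 := q)) i \<in> carrier (poly_ring_on B)" by simp
    ultimately show ?case unfolding diff_zero by blast
  next
    case (Suc k)
    then obtain y where y: "\<forall>i<Suc k. y i \<in> carrier (poly_ring_on B)" "alg_indep_mod (P (L - k)) y (Suc k)" by auto
    have S: "L - k = Suc (L - Suc k)" using Suc.prems by simp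
    obtain q where q: "q \<in> P (L - k)" "q \<notin> P (L - Suc k)"
      using less[of "L - Suc k"] Suc.prems S by auto
    interpret Q: primeideal "P (L - k)" "poly_ring_on B" by (rule prime) simp
    have "alg_indep_mod (P (L - Suc k)) (y(Suc k := q)) (Suc (Suc k))"
    proof (rule alg_indep_mod_extend[OF prime Q.is_ideal _ q _ y(2)])
      show "P (L - Suc k) \<subseteq> P (L - k)" using less[of "L - Suc k"] Suc.prems S by auto
    qed (use y(1) in auto)
    moreover have "\<forall>i<Suc (Suc k). (y(Suc k := q)) i \<in> carrier (poly_ring_on B)"
      using y(1) Q.a_Hcarr[OF q(1)] by (simp add: less_Suc_eq)
    ultimately show ?case by blast
  qed
  from this[of L] show ?thesis by simp
qed

text \<open>
  The polynomial ring of the cone over the chart has the entries of \<open>Y\<close> and the cone variable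
  \<open>None\<close> as its \<open>d (m - d) + 1\<close> variables.
\<close>

proposition Proj_dim_plucker_ideal:
  assumes "d \<le> m"
  shows "Proj_dim (plucker_index d m) (plucker_ideal d m :: (nat set, 'k::field) mpolynomial set) =
    ereal (real (d * (m - d)))"
  unfolding Proj_dim_def
proof (rule Sup_eqI)
  let ?S = "chart_coords d m" and ?B = "plucker_index d m"
  have cardS: "card ?S = d * (m - d)" by (simp add: card_cartesian_product)
  fix x assume "x \<in> {ereal (real L) |L. \<exists>P :: nat \<Rightarrow> (nat set, 'k) mpolynomial set.
    (\<forall>l\<le>L. P l \<in> Proj_points ?B (plucker_ideal d m)) \<and> (\<forall>l<L. P l \<subset> P (Suc l))}"
  then obtain L and P :: "nat \<Rightarrow> (nat set, 'k) mpolynomial set" where x: "x = ereal (real L)"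
    and P: "\<And>l. l \<le> L \<Longrightarrow> P l \<in> Proj_points ?B (plucker_ideal d m)" "\<And>l. l < L \<Longrightarrow> P l \<subset> P (Suc l)"
    by auto
  obtain y where y: "\<And>i. i < Suc L \<Longrightarrow> y i \<in> carrier (poly_ring_on ?B)" "alg_indep_mod (P 0) y (Suc L)"
    using chain_alg_indep[of L P ?B "plucker_ideal d m"] P by blast
  have "L \<le> d * (m - d)"
  proof (rule ccontr)
    assume "\<not> L \<le> d * (m - d)"
    let ?X = "insert None (Some ` ?S)"
    have "card ?X = Suc (d * (m - d))" by (simp add: card_insert_if card_image cardS image_iff)
    then have X: "finite ?X" "card ?X < Suc L" using \<open>\<not> L \<le> d * (m - d)\<close> by auto
    let ?\<psi> = "\<lambda>I. pvar None * rename_Some (minor d (affine_chart d ?S) I) :: ((nat \<times> nat) option, 'k) mpolynomial"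
    note c = comm_ring_hom_pconst
    have \<psi>X: "?\<psi> I \<in> carrier (poly_ring_on ?X)" if "I \<in> ?B" for I
      unfolding minor_def
      using plucker_index_nth(5)[OF that]
      by (intro poly_ring_on_mult poly_ring_on_pvar poly_ring_on_poly_subst[of _ ?S] poly_ring_on_det)
         (auto simp: affine_chart_def intro!: poly_ring_on_pvar)
    have "poly_subst pconst ?\<psi> (y i) \<in> carrier (poly_ring_on ?X)" if "i < Suc L" for i
      using y(1)[OF that] by (rule poly_ring_on_poly_subst) (rule \<psi>X)
    from algebraically_dependent[OF X, of "\<lambda>i. poly_subst pconst ?\<psi> (y i)", OF this] obtain f where f: "f \<in> carrier (poly_ring_on {..<Suc L})" "f \<noteq> 0"
      "poly_subst pconst (\<lambda>i. poly_subst pconst ?\<psi> (y i)) f = 0" by blast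
    then have "poly_subst pconst ?\<psi> (poly_subst pconst y f) = 0"
      by (simp add: poly_subst_comp[OF c comm_ring_hom_poly_subst[OF c]] poly_subst_pconst[OF c])
    moreover have "poly_subst pconst y f \<in> carrier (poly_ring_on ?B)"
      using f(1) by (rule poly_ring_on_poly_subst) (simp add: y(1))
    ultimately have "poly_subst pconst y f \<in> chart_kernel d m ?S"
      unfolding kernel_with_cone_variable by (simp add: chart_kernel_def graded_kernel_def)
    then have "poly_subst pconst y f \<in> P 0"
      using P(1)[of 0] by (auto simp: chart_kernel_eq_plucker_ideal[OF assms] Proj_points_def)
    then show False using y(2) f by (auto simp: alg_indep_mod_def)
  qed
  then show "x \<le> ereal (real (d * (m - d)))" by (simp only: x ereal_less_eq of_nat_le_iff)
next
  let ?S = "chart_coords d m" and ?B = "plucker_index d m"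
  let ?N = "d * (m - d)"
  have cardS: "card ?S = ?N" by (simp add: card_cartesian_product)
  obtain g where g: "bij_betw g {..<?N} ?S"
    using ex_bij_betw_nat_finite[of ?S] cardS by (auto simp: atLeast0LessThan)
  define P :: "nat \<Rightarrow> (nat set, 'k) mpolynomial set" where "P l = chart_kernel d m (?S - g ` {..<l})" for l
  have "P l \<subset> P (Suc l)" if "l < ?N" for l
    unfolding P_def
  proof (rule chart_kernel_strict[OF assms, of "g l"])
    have "g l \<noteq> g x" if "x < l" for x
      using inj_onD[OF bij_betw_imp_inj_on[OF g], of l x] \<open>l < ?N\<close> that by auto
    then show "g l \<in> ?S - g ` {..<l}" using g that by (auto simp: bij_betw_def)
    show "g l \<in> ?S" using g that by (auto simp: bij_betw_def)
  qed auto
  moreover have "P l \<in> Proj_points ?B (plucker_ideal d m)" for l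
    unfolding P_def by (rule chart_kernel_in_Proj_points[OF assms])
  ultimately have mem: "ereal (real ?N) \<in> {ereal (real L) |L. \<exists>P :: nat \<Rightarrow> (nat set, 'k) mpolynomial set.
    (\<forall>l\<le>L. P l \<in> Proj_points ?B (plucker_ideal d m)) \<and> (\<forall>l<L. P l \<subset> P (Suc l))}" by blast
  fix y assume "\<And>z. z \<in> {ereal (real L) |L. \<exists>P :: nat \<Rightarrow> (nat set, 'k) mpolynomial set.
    (\<forall>l\<le>L. P l \<in> Proj_points ?B (plucker_ideal d m)) \<and> (\<forall>l<L. P l \<subset> P (Suc l))} \<Longrightarrow> z \<le> y"
  from this[OF mem] show "ereal (real ?N) \<le> y" .
qed

section \<open>Pluecker coordinates of subspaces\<close>

lemma proj_line_scale:
  assumes "c \<noteq> (0::'k::field)"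
  shows "proj_line (\<lambda>I. c * v I) = proj_line v"
proof (intro equalityI subsetI)
  fix w assume "w \<in> proj_line (\<lambda>I. c * v I)"
  then obtain x where "w = (\<lambda>I. (x * c) * v I)" "x \<noteq> 0" by (auto simp: proj_line_def mult.assoc)
  then show "w \<in> proj_line v" using assms unfolding proj_line_def by (intro CollectI exI[of _ "x * c"]) simp
next
  fix w assume "w \<in> proj_line v"
  then obtain x where "w = (\<lambda>I. x * v I)" "x \<noteq> 0" by (auto simp: proj_line_def)
  then show "w \<in> proj_line (\<lambda>I. c * v I)"
    using assms unfolding proj_line_def by (intro CollectI exI[of _ "x / c"]) simp
qed

lemma proj_line_eqD:
  assumes "proj_line v = proj_line w"
  obtains c where "c \<noteq> (0::'k::field)" "w = (\<lambda>I. c * v I)"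
proof -
  have "w \<in> proj_line w" unfolding proj_line_def by (intro CollectI exI[of _ 1]) simp
  then show thesis using that assms by (auto simp: proj_line_def)
qed

context vector_space
begin

text \<open>
  A family with repetitions may have an independent image, hence the injectivity; the condition on
  coefficients treats both at once.
\<close>

lemma independent_family_iff:
  "inj_on u {..<d} \<and> independent (u ` {..<d}) \<longleftrightarrow>
    (\<forall>x. (\<Sum>a<d. scale (x a) (u a)) = 0 \<longrightarrow> (\<forall>a<d. x a = 0))" for d :: nat
proof (intro iffI conjI allI impI)
  fix x a assume 1: "inj_on u {..<d} \<and> independent (u ` {..<d})" "(\<Sum>a<d. scale (x a) (u a)) = 0" "a < d"
  let ?y = "\<lambda>v. x (inv_into {..<d} u v)"
  have "(\<Sum>v\<in>u ` {..<d}. scale (?y v) v) = (\<Sum>a<d. scale (x a) (u a))"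
    using 1(1) by (subst sum.reindex) (auto intro!: sum.cong)
  then have "?y (u a) = 0"
    using 1 independentD[of "u ` {..<d}" "u ` {..<d}" ?y "u a"] by auto
  then show "x a = 0" using 1 by simp
next
  assume 2: "\<forall>x. (\<Sum>a<d. scale (x a) (u a)) = 0 \<longrightarrow> (\<forall>a<d. x a = 0)"
  show inj: "inj_on u {..<d}"
  proof (rule inj_onI, rule ccontr)
    fix p q assume pq: "p \<in> {..<d}" "q \<in> {..<d}" "u p = u q" "p \<noteq> q"
    let ?x = "\<lambda>a. if a = p then 1 else if a = q then -1 else 0"
    have "scale (?x a) (u a) = (if a = p then u p else 0) - (if a = q then u q else 0)" for a
      using pq(4) by auto
    then have "(\<Sum>a<d. scale (?x a) (u a)) = 0"
      using pq by (simp add: sum_subtractf sum.delta)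
    then show False using 2[rule_format, of ?x p] pq(1) by simp
  qed
  show "independent (u ` {..<d})"
  proof (rule independent_if_scalars_zero)
    fix f v assume "(\<Sum>v\<in>u ` {..<d}. scale (f v) v) = 0" "v \<in> u ` {..<d}"
    then show "f v = 0" using 2[rule_format, of "\<lambda>a. f (u a)"] by (auto simp: sum.reindex[OF inj])
  qed simp
qed

end

context fd_algebra
begin

definition row_vector :: "(nat \<Rightarrow> 'a) \<Rightarrow> nat \<Rightarrow> (nat \<Rightarrow> nat \<Rightarrow> 'k) \<Rightarrow> nat \<Rightarrow> 'a" where
  "row_vector b m A a = (\<Sum>l<m. scale (A a l) (b l))"

definition coord_matrix :: "(nat \<Rightarrow> 'a) \<Rightarrow> nat \<Rightarrow> (nat \<Rightarrow> 'a) \<Rightarrow> nat \<Rightarrow> nat \<Rightarrow> 'k" where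
  "coord_matrix b m u a l = representation (b ` {..<m}) (u a) (b l)"

lemma plucker_vector_eq:
  "plucker_vector b m d u I = (if I \<in> plucker_index d m then minor d (coord_matrix b m u) I else 0)"
  by (simp add: plucker_vector_def coord_matrix_def[abs_def])

lemma ordered_basis_family:
  assumes "ordered_basis u d U" "(\<Sum>a<d. scale (x a) (u a)) = 0" "a < d"
  shows "x a = 0"
  using assms independent_family_iff[of u d] by (auto simp: ordered_basis_def)

lemma ordered_basisI:
  assumes "\<And>x a. (\<Sum>a<d. scale (x a) (u a)) = 0 \<Longrightarrow> a < d \<Longrightarrow> x a = 0"
  shows "ordered_basis u d (span (u ` {..<d}))"
  using assms independent_family_iff[of u d] by (auto simp: ordered_basis_def)

lemma ordered_basis_dim: "ordered_basis u d U \<Longrightarrow> dim U = d"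
  by (auto simp: ordered_basis_def dim_span dim_eq_card_independent card_image)

lemma ordered_basis_subspace: "ordered_basis u d U \<Longrightarrow> subspace U"
  by (auto simp: ordered_basis_def)

lemma ordered_basis_mem: "ordered_basis u d U \<Longrightarrow> a < d \<Longrightarrow> u a \<in> U"
  by (auto simp: ordered_basis_def intro: span_base)

lemma ordered_basis_coords:
  assumes "ordered_basis u d U" "x \<in> U"
  obtains c where "x = (\<Sum>a<d. scale (c a) (u a))"
proof -
  have u: "inj_on u {..<d}" "independent (u ` {..<d})" "x \<in> span (u ` {..<d})"
    using assms by (auto simp: ordered_basis_def)
  have "x = (\<Sum>v\<in>u ` {..<d}. scale (representation (u ` {..<d}) x v) v)"
    using sum_representation_eq[OF u(2,3), of "u ` {..<d}"] by simp
  then show thesis using that[of "\<lambda>a. representation (u ` {..<d}) x (u a)"]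
    by (simp add: sum.reindex[OF u(1)])
qed

lemma ex_ordered_basis:
  assumes "subspace U" "dim U = d"
  obtains u where "ordered_basis u d U"
proof -
  obtain B where B: "B \<subseteq> U" "independent B" "U \<subseteq> span B" "card B = dim U"
    by (rule basis_exists[of U])
  obtain S where S: "finite S" "span S = UNIV" using finite_dim by blast
  have "finite B" using independent_span_bound[OF S(1) B(2)] S(2) by simp
  then obtain u where u: "bij_betw u {0..<card B} B" using ex_bij_betw_nat_finite by blast
  have "span B = U" using B span_minimal[OF B(1) assms(1)] by auto
  with u B assms(2) have "ordered_basis u d U"
    by (auto simp: ordered_basis_def bij_betw_def atLeast0LessThan)
  then show thesis by (rule that)
qed

context
  fixes b :: "nat \<Rightarrow> 'a" and m :: nat and V :: "'a set"
  assumes b: "ordered_basis b m V"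
begin

lemma basis_facts: "inj_on b {..<m}" "independent (b ` {..<m})" "span (b ` {..<m}) = V"
  using b by (auto simp: ordered_basis_def)

lemma row_vector_in_V: "row_vector b m A a \<in> V"
  unfolding row_vector_def basis_facts(3)[symmetric]
  by (intro span_sum span_scale span_base) auto

lemma coord_matrix_row_vector:
  assumes "l < m"
  shows "coord_matrix b m (row_vector b m A) a l = A a l"
proof -
  have rep: "representation (b ` {..<m}) (b k) (b l) = (if k = l then 1 else 0)" if "k < m" for k
    using representation_basis[OF basis_facts(2), of "b k"] that assms inj_onD[OF basis_facts(1), of k l] by auto
  have "representation (b ` {..<m}) (row_vector b m A a) (b l) =
      (\<Sum>k<m. A a k * representation (b ` {..<m}) (b k) (b l))"
    unfolding row_vector_def
    by (subst representation_sum[OF basis_facts(2)])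
       (auto intro: span_scale span_base intro!: sum.cong simp: representation_scale[OF basis_facts(2)] span_base)
  also have "\<dots> = (\<Sum>k<m. if k = l then A a k else 0)" by (intro sum.cong) (auto simp: rep)
  also have "\<dots> = A a l" using assms by (simp add: sum.delta)
  finally show ?thesis by (simp add: coord_matrix_def)
qed

lemma row_vector_coord_matrix:
  assumes "u a \<in> V"
  shows "row_vector b m (coord_matrix b m u) a = u a"
proof -
  have "(\<Sum>v\<in>b ` {..<m}. scale (representation (b ` {..<m}) (u a) v) v) = u a"
    using assms basis_facts by (intro sum_representation_eq) auto
  then show ?thesis by (simp add: row_vector_def coord_matrix_def sum.reindex[OF basis_facts(1)])
qed

lemma sum_row_vectors:
  "(\<Sum>a<d. scale (x a) (row_vector b m A a)) = (\<Sum>l<m. scale (\<Sum>a<d. x a * A a l) (b l))" for d :: nat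
  unfolding row_vector_def
  by (simp add: scale_sum_right scale_sum_left sum.swap[of _ "{..<m}"])

lemma row_vector_mult:
  "row_vector b m (\<lambda>a l. \<Sum>c<d. C a c * A c l) a = (\<Sum>c<d. scale (C a c) (row_vector b m A c))" for d :: nat
  unfolding sum_row_vectors by (simp add: row_vector_def)

lemma combination_zero:
  assumes "(\<Sum>l<m. scale (y l) (b l)) = 0" "l < m"
  shows "y l = 0"
  by (rule ordered_basis_family[OF b assms])

text \<open>
  A linear relation between the rows of \<open>A\<close> is one between the rows of each square submatrix.
\<close>

lemma nonzero_minor_imp_ordered_basis:
  assumes I: "I \<in> plucker_index d m" and nz: "minor d A I \<noteq> 0"
  shows "ordered_basis (row_vector b m A) d (span (row_vector b m A ` {..<d}))"
proof (rule ordered_basisI)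
  fix x a assume 0: "(\<Sum>a<d. scale (x a) (row_vector b m A a)) = 0" and a: "a < d"
  have "(\<Sum>a<d. x a * A a l) = 0" if "l < m" for l
    using combination_zero[OF 0[unfolded sum_row_vectors] that] .
  then show "x a = 0"
    using det_nonzero_left_kernel[of d "\<lambda>a c. A a (sorted_list_of_set I ! c)" x a] nz a
      plucker_index_nth(5)[OF I]
    by (simp add: minor_def)
qed

text \<open>
  Extend the basis of \<open>U\<close> by some of the vectors \<open>b l\<close>, \<open>l \<in> I'\<close>, to a basis of \<open>V\<close>, and let \<open>I\<close>
  be the complement of \<open>I'\<close>. If the \<open>I\<close>-minor vanished, some nontrivial combination of the basis of
  \<open>U\<close> would have no coordinates in \<open>I\<close> and so lie in the span of the added vectors.
\<close>

lemma ordered_basis_imp_nonzero_minor: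
  assumes u: "ordered_basis u d U" and UV: "U \<subseteq> V"
  obtains I where "I \<in> plucker_index d m" "minor d (coord_matrix b m u) I \<noteq> 0"
proof -
  have ui: "inj_on u {..<d}" "independent (u ` {..<d})" "span (u ` {..<d}) = U"
    using u by (auto simp: ordered_basis_def)
  have uV: "u ` {..<d} \<subseteq> V" using ordered_basis_mem[OF u] UV by auto
  let ?W = "u ` {..<d} \<union> b ` {..<m}"
  obtain B where B: "u ` {..<d} \<subseteq> B" "B \<subseteq> ?W" "independent B" "?W \<subseteq> span B"
    by (rule maximal_independent_subset_extend[of "u ` {..<d}" ?W]) (use ui in auto)
  have "b ` {..<m} \<subseteq> V" using ordered_basis_mem[OF b] by auto
  with uV B(2) have BV: "B \<subseteq> V" by blast
  have spanB: "span B = V"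
  proof
    show "span B \<subseteq> V" using BV ordered_basis_subspace[OF b] by (rule span_minimal)
    have "b ` {..<m} \<subseteq> span B" using B(4) by auto
    then have "span (b ` {..<m}) \<subseteq> span B" using span_minimal subspace_span by blast
    then show "V \<subseteq> span B" using basis_facts(3) by simp
  qed
  have finB: "finite B" using B(2) by (rule finite_subset) auto
  have cardB: "card B = m"
    using ordered_basis_dim[OF b] dim_eq_card_independent[OF B(3)] dim_span[of B] spanB by simp
  define I' where "I' = {l \<in> {..<m}. b l \<in> B - u ` {..<d}}"
  have "b ` I' = B - u ` {..<d}" using B(2) by (auto simp: I'_def)
  moreover have "inj_on b I'" using basis_facts(1) by (rule inj_on_subset) (auto simp: I'_def)
  ultimately have "card I' = card (B - u ` {..<d})" using card_image by metis
  also have "\<dots> = m - d" using B(1) cardB card_image[OF ui(1)] by (simp add: card_Diff_subset)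
  finally have cI': "card I' = m - d" .
  have dm: "d \<le> m" using card_mono[OF finB B(1)] cardB card_image[OF ui(1)] by simp
  define I where "I = {..<m} - I'"
  have "I' \<subseteq> {..<m}" by (auto simp: I'_def)
  then have "card I = m - (m - d)"
    unfolding I_def using finite_subset[of I' "{..<m}"] by (simp add: card_Diff_subset cI')
  then have I: "I \<in> plucker_index d m" using dm by (auto simp: plucker_index_def I_def)
  let ?A = "coord_matrix b m u"
  have "minor d ?A I \<noteq> 0"
  proof
    assume "minor d ?A I = 0"
    then obtain x where x: "\<exists>a<d. x a \<noteq> 0"
      "\<And>c. c < d \<Longrightarrow> (\<Sum>a<d. x a * ?A a (sorted_list_of_set I ! c)) = 0"
      using det_eq_0_imp_left_kernel[of d "\<lambda>a c. ?A a (sorted_list_of_set I ! c)"]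
      unfolding minor_def by blast
    have xI: "(\<Sum>a<d. x a * ?A a l) = 0" if "l \<in> I" for l
      using x(2) that plucker_index_nth(1,2)[OF I] by (metis in_set_conv_nth)
    define w where "w = (\<Sum>a<d. scale (x a) (u a))"
    have "w = (\<Sum>a<d. scale (x a) (row_vector b m ?A a))"
      unfolding w_def using uV by (intro sum.cong) (auto simp: row_vector_coord_matrix)
    also have "\<dots> = (\<Sum>l<m. scale (\<Sum>a<d. x a * ?A a l) (b l))" by (rule sum_row_vectors)
    also have "\<dots> = (\<Sum>l\<in>I'. scale (\<Sum>a<d. x a * ?A a l) (b l))"
      by (rule sum.mono_neutral_right) (auto simp: I'_def xI I_def)
    also have "\<dots> \<in> span (B - u ` {..<d})"
      by (intro span_sum span_scale span_base) (auto simp: I'_def)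
    finally have w1: "w \<in> span (B - u ` {..<d})" .
    have "w \<in> span (u ` {..<d})" unfolding w_def by (intro span_sum span_scale span_base) auto
    moreover have "u ` {..<d} \<inter> (B - u ` {..<d}) = {}" by auto
    ultimately have "w = 0"
    proof -
      assume w2: "w \<in> span (u ` {..<d})"
      have "representation B w v = 0" for v
      proof -
        have "representation (u ` {..<d}) w v = representation B w v"
          using representation_extend[OF B(3) w2 B(1)] by simp
        moreover have "representation (B - u ` {..<d}) w v = representation B w v"
          using representation_extend[OF B(3) w1] by simp
        ultimately show ?thesis
          using representation_ne_zero[of "u ` {..<d}" w v] representation_ne_zero[of "B - u ` {..<d}" w v] by auto
      qed
      then have "(\<Sum>v\<in>B. scale (representation B w v) v) = 0" by simp
      then show "w = 0"
        using sum_representation_eq[OF B(3) _ finB, of w] w2 span_mono[OF B(1)] by auto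
    qed
    then show False using x(1) ordered_basis_family[OF u, of x] by (auto simp: w_def)
  qed
  with I show thesis by (rule that)
qed

lemma plucker_vector_change_basis:
  assumes u: "ordered_basis u d U" and u': "ordered_basis u' d U" and UV: "U \<subseteq> V"
  obtains c where "c \<noteq> 0" "plucker_vector b m d u' = (\<lambda>I. c * plucker_vector b m d u I)"
proof -
  have "\<exists>c. u' a = (\<Sum>k<d. scale (c k) (u k))" if "a < d" for a
    using ordered_basis_coords[OF u ordered_basis_mem[OF u' that]] by metis
  then obtain C where C: "\<And>a. a < d \<Longrightarrow> u' a = (\<Sum>k<d. scale (C a k) (u k))" by metis
  let ?A = "coord_matrix b m u"
  have A': "coord_matrix b m u' a l = (\<Sum>k<d. C a k * ?A k l)" if "a < d" "l < m" for a l
  proof -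
    have "row_vector b m (\<lambda>a l. \<Sum>k<d. C a k * ?A k l) a = (\<Sum>k<d. scale (C a k) (u k))"
      unfolding row_vector_mult using subsetD[OF UV ordered_basis_mem[OF u]]
      by (intro sum.cong) (auto simp: row_vector_coord_matrix)
    then have "u' a = row_vector b m (\<lambda>a l. \<Sum>k<d. C a k * ?A k l) a" using C that by simp
    then have "coord_matrix b m u' a l = coord_matrix b m (row_vector b m (\<lambda>a l. \<Sum>k<d. C a k * ?A k l)) a l"
      by (simp add: coord_matrix_def)
    then show ?thesis by (simp add: coord_matrix_row_vector that)
  qed
  let ?c = "det (mat d d (\<lambda>(a, k). C a k))"
  have eq: "minor d (coord_matrix b m u') I = ?c * minor d ?A I" if "I \<in> plucker_index d m" for I
    using minor_cong[OF that A'] by (simp add: minor_mult)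
  obtain I where I: "I \<in> plucker_index d m" "minor d (coord_matrix b m u') I \<noteq> 0"
    by (rule ordered_basis_imp_nonzero_minor[OF u' UV])
  show thesis
  proof (rule that[of ?c])
    show "?c \<noteq> 0" using eq[OF I(1)] I(2) by auto
    show "plucker_vector b m d u' = (\<lambda>I. ?c * plucker_vector b m d u I)"
      using eq by (auto simp: plucker_vector_eq fun_eq_iff)
  qed
qed

lemma plucker_point_eq:
  assumes u: "ordered_basis u d U" and UV: "U \<subseteq> V"
  shows "plucker_point b m d U = proj_line (plucker_vector b m d u)"
proof -
  have "proj_line (plucker_vector b m d u') = proj_line (plucker_vector b m d u)"
    if u': "ordered_basis u' d U" for u'
  proof -
    obtain c where "c \<noteq> 0" "plucker_vector b m d u' = (\<lambda>I. c * plucker_vector b m d u I)"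
      by (rule plucker_vector_change_basis[OF u u' UV])
    then show ?thesis by (simp add: proj_line_scale)
  qed
  then show ?thesis unfolding plucker_point_def using u by blast
qed

lemma plucker_point_rational:
  assumes U: "U \<in> Gr d V"
  shows "plucker_point b m d U \<in> rational_points (plucker_index d m) (plucker_ideal d m)"
proof -
  have UV: "U \<subseteq> V" using U by (simp add: Gr_def)
  obtain u where u: "ordered_basis u d U" by (rule ex_ordered_basis[of U d]) (use U in \<open>auto simp: Gr_def\<close>)
  obtain I where I: "I \<in> plucker_index d m" "minor d (coord_matrix b m u) I \<noteq> 0"
    by (rule ordered_basis_imp_nonzero_minor[OF u UV])
  show ?thesis
    unfolding plucker_point_eq[OF u UV] rational_points_def
  proof (intro CollectI exI[of _ "plucker_vector b m d u"] conjI ballI allI impI bexI[of _ I])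
    show "plucker_vector b m d u I \<noteq> 0" using I by (simp add: plucker_vector_eq)
    show "poly_subst (\<lambda>c. c) (plucker_vector b m d u) f = 0" if "f \<in> plucker_ideal d m" for f
      by (rule plucker_ideal_vanishes_on_minors[OF that comm_ring_hom_id, of _ 1 "coord_matrix b m u"])
         (simp add: plucker_vector_eq)
  qed (use I in \<open>auto simp: plucker_vector_eq\<close>)
qed

text \<open>
  The rows of \<open>adj(A\<^sub>I) A\<close> lie in the row space and, by Cramer's rule, depend only on the Pluecker
  coordinates. Two subspaces with proportional coordinates thus share \<open>d\<close> independent vectors.
\<close>

lemma plucker_point_inj: "inj_on (plucker_point b m d) (Gr d V)"
proof (rule inj_onI)
  fix U U' assume U: "U \<in> Gr d V" and U': "U' \<in> Gr d V" and eq: "plucker_point b m d U = plucker_point b m d U'"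
  have UV: "U \<subseteq> V" and UV': "U' \<subseteq> V" using U U' by (auto simp: Gr_def)
  obtain u where u: "ordered_basis u d U" by (rule ex_ordered_basis[of U d]) (use U in \<open>auto simp: Gr_def\<close>)
  obtain u' where u': "ordered_basis u' d U'" by (rule ex_ordered_basis[of U' d]) (use U' in \<open>auto simp: Gr_def\<close>)
  let ?A = "coord_matrix b m u" and ?A' = "coord_matrix b m u'"
  obtain I0 where I0: "I0 \<in> plucker_index d m" "minor d ?A I0 \<noteq> 0"
    by (rule ordered_basis_imp_nonzero_minor[OF u UV])
  obtain c where c: "c \<noteq> 0" "plucker_vector b m d u' = (\<lambda>I. c * plucker_vector b m d u I)"
    using eq unfolding plucker_point_eq[OF u UV] plucker_point_eq[OF u' UV'] by (rule proj_line_eqD)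
  have min: "minor d ?A' I = c * minor d ?A I" if "I \<in> plucker_index d m" for I
    using fun_cong[OF c(2), of I] that by (simp add: plucker_vector_eq)
  let ?Q = "\<lambda>A a l. column_det d A (replace_at I0 a l)"
  have Q: "?Q ?A' a l = c * ?Q ?A a l" if l: "l < m" for a l
  proof -
    obtain \<epsilon> :: int and I where "I \<in> plucker_index d m"
      "\<And>A :: nat \<Rightarrow> nat \<Rightarrow> 'k. column_det d A (replace_at I0 a l) = of_int \<epsilon> * minor d A I"
      using replaced_columns_eq_signed_minor[OF I0(1) l, of a] by blast
    then show ?thesis using min by simp
  qed
  have mem: "row_vector b m (?Q (coord_matrix b m u)) a \<in> U" if "a < d" "ordered_basis u d U" "U \<subseteq> V" for a u U
  proof -
    let ?C = "adj_mat (mat d d (\<lambda>(a, c). coord_matrix b m u a (sorted_list_of_set I0 ! c)))"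
    have "row_vector b m (?Q (coord_matrix b m u)) a =
        row_vector b m (\<lambda>a l. \<Sum>k<d. ?C $$ (a, k) * coord_matrix b m u k l) a"
      unfolding row_vector_def by (simp add: cramer_columns[OF that(1)])
    also have "\<dots> = (\<Sum>k<d. scale (?C $$ (a, k)) (row_vector b m (coord_matrix b m u) k))"
      by (rule row_vector_mult)
    also have "\<dots> = (\<Sum>k<d. scale (?C $$ (a, k)) (u k))"
      using subsetD[OF that(3) ordered_basis_mem[OF that(2)]]
      by (intro sum.cong) (auto simp: row_vector_coord_matrix)
    also have "\<dots> \<in> U"
      using ordered_basis_mem[OF that(2)] ordered_basis_subspace[OF that(2)]
      by (intro subspace_sum subspace_scale) auto
    finally show ?thesis .
  qed
  let ?w = "row_vector b m (?Q ?A)"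
  have "minor d ?A I0 * minor d (?Q ?A) I0 \<noteq> 0"
    unfolding minor_of_replaced_columns using I0(2) by simp
  then have "ordered_basis ?w d (span (?w ` {..<d}))"
    by (intro nonzero_minor_imp_ordered_basis[OF I0(1)]) auto
  then have dimw: "dim (span (?w ` {..<d})) = d" by (rule ordered_basis_dim)
  have wU: "span (?w ` {..<d}) \<subseteq> U"
    using mem[OF _ u UV] ordered_basis_subspace[OF u] by (intro span_minimal) auto
  have wU': "span (?w ` {..<d}) \<subseteq> U'"
  proof (rule span_minimal[OF _ ordered_basis_subspace[OF u']], clarify)
    fix a assume "a < d"
    then have "row_vector b m (?Q ?A') a \<in> U'" using mem[OF _ u' UV'] by blast
    moreover have "row_vector b m (?Q ?A') a = scale c (?w a)"
      by (simp add: row_vector_def Q scale_sum_right)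
    ultimately have "scale (1 / c) (scale c (?w a)) \<in> U'"
      using subspace_scale[OF ordered_basis_subspace[OF u']] by metis
    then show "?w a \<in> U'" using c(1) by simp
  qed
  have "span (?w ` {..<d}) = U"
    using U dimw by (intro subspace_eq_of_dim[OF subspace_span _ wU]) (auto simp: Gr_def)
  moreover have "span (?w ` {..<d}) = U'"
    using U' dimw by (intro subspace_eq_of_dim[OF subspace_span _ wU']) (auto simp: Gr_def)
  ultimately show "U = U'" by simp
qed

text \<open>
  A representative with one coordinate equal to \<open>1\<close> is chosen; the relations still vanish on it,
  since their homogeneous components do.
\<close>

lemma plucker_point_surj:
  assumes "p \<in> rational_points (plucker_index d m) (plucker_ideal d m)"
  shows "p \<in> plucker_point b m d ` Gr d V"
proof -
  obtain v I0 where p: "p = proj_line v" and I0: "I0 \<in> plucker_index d m" "v I0 \<noteq> 0"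
    and out: "\<And>I. I \<notin> plucker_index d m \<Longrightarrow> v I = 0"
    and van: "\<And>f. f \<in> plucker_ideal d m \<Longrightarrow> poly_subst (\<lambda>c. c) v f = 0"
    using assms by (auto simp: rational_points_def)
  define v' where "v' = (\<lambda>I. (1 / v I0) * v I)"
  have pv': "p = proj_line v'" unfolding v'_def p using I0(2) by (subst proj_line_scale) auto
  have van': "poly_subst (\<lambda>c. c) v' f = 0" if f: "f \<in> plucker_ideal d m" for f
  proof -
    have i: "poly_subst (\<lambda>c. c) v (hom_component D f) = 0" for D
    proof (cases "d \<le> m")
      case True
      then have "hom_component D f \<in> plucker_ideal d m"
        using plucker_ideal_in_Proj_points[OF True, where 'k = 'k] f by (simp add: Proj_points_def)
      then show ?thesis by (rule van)
    next
      case False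
      then have "plucker_index d m = {}"
        by (auto simp: plucker_index_def dest!: card_mono[OF finite_lessThan])
      then show ?thesis using I0(1) by simp
    qed
    obtain N where "poly_subst (\<lambda>c. c) v' f = (\<Sum>D\<le>N. (1 / v I0) ^ D * poly_subst (\<lambda>c. c) v (hom_component D f))"
      unfolding v'_def using poly_subst_scaled[OF comm_ring_hom_id, of "1 / v I0" v f] by blast
    then show ?thesis by (simp add: i)
  qed
  have "v' I0 = 1" using I0(2) by (simp add: v'_def)
  from plucker_point_is_minor_vector[OF I0(1) this van'] obtain A
    where A: "\<And>J. J \<in> plucker_index d m \<Longrightarrow> minor d A J = v' J" by blast
  let ?u = "row_vector b m A"
  let ?U = "span (?u ` {..<d})"
  have u: "ordered_basis ?u d ?U"
    using A[OF I0(1)] \<open>v' I0 = 1\<close> by (intro nonzero_minor_imp_ordered_basis[OF I0(1)]) auto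
  have UV: "?U \<subseteq> V"
    using row_vector_in_V ordered_basis_subspace[OF b] by (intro span_minimal) auto
  have "plucker_vector b m d ?u = v'"
  proof
    fix I
    show "plucker_vector b m d ?u I = v' I"
    proof (cases "I \<in> plucker_index d m")
      case True
      then show ?thesis
        using minor_cong[OF True, of "coord_matrix b m ?u" A] by (simp add: plucker_vector_eq coord_matrix_row_vector A)
    qed (simp add: plucker_vector_eq v'_def out)
  qed
  then have "plucker_point b m d ?U = p" using plucker_point_eq[OF u UV] pv' by simp
  moreover have "?U \<in> Gr d V" using UV ordered_basis_dim[OF u] by (simp add: Gr_def)
  ultimately show ?thesis by blast
qed

proposition bij_betw_plucker_point:
  "bij_betw (plucker_point b m d) (Gr d V) (rational_points (plucker_index d m) (plucker_ideal d m))"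
  unfolding bij_betw_def using plucker_point_inj plucker_point_rational plucker_point_surj by blast

end

end

section \<open>The fibre as a variety\<close>

lemma projective_variety_transport_structure:
  assumes "projective_variety X" "bij_betw g (vpoints X) Y"
  shows "projective_variety (transport_structure g X)"
proof -
  have "bij_betw (inv_into (vpoints X) g) (g ` vpoints X) (vpoints X)"
    using assms(2) by (metis bij_betw_imp_surj_on bij_betw_inv_into)
  from bij_betw_trans[OF this, of "vembed X" "rational_points (vcoords X) (videal X)"] show ?thesis
    using assms(1) by (simp add: projective_variety_def transport_structure_def comp_def)
qed

theorem corollary6p5:
  fixes scale :: "'k::field \<Rightarrow> 'a::ring_1 \<Rightarrow> 'a"
    and e b :: "nat \<Rightarrow> 'a" and t n i j m s :: nat
  assumes "fd_algebra scale"
    and "complete_primitive_orthogonal e t"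
    and "basic_idempotents e t"
    and "fd_algebra.split_idempotents scale e t"
    and "n \<ge> 1" and "radical_power n = ({0} :: 'a set)"
    and "i \<in> {1..t}" and "j \<in> {1..t}"
    and "peirce_top e n i j \<noteq> {0}"
    and "m = vector_space.dim scale (peirce_top e n i j)"
    and "1 \<le> s" and "s \<le> m"
    and "fd_algebra.ordered_basis scale b m (peirce_top e n i j)"
  defines "G \<equiv> fd_algebra.Grassmannian scale b m (m - s)"
    and "\<Phi> \<equiv> fd_algebra.fibre_class scale e t n i j s"
    and "F \<equiv> fd_algebra.ambiguity_fibre scale e t n i j s"
  shows "bij_betw \<Phi> (fd_algebra.Gr scale (m - s) (peirce_top e n i j)) F
    \<and> vpoints (transport_structure \<Phi> G) = F
    \<and> projective_variety (transport_structure \<Phi> G)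
    \<and> variety_dim (transport_structure \<Phi> G) = ereal (real (s * (m - s)))"
proof -
  interpret fd_algebra scale by fact
  interpret basic_split_algebra scale e t n
    using assms by unfold_locales
  have m: "m = dim (V i j)" and b: "ordered_basis b m (V i j)" using assms by simp_all
  have bij: "bij_betw \<Phi> (Gr (m - s) (V i j)) F"
    unfolding \<Phi>_def F_def using bij_betw_fibre_class[of i j s] assms(7,8,11,12) m by simp
  have pts: "vpoints G = Gr (m - s) (V i j)"
    using b by (simp add: G_def Grassmannian_def ordered_basis_def)
  have "vembed G = plucker_point b m (m - s)" "vcoords G = plucker_index (m - s) m"
    "videal G = plucker_ideal (m - s) m" by (simp_all add: G_def Grassmannian_def)
  then have "projective_variety G"
    using plucker_ideal_in_Proj_points[of "m - s" m] bij_betw_plucker_point[OF b]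
    by (simp add: projective_variety_def finite_plucker_index pts)
  then have "projective_variety (transport_structure \<Phi> G)"
    using bij pts by (intro projective_variety_transport_structure) simp_all
  moreover have "variety_dim (transport_structure \<Phi> G) = ereal (real ((m - s) * (m - (m - s))))"
    using Proj_dim_plucker_ideal[of "m - s" m, where 'k = 'k]
    by (simp add: variety_dim_def transport_structure_def G_def Grassmannian_def)
  moreover have "(m - s) * (m - (m - s)) = s * (m - s)" using assms(12) by simp
  moreover have "vpoints (transport_structure \<Phi> G) = F"
    using bij pts by (simp add: transport_structure_def bij_betw_def)
  ultimately show ?thesis using bij by simp
qed

end
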